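(* Let $H$ be a Hopf algebra with bijective antipode over a field $k$ and let $C$ be a right $H$-module coalgebra. There is a bijection between the set $Z^2_{\rm Harr}(H,C)$ of Harrison 2-cocycles corresponding to the trivial weak coaction and the set $Z^2_{\rm tw}(H,C\otimes H)$ of twisted 2-cocycles $C\otimes H\to H\otimes H$.
   Context: All maps are $k$-linear; $\Delta(c)=c_1\otimes c_2$ (Sweedler notation, summation understood). $S$ is the antipode of $H$ and $\bar S$ its composition inverse. A right $H$-module coalgebra is a coalgebra $C$ that is a right $H$-module with $\Delta(c\cdot h)=c_1\cdot h_1\otimes c_2\cdot h_2$ and $\varepsilon_C(c\cdot h)=\varepsilon_C(c)\varepsilon_H(h)$. $Z^2_{\rm Harr}(H,C)$ (Harrison 2-cocycles for the trivial weak coaction $\rho(c)=1\otimes c$) is the set of linear maps $\alpha:C\to H\otimes H$, $\alpha(c)=\alpha_1(c)\otimes\alpha_2(c)$, such that for all $c\in C$: (i) $(\varepsilon_H\otimes id)\alpha(c)=(id\otimes\varepsilon_H)\alpha(c)=\varepsilon_C(c)1_H$; (ii) $\alpha_1(c_2)\otimes\alpha_1(c_1)\alpha_2(c_2)_1\otimes\alpha_2(c_1)\alpha_2(c_2)_2=\alpha_1(c_1)\alpha_1(c_2)_1\otimes\alpha_2(c_1)\alpha_1(c_2)_2\otimes\alpha_2(c_2)$; (iii) $\alpha_1(c_2)\otimes\alpha_2(c_2)\otimes c_1=\alpha_1(c_1)\otimes\alpha_2(c_1)\otimes c_2$. For a right $H$-module coalgebra $D$, a twisted 2-cocycle on $D$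 is a linear map $\alpha:D\to H\otimes H$, $\alpha(d)=\alpha_1(d)\otimes\alpha_2(d)$, such that for all $d\in D$, $h\in H$: (a) $(id_H\otimes\varepsilon_H)\alpha(d)=(\varepsilon_H\otimes id_H)\alpha(d)=\varepsilon_D(d)1_H$; (b) $\alpha(d\cdot h)=S(h_1)\alpha_1(d)h_2\otimes\bar S(h_4)\alpha_2(d)h_3$; (c) $\alpha_1(d_1)\alpha_1(d_3)_1\otimes d_2\cdot\alpha_2(d_1)\alpha_1(d_3)_2\otimes\alpha_2(d_3)=\alpha_1(d_1)\otimes d_2\cdot\alpha_1(d_3)\alpha_2(d_1)_1\otimes\alpha_2(d_3)\alpha_2(d_1)_2$. (In (c), $d_2\cdot xy$ means $d_2\cdot(xy)$.) $Z^2_{\rm tw}(H,C\otimes H)$ is the set of twisted 2-cocycles on $D=C\otimes H$, which is the tensor product coalgebra with right $H$-action $(c\otimes h)\cdot g=c\otimes hg$. *)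

theory Defs
  imports "HOL-Algebra.Module" "HOL-Library.FuncSet"
begin

section \<open>Tensor products of modules\<close>

text \<open>
  A list \<open>[(v1, w1), ..., (vn, wn)]\<close> stands for the formal sum of the \<open>vi \<otimes> wi\<close>.
  The tensor product is the quotient of these formal sums by the smallest congruence that makes
  the formal sum commutative and the pairing balanced and biadditive. Formal coefficients are not
  needed because a scalar can be absorbed in the first component.
\<close>

type_synonym ('a, 'b) tensor = "('a \<times> 'b) list set"

inductive tensor_eq ::
    "('k, 'p) ring_scheme \<Rightarrow> ('k, 'a, 'q) module_scheme \<Rightarrow> ('k, 'b, 'r) module_scheme \<Rightarrow>
     ('a \<times> 'b) list \<Rightarrow> ('a \<times> 'b) list \<Rightarrow> bool"
  for K M N where
  refl: "set xs \<subseteq> carrier M \<times> carrier N \<Longrightarrow> tensor_eq K M N xs xs"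
| sym: "tensor_eq K M N xs ys \<Longrightarrow> tensor_eq K M N ys xs"
| trans: "tensor_eq K M N xs ys \<Longrightarrow> tensor_eq K M N ys zs \<Longrightarrow> tensor_eq K M N xs zs"
| append: "tensor_eq K M N xs xs' \<Longrightarrow> tensor_eq K M N ys ys' \<Longrightarrow>
    tensor_eq K M N (xs @ ys) (xs' @ ys')"
| comm: "set xs \<subseteq> carrier M \<times> carrier N \<Longrightarrow> set ys \<subseteq> carrier M \<times> carrier N \<Longrightarrow>
    tensor_eq K M N (xs @ ys) (ys @ xs)"
| zero: "w \<in> carrier N \<Longrightarrow> tensor_eq K M N [(\<zero>\<^bsub>M\<^esub>, w)] []"
| add_left: "u \<in> carrier M \<Longrightarrow> v \<in> carrier M \<Longrightarrow> w \<in> carrier N \<Longrightarrow>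
    tensor_eq K M N [(u \<oplus>\<^bsub>M\<^esub> v, w)] [(u, w), (v, w)]"
| add_right: "v \<in> carrier M \<Longrightarrow> w \<in> carrier N \<Longrightarrow> z \<in> carrier N \<Longrightarrow>
    tensor_eq K M N [(v, w \<oplus>\<^bsub>N\<^esub> z)] [(v, w), (v, z)]"
| balanced: "a \<in> carrier K \<Longrightarrow> v \<in> carrier M \<Longrightarrow> w \<in> carrier N \<Longrightarrow>
    tensor_eq K M N [(a \<odot>\<^bsub>M\<^esub> v, w)] [(v, a \<odot>\<^bsub>N\<^esub> w)]"

definition tensor_class ::
    "('k, 'p) ring_scheme \<Rightarrow> ('k, 'a, 'q) module_scheme \<Rightarrow> ('k, 'b, 'r) module_scheme \<Rightarrow>
     ('a \<times> 'b) list \<Rightarrow> ('a, 'b) tensor" where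
  "tensor_class K M N xs = {ys. tensor_eq K M N xs ys}"

definition ptensor ::
    "('k, 'p) ring_scheme \<Rightarrow> ('k, 'a, 'q) module_scheme \<Rightarrow> ('k, 'b, 'r) module_scheme \<Rightarrow>
     'a \<Rightarrow> 'b \<Rightarrow> ('a, 'b) tensor" where
  "ptensor K M N v w = tensor_class K M N [(v, w)]"

definition tensor_rep :: "('a, 'b) tensor \<Rightarrow> ('a \<times> 'b) list" where
  "tensor_rep t = (SOME xs. xs \<in> t)"

text \<open>
  Multiplication is the componentwise one, \<open>(a \<otimes> b)(c \<otimes> d) = ac \<otimes> bd\<close>; it and the unit are
  meaningful only if both factors are algebras.
\<close>

definition tensor_product ::
    "('k, 'p) ring_scheme \<Rightarrow> ('k, 'a, 'q) module_scheme \<Rightarrow> ('k, 'b, 'r) module_scheme \<Rightarrow>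
     ('k, ('a, 'b) tensor) module" where
  "tensor_product K M N =
    \<lparr>carrier = tensor_class K M N ` {xs. set xs \<subseteq> carrier M \<times> carrier N},
     mult = (\<lambda>s t. tensor_class K M N
       [(a \<otimes>\<^bsub>M\<^esub> c, b \<otimes>\<^bsub>N\<^esub> d). (a, b) \<leftarrow> tensor_rep s, (c, d) \<leftarrow> tensor_rep t]),
     one = ptensor K M N \<one>\<^bsub>M\<^esub> \<one>\<^bsub>N\<^esub>,
     zero = tensor_class K M N [],
     add = (\<lambda>s t. tensor_class K M N (tensor_rep s @ tensor_rep t)),
     smult = (\<lambda>x t. tensor_class K M N [(x \<odot>\<^bsub>M\<^esub> v, w). (v, w) \<leftarrow> tensor_rep t])\<rparr>"

text \<open>
  \<open>tsum U t (\<lambda>v w. f v w)\<close> is Sweedler notation: the value at \<open>t\<close> of the linear map into \<open>U\<close>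
  with \<open>v \<otimes> w \<mapsto> f v w\<close>. It is independent of the chosen representative when \<open>f\<close> is
  bilinear (lemma \<open>tsum_tensor_class\<close> below).
\<close>

definition tsum :: "('u, 'p) ring_scheme \<Rightarrow> ('a, 'b) tensor \<Rightarrow> ('a \<Rightarrow> 'b \<Rightarrow> 'u) \<Rightarrow> 'u" where
  "tsum U t f = foldr (\<lambda>(v, w) u. f v w \<oplus>\<^bsub>U\<^esub> u) (tensor_rep t) \<zero>\<^bsub>U\<^esub>"

abbreviation tensor_product3 where
  "tensor_product3 K L M N \<equiv> tensor_product K L (tensor_product K M N)"

abbreviation ptensor3 where
  "ptensor3 K L M N x y z \<equiv> ptensor K L (tensor_product K M N) x (ptensor K M N y z)"

section \<open>Linear maps\<close>

definition linear_map ::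
    "('k, 'p) ring_scheme \<Rightarrow> ('k, 'a, 'q) module_scheme \<Rightarrow> ('k, 'b, 'r) module_scheme \<Rightarrow>
     ('a \<Rightarrow> 'b) \<Rightarrow> bool" where
  "linear_map K M N f \<longleftrightarrow>
    f \<in> carrier M \<rightarrow> carrier N \<and>
    (\<forall>x\<in>carrier M. \<forall>y\<in>carrier M. f (x \<oplus>\<^bsub>M\<^esub> y) = f x \<oplus>\<^bsub>N\<^esub> f y) \<and>
    (\<forall>a\<in>carrier K. \<forall>x\<in>carrier M. f (a \<odot>\<^bsub>M\<^esub> x) = a \<odot>\<^bsub>N\<^esub> f x)"

definition bilinear_map ::
    "('k, 'p) ring_scheme \<Rightarrow> ('k, 'a, 'q) module_scheme \<Rightarrow> ('k, 'b, 'r) module_scheme \<Rightarrow>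
     ('k, 'u, 's) module_scheme \<Rightarrow> ('a \<Rightarrow> 'b \<Rightarrow> 'u) \<Rightarrow> bool" where
  "bilinear_map K M N U f \<longleftrightarrow>
    (\<forall>y\<in>carrier N. linear_map K M U (\<lambda>x. f x y)) \<and>
    (\<forall>x\<in>carrier M. linear_map K N U (f x))"

definition self_module :: "('k, 'p) ring_scheme \<Rightarrow> ('k, 'k) module" where
  "self_module K = \<lparr>carrier = carrier K, mult = mult K, one = one K, zero = zero K, add = add K,
     smult = mult K\<rparr>"

lemma tensor_eq_carrier:
  assumes "tensor_eq K M N xs ys" "module K M" "module K N"
  shows "set xs \<subseteq> carrier M \<times> carrier N" "set ys \<subseteq> carrier M \<times> carrier N"
proof -
  interpret M: module K M by fact
  interpret N: module K N by fact
  have "set xs \<subseteq> carrier M \<times> carrier N \<and> set ys \<subseteq> carrier M \<times> carrier N"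
    using assms(1) by (induction) auto
  then show "set xs \<subseteq> carrier M \<times> carrier N" "set ys \<subseteq> carrier M \<times> carrier N" by auto
qed

lemma tensor_rep_tensor_class:
  assumes "set xs \<subseteq> carrier M \<times> carrier N"
  shows "tensor_eq K M N xs (tensor_rep (tensor_class K M N xs))"
  using someI[of "tensor_eq K M N xs" xs, OF tensor_eq.refl[OF assms]]
  by (simp add: tensor_rep_def tensor_class_def)

lemma tsum_tensor_class:
  assumes "module K M" "module K N" "module K U" and f: "bilinear_map K M N U f"
    and xs: "set xs \<subseteq> carrier M \<times> carrier N"
  shows "tsum U (tensor_class K M N xs) f = foldr (\<lambda>(v, w) u. f v w \<oplus>\<^bsub>U\<^esub> u) xs \<zero>\<^bsub>U\<^esub>"
proof -
  interpret M: module K M by fact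
  interpret N: module K N by fact
  interpret U: module K U by fact
  let ?s = "\<lambda>xs. foldr (\<lambda>(v, w) u. f v w \<oplus>\<^bsub>U\<^esub> u) xs \<zero>\<^bsub>U\<^esub>"
  have cl: "f v w \<in> carrier U" if "v \<in> carrier M" "w \<in> carrier N" for v w
    using f that unfolding bilinear_map_def linear_map_def by blast
  have scl: "?s zs \<in> carrier U" if "set zs \<subseteq> carrier M \<times> carrier N" for zs
    using that by (induction zs) (auto intro!: U.M.add.m_closed cl)
  have app: "?s (ys @ zs) = ?s ys \<oplus>\<^bsub>U\<^esub> ?s zs"
    if "set ys \<subseteq> carrier M \<times> carrier N" "set zs \<subseteq> carrier M \<times> carrier N" for ys zs
    using that
  proof (induction ys)
    case Nil
    then show ?case using scl[of zs] by simp
  next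
    case (Cons y ys)
    then show ?case
      using scl[of ys] scl[of zs] by (cases y) (auto simp: U.M.add.m_assoc cl simp del: foldr_append)
  qed
  have fadd: "f (u \<oplus>\<^bsub>M\<^esub> v) w = f u w \<oplus>\<^bsub>U\<^esub> f v w"
    if "u \<in> carrier M" "v \<in> carrier M" "w \<in> carrier N" for u v w
    using f that unfolding bilinear_map_def linear_map_def by blast
  have fadd': "f v (w \<oplus>\<^bsub>N\<^esub> z) = f v w \<oplus>\<^bsub>U\<^esub> f v z"
    if "v \<in> carrier M" "w \<in> carrier N" "z \<in> carrier N" for v w z
    using f that unfolding bilinear_map_def linear_map_def by blast
  have fbal: "f (a \<odot>\<^bsub>M\<^esub> v) w = f v (a \<odot>\<^bsub>N\<^esub> w)"
    if "a \<in> carrier K" "v \<in> carrier M" "w \<in> carrier N" for a v w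
    using f that unfolding bilinear_map_def linear_map_def by metis
  have f0: "f \<zero>\<^bsub>M\<^esub> w = \<zero>\<^bsub>U\<^esub>" if w: "w \<in> carrier N" for w
    using fadd[of "\<zero>\<^bsub>M\<^esub>" "\<zero>\<^bsub>M\<^esub>" w] cl[of "\<zero>\<^bsub>M\<^esub>" w] w U.M.add.l_cancel_one by auto
  have "?s xs = ?s ys" if "tensor_eq K M N xs ys" for xs ys
    using that
  proof induction
    case (append xs xs' ys ys')
    then show ?case
      using tensor_eq_carrier[OF append.hyps(1) assms(1,2)]
        tensor_eq_carrier[OF append.hyps(2) assms(1,2)]
      by (simp only: app)
  next
    case (comm xs ys)
    then show ?case
      using scl[of xs] scl[of ys] by (simp only: app U.M.add.m_comm)
  qed (auto simp: f0 fadd fadd' fbal cl U.M.add.m_assoc)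
  then show ?thesis
    using tensor_rep_tensor_class[OF xs, of K] unfolding tsum_def by metis
qed

lemma tensor_class_eq: assumes "tensor_eq K M N xs ys" shows "tensor_class K M N xs = tensor_class K M N ys"
  using assms unfolding tensor_class_def by (auto intro: tensor_eq.sym tensor_eq.trans)

lemma tensor_product_module:
  assumes "module K M" "module K N"
  shows "module K (tensor_product K M N)"
proof -
  interpret M: module K M by fact
  interpret N: module K N by fact
  let ?T = "tensor_product K M N"
  let ?ok = "\<lambda>xs. set xs \<subseteq> carrier M \<times> carrier N"
  let ?c = "tensor_class K M N"
  have car: "carrier ?T = {?c xs |xs. ?ok xs}" by (auto simp: tensor_product_def)
  have rep: "tensor_eq K M N (tensor_rep (?c xs)) xs" if "?ok xs" for xs
    using tensor_rep_tensor_class[OF that] by (rule tensor_eq.sym)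
  have add: "?c xs \<oplus>\<^bsub>?T\<^esub> ?c ys = ?c (xs @ ys)" if "?ok xs" "?ok ys" for xs ys
    unfolding tensor_product_def using that by (auto intro!: tensor_class_eq tensor_eq.append rep)
  let ?m = "\<lambda>a. map (\<lambda>(v,w). (a \<odot>\<^bsub>M\<^esub> v, w))"
  have sm: "tensor_eq K M N (?m a xs) (?m a ys)" if "tensor_eq K M N xs ys" "a \<in> carrier K" for a xs ys
    using that(1)
  proof induction
    case (refl xs) then show ?case using that by (intro tensor_eq.refl) auto
  next case (sym xs ys) then show ?case by (blast intro: tensor_eq.sym)
  next case (trans xs ys zs) then show ?case by (blast intro: tensor_eq.trans)
  next case (append xs xs' ys ys') then show ?case by (auto intro: tensor_eq.append)
  next case (comm xs ys) then show ?case using that by (auto intro!: tensor_eq.comm simp: subset_iff)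
  next case (zero w) then show ?case using that by (auto intro: tensor_eq.zero)
  next case (add_left u v w) then show ?case using that by (auto simp: M.smult_r_distr intro: tensor_eq.add_left)
  next case (add_right) then show ?case using that by (auto intro: tensor_eq.add_right)
  next case (balanced b v w)
    have "a \<odot>\<^bsub>M\<^esub> (b \<odot>\<^bsub>M\<^esub> v) = b \<odot>\<^bsub>M\<^esub> (a \<odot>\<^bsub>M\<^esub> v)"
      using balanced that by (metis M.smult_assoc1 M.R.m_comm)
    then show ?case using that balanced by (auto intro: tensor_eq.balanced)
  qed
  have smult: "a \<odot>\<^bsub>?T\<^esub> ?c xs = ?c (?m a xs)" if "?ok xs" "a \<in> carrier K" for a xs
  proof -
    have "a \<odot>\<^bsub>?T\<^esub> ?c xs = ?c (?m a (tensor_rep (?c xs)))" by (simp add: tensor_product_def)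
    also have "\<dots> = ?c (?m a xs)" using that by (intro tensor_class_eq sm rep)
    finally show ?thesis .
  qed
  have zero: "\<zero>\<^bsub>?T\<^esub> = ?c []" by (simp add: tensor_product_def)
  have cls: "?c xs \<in> carrier ?T" if "?ok xs" for xs using that car by auto
  have okm: "?ok (?m a xs)" if "?ok xs" "a \<in> carrier K" for a xs using that by auto
  have l: "tensor_eq K M N (?m (a \<oplus>\<^bsub>K\<^esub> b) xs) (?m a xs @ ?m b xs)" if "?ok xs" "a \<in> carrier K" "b \<in> carrier K" for a b xs
    using that(1)
  proof (induction xs)
    case Nil then show ?case by (auto intro: tensor_eq.refl)
  next
    case (Cons x xs)
    obtain v w where x: "x = (v,w)" "v \<in> carrier M" "w \<in> carrier N" using Cons by (cases x) auto
    have "tensor_eq K M N ([((a \<oplus>\<^bsub>K\<^esub> b) \<odot>\<^bsub>M\<^esub> v, w)] @ ?m (a \<oplus>\<^bsub>K\<^esub> b) xs) ([(a \<odot>\<^bsub>M\<^esub> v,w),(b \<odot>\<^bsub>M\<^esub> v,w)] @ (?m a xs @ ?m b xs))"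
      using Cons that x by (intro tensor_eq.append) (auto simp: M.smult_l_distr intro: tensor_eq.add_left)
    moreover have "tensor_eq K M N ([(a \<odot>\<^bsub>M\<^esub> v,w)] @ (([(b \<odot>\<^bsub>M\<^esub> v,w)] @ ?m a xs) @ ?m b xs)) ([(a \<odot>\<^bsub>M\<^esub> v,w)] @ ((?m a xs @ [(b \<odot>\<^bsub>M\<^esub> v,w)]) @ ?m b xs))"
      using Cons that x okm[of xs] by (intro tensor_eq.append tensor_eq.comm tensor_eq.refl) auto
    ultimately show ?case using x by (auto intro: tensor_eq.trans)
  qed
  show ?thesis
  proof (rule moduleI)
    show "cring K" by (rule M.R.is_cring)
    show "abelian_group ?T"
    proof (rule abelian_groupI)
      fix x y z assume "x \<in> carrier ?T" "y \<in> carrier ?T" "z \<in> carrier ?T"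
      then obtain xs ys zs where [simp]: "x = ?c xs" "?ok xs" "y = ?c ys" "?ok ys" "z = ?c zs" "?ok zs" by (auto simp: car)
      show "x \<oplus>\<^bsub>?T\<^esub> y \<oplus>\<^bsub>?T\<^esub> z = x \<oplus>\<^bsub>?T\<^esub> (y \<oplus>\<^bsub>?T\<^esub> z)" by (simp add: add)
    next
      fix x y assume "x \<in> carrier ?T" "y \<in> carrier ?T"
      then obtain xs ys where [simp]: "x = ?c xs" "?ok xs" "y = ?c ys" "?ok ys" by (auto simp: car)
      show "x \<oplus>\<^bsub>?T\<^esub> y \<in> carrier ?T" by (simp add: add cls)
      show "x \<oplus>\<^bsub>?T\<^esub> y = y \<oplus>\<^bsub>?T\<^esub> x" by (simp add: add tensor_class_eq tensor_eq.comm)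
    next
      show "\<zero>\<^bsub>?T\<^esub> \<in> carrier ?T" by (simp add: zero cls)
    next
      fix x assume "x \<in> carrier ?T"
      then obtain xs where x[simp]: "x = ?c xs" "?ok xs" by (auto simp: car)
      show "\<zero>\<^bsub>?T\<^esub> \<oplus>\<^bsub>?T\<^esub> x = x" by (simp add: zero add)
      have "tensor_eq K M N (?m (\<ominus>\<^bsub>K\<^esub> \<one>\<^bsub>K\<^esub> \<oplus>\<^bsub>K\<^esub> \<one>\<^bsub>K\<^esub>) xs) (?m (\<ominus>\<^bsub>K\<^esub> \<one>\<^bsub>K\<^esub>) xs @ ?m \<one>\<^bsub>K\<^esub> xs)" using x by (intro l) auto
      moreover have "?m \<one>\<^bsub>K\<^esub> xs = xs" using x(2) by (induction xs) auto
      moreover have "tensor_eq K M N (?m \<zero>\<^bsub>K\<^esub> xs) []" using x(2)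
      proof (induction xs)
        case (Cons y ys)
        then have "tensor_eq K M N ([(\<zero>\<^bsub>M\<^esub>, snd y)] @ ?m \<zero>\<^bsub>K\<^esub> ys) ([]@[])"
          by (intro tensor_eq.append tensor_eq.zero) auto
        then show ?case using Cons by (cases y) auto
      qed (auto intro: tensor_eq.refl)
      ultimately have "tensor_eq K M N (?m (\<ominus>\<^bsub>K\<^esub> \<one>\<^bsub>K\<^esub>) xs @ xs) []"
        by (metis M.R.l_neg M.R.one_closed tensor_eq.sym tensor_eq.trans)
      then show "\<exists>y\<in>carrier ?T. y \<oplus>\<^bsub>?T\<^esub> x = \<zero>\<^bsub>?T\<^esub>"
        by (intro bexI[of _ "?c (?m (\<ominus>\<^bsub>K\<^esub> \<one>\<^bsub>K\<^esub>) xs)"]) (simp_all add: add zero tensor_class_eq cls okm del: set_map)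
    qed
  next
    fix a x assume a: "a \<in> carrier K" and "x \<in> carrier ?T"
    then obtain xs where x[simp]: "x = ?c xs" "?ok xs" by (auto simp: car)
    show "a \<odot>\<^bsub>?T\<^esub> x \<in> carrier ?T" using a by (simp add: smult cls okm del: set_map)
    fix b assume b: "b \<in> carrier K"
    show "(a \<oplus>\<^bsub>K\<^esub> b) \<odot>\<^bsub>?T\<^esub> x = a \<odot>\<^bsub>?T\<^esub> x \<oplus>\<^bsub>?T\<^esub> b \<odot>\<^bsub>?T\<^esub> x" using a b
      by (simp add: smult add okm tensor_class_eq l del: set_map)
    have "?m (a \<otimes>\<^bsub>K\<^esub> b) xs = ?m a (?m b xs)" using x(2) a b by (induction xs) (auto simp: M.smult_assoc1)
    then show "(a \<otimes>\<^bsub>K\<^esub> b) \<odot>\<^bsub>?T\<^esub> x = a \<odot>\<^bsub>?T\<^esub> (b \<odot>\<^bsub>?T\<^esub> x)" using a b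
      by (simp add: smult okm del: set_map map_map)
  next
    fix a x y assume a: "a \<in> carrier K" and "x \<in> carrier ?T" "y \<in> carrier ?T"
    then obtain xs ys where [simp]: "x = ?c xs" "?ok xs" "y = ?c ys" "?ok ys" by (auto simp: car)
    show "a \<odot>\<^bsub>?T\<^esub> (x \<oplus>\<^bsub>?T\<^esub> y) = a \<odot>\<^bsub>?T\<^esub> x \<oplus>\<^bsub>?T\<^esub> a \<odot>\<^bsub>?T\<^esub> y" using a
      by (simp add: smult add okm del: set_map)
  next
    fix x assume "x \<in> carrier ?T"
    then obtain xs where x[simp]: "x = ?c xs" "?ok xs" by (auto simp: car)
    have "?m \<one>\<^bsub>K\<^esub> xs = xs" using x(2) by (induction xs) auto
    then show "\<one>\<^bsub>K\<^esub> \<odot>\<^bsub>?T\<^esub> x = x" by (simp add: smult)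
  qed
qed
section \<open>Hopf algebras and module coalgebras\<close>

text \<open>
  The ring fields \<open>mult\<close> and \<open>one\<close> that a coalgebra inherits from the record \<open>module\<close> are unused.
\<close>

record ('k, 'a) coalgebra = "('k, 'a) module" +
  comult :: "'a \<Rightarrow> ('a, 'a) tensor"
  counit :: "'a \<Rightarrow> 'k"

record ('k, 'a) hopf_algebra = "('k, 'a) coalgebra" +
  antipode :: "'a \<Rightarrow> 'a"

text \<open>The library's locale \<open>algebra\<close> is restricted to commutative algebras.\<close>

locale assoc_algebra = R?: field K + module K A + M?: ring A
  for K (structure) and A (structure) +
  assumes smult_mult_left: "a \<in> carrier K \<Longrightarrow> x \<in> carrier A \<Longrightarrow> y \<in> carrier A \<Longrightarrow>
      (a \<odot>\<^bsub>A\<^esub> x) \<otimes>\<^bsub>A\<^esub> y = a \<odot>\<^bsub>A\<^esub> (x \<otimes>\<^bsub>A\<^esub> y)"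
    and smult_mult_right: "a \<in> carrier K \<Longrightarrow> x \<in> carrier A \<Longrightarrow> y \<in> carrier A \<Longrightarrow>
      x \<otimes>\<^bsub>A\<^esub> (a \<odot>\<^bsub>A\<^esub> y) = a \<odot>\<^bsub>A\<^esub> (x \<otimes>\<^bsub>A\<^esub> y)"

locale coalgebra = R?: field K + module K C
  for K (structure) and C (structure) +
  assumes comult_linear: "linear_map K C (tensor_product K C C) (comult C)"
    and counit_linear: "linear_map K C (self_module K) (counit C)"
    and coassoc: "c \<in> carrier C \<Longrightarrow>
      tsum (tensor_product3 K C C C) (comult C c) (\<lambda>c1 c2.
        tsum (tensor_product3 K C C C) (comult C c1) (\<lambda>c11 c12. ptensor3 K C C C c11 c12 c2)) =
      tsum (tensor_product3 K C C C) (comult C c) (\<lambda>c1 c2.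
        tsum (tensor_product3 K C C C) (comult C c2) (\<lambda>c21 c22. ptensor3 K C C C c1 c21 c22))"
    and counit_left: "c \<in> carrier C \<Longrightarrow>
      tsum C (comult C c) (\<lambda>c1 c2. counit C c1 \<odot>\<^bsub>C\<^esub> c2) = c"
    and counit_right: "c \<in> carrier C \<Longrightarrow>
      tsum C (comult C c) (\<lambda>c1 c2. counit C c2 \<odot>\<^bsub>C\<^esub> c1) = c"

locale hopf_algebra = assoc_algebra K H + coalgebra K H
  for K (structure) and H (structure) +
  assumes comult_mult: "x \<in> carrier H \<Longrightarrow> y \<in> carrier H \<Longrightarrow>
      comult H (x \<otimes>\<^bsub>H\<^esub> y) = comult H x \<otimes>\<^bsub>tensor_product K H H\<^esub> comult H y"
    and comult_one: "comult H \<one>\<^bsub>H\<^esub> = \<one>\<^bsub>tensor_product K H H\<^esub>"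
    and counit_mult: "x \<in> carrier H \<Longrightarrow> y \<in> carrier H \<Longrightarrow>
      counit H (x \<otimes>\<^bsub>H\<^esub> y) = counit H x \<otimes>\<^bsub>K\<^esub> counit H y"
    and counit_one: "counit H \<one>\<^bsub>H\<^esub> = \<one>\<^bsub>K\<^esub>"
    and antipode_linear: "linear_map K H H (antipode H)"
    and antipode_left: "h \<in> carrier H \<Longrightarrow>
      tsum H (comult H h) (\<lambda>h1 h2. antipode H h1 \<otimes>\<^bsub>H\<^esub> h2) = counit H h \<odot>\<^bsub>H\<^esub> \<one>\<^bsub>H\<^esub>"
    and antipode_right: "h \<in> carrier H \<Longrightarrow>
      tsum H (comult H h) (\<lambda>h1 h2. h1 \<otimes>\<^bsub>H\<^esub> antipode H h2) = counit H h \<odot>\<^bsub>H\<^esub> \<one>\<^bsub>H\<^esub>"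

definition antipode_inv :: "('k, 'h, 'p) hopf_algebra_scheme \<Rightarrow> 'h \<Rightarrow> 'h" where
  "antipode_inv H = inv_into (carrier H) (antipode H)"

locale right_module_coalgebra = H?: hopf_algebra K H + C?: coalgebra K C
  for K (structure) and H (structure) and C (structure) and act :: "'c \<Rightarrow> 'h \<Rightarrow> 'c" +
  assumes act_bilinear: "bilinear_map K C H C act"
    and act_one: "c \<in> carrier C \<Longrightarrow> act c \<one>\<^bsub>H\<^esub> = c"
    and act_mult: "c \<in> carrier C \<Longrightarrow> g \<in> carrier H \<Longrightarrow> h \<in> carrier H \<Longrightarrow>
      act c (g \<otimes>\<^bsub>H\<^esub> h) = act (act c g) h"
    and comult_act: "c \<in> carrier C \<Longrightarrow> h \<in> carrier H \<Longrightarrow>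
      comult C (act c h) =
      tsum (tensor_product K C C) (comult C c) (\<lambda>c1 c2.
        tsum (tensor_product K C C) (comult H h) (\<lambda>h1 h2. ptensor K C C (act c1 h1) (act c2 h2)))"
    and counit_act: "c \<in> carrier C \<Longrightarrow> h \<in> carrier H \<Longrightarrow>
      counit C (act c h) = counit C c \<otimes>\<^bsub>K\<^esub> counit H h"

definition tensor_coalgebra ::
    "('k, 'p) ring_scheme \<Rightarrow> ('k, 'a, 'q) coalgebra_scheme \<Rightarrow> ('k, 'b, 'r) coalgebra_scheme \<Rightarrow>
     ('k, ('a, 'b) tensor) coalgebra" where
  "tensor_coalgebra K C E =
    (let D = tensor_product K C E; DD = tensor_product K D D in
     module.extend D (coalgebra.fields
       (\<lambda>d. tsum DD d (\<lambda>c e.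
          tsum DD (comult C c) (\<lambda>c1 c2. tsum DD (comult E e) (\<lambda>e1 e2.
            ptensor K D D (ptensor K C E c1 e1) (ptensor K C E c2 e2)))))
       (\<lambda>d. tsum K d (\<lambda>c e. counit C c \<otimes>\<^bsub>K\<^esub> counit E e))))"

text \<open>The right action \<open>(c \<otimes> h) \<cdot> g = c \<otimes> hg\<close> on \<open>C \<otimes> H\<close>.\<close>

definition tensor_right_act ::
    "('k, 'p) ring_scheme \<Rightarrow> ('k, 'c, 'q) module_scheme \<Rightarrow> ('k, 'h, 'r) module_scheme \<Rightarrow>
     ('c, 'h) tensor \<Rightarrow> 'h \<Rightarrow> ('c, 'h) tensor" where
  "tensor_right_act K C H d g =
    tsum (tensor_product K C H) d (\<lambda>c h. ptensor K C H c (h \<otimes>\<^bsub>H\<^esub> g))"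

section \<open>Harrison and twisted 2-cocycles\<close>

text \<open>
  Linear maps on a carrier are taken to be \<open>undefined\<close> outside it (\<open>extensional\<close>), so that the
  elements of the two sets below correspond to the maps in the mathematical sense. Partially
  evaluated maps such as \<open>\<epsilon> \<otimes> id\<close> use the identification of \<open>K \<otimes> H\<close> with \<open>H\<close>.
\<close>

definition harrison_cocycles ::
    "('k, 'p) ring_scheme \<Rightarrow> ('k, 'h, 'q) hopf_algebra_scheme \<Rightarrow> ('k, 'c, 'r) coalgebra_scheme \<Rightarrow>
     ('c \<Rightarrow> ('h, 'h) tensor) set" where
  "harrison_cocycles K H C =
    (let T = tensor_product3 K H H H; T' = tensor_product3 K H H C in
     {\<alpha> \<in> extensional (carrier C). linear_map K C (tensor_product K H H) \<alpha> \<and>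
      (\<forall>c\<in>carrier C.
        tsum H (\<alpha> c) (\<lambda>a b. counit H a \<odot>\<^bsub>H\<^esub> b) = counit C c \<odot>\<^bsub>H\<^esub> \<one>\<^bsub>H\<^esub> \<and>
        tsum H (\<alpha> c) (\<lambda>a b. counit H b \<odot>\<^bsub>H\<^esub> a) = counit C c \<odot>\<^bsub>H\<^esub> \<one>\<^bsub>H\<^esub> \<and>
        tsum T (comult C c) (\<lambda>c1 c2. tsum T (\<alpha> c1) (\<lambda>a b. tsum T (\<alpha> c2) (\<lambda>x y.
          tsum T (comult H y) (\<lambda>y1 y2. ptensor3 K H H H x (a \<otimes>\<^bsub>H\<^esub> y1) (b \<otimes>\<^bsub>H\<^esub> y2))))) =
        tsum T (comult C c) (\<lambda>c1 c2. tsum T (\<alpha> c1) (\<lambda>a b. tsum T (\<alpha> c2) (\<lambda>x y.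
          tsum T (comult H x) (\<lambda>x1 x2. ptensor3 K H H H (a \<otimes>\<^bsub>H\<^esub> x1) (b \<otimes>\<^bsub>H\<^esub> x2) y)))) \<and>
        tsum T' (comult C c) (\<lambda>c1 c2. tsum T' (\<alpha> c2) (\<lambda>a b. ptensor3 K H H C a b c1)) =
        tsum T' (comult C c) (\<lambda>c1 c2. tsum T' (\<alpha> c1) (\<lambda>a b. ptensor3 K H H C a b c2)))})"

definition twisted_cocycles ::
    "('k, 'p) ring_scheme \<Rightarrow> ('k, 'h, 'q) hopf_algebra_scheme \<Rightarrow> ('k, 'd, 'r) coalgebra_scheme \<Rightarrow>
     ('d \<Rightarrow> 'h \<Rightarrow> 'd) \<Rightarrow> ('d \<Rightarrow> ('h, 'h) tensor) set" where
  "twisted_cocycles K H D act =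
    (let HH = tensor_product K H H; T = tensor_product3 K H D H;
         S = antipode H; S' = antipode_inv H in
     {\<alpha> \<in> extensional (carrier D). linear_map K D HH \<alpha> \<and>
      (\<forall>d\<in>carrier D.
        tsum H (\<alpha> d) (\<lambda>a b. counit H b \<odot>\<^bsub>H\<^esub> a) = counit D d \<odot>\<^bsub>H\<^esub> \<one>\<^bsub>H\<^esub> \<and>
        tsum H (\<alpha> d) (\<lambda>a b. counit H a \<odot>\<^bsub>H\<^esub> b) = counit D d \<odot>\<^bsub>H\<^esub> \<one>\<^bsub>H\<^esub>) \<and>
      (\<forall>d\<in>carrier D. \<forall>h\<in>carrier H.
        \<alpha> (act d h) =
        tsum HH (comult H h) (\<lambda>h1 r. tsum HH (comult H r) (\<lambda>h2 s. tsum HH (comult H s) (\<lambda>h3 h4.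
          tsum HH (\<alpha> d) (\<lambda>a b.
            ptensor K H H (S h1 \<otimes>\<^bsub>H\<^esub> a \<otimes>\<^bsub>H\<^esub> h2) (S' h4 \<otimes>\<^bsub>H\<^esub> b \<otimes>\<^bsub>H\<^esub> h3)))))) \<and>
      (\<forall>d\<in>carrier D.
        tsum T (comult D d) (\<lambda>d1 r. tsum T (comult D r) (\<lambda>d2 d3.
          tsum T (\<alpha> d1) (\<lambda>a b. tsum T (\<alpha> d3) (\<lambda>x y. tsum T (comult H x) (\<lambda>x1 x2.
            ptensor3 K H D H (a \<otimes>\<^bsub>H\<^esub> x1) (act d2 (b \<otimes>\<^bsub>H\<^esub> x2)) y))))) =
        tsum T (comult D d) (\<lambda>d1 r. tsum T (comult D r) (\<lambda>d2 d3.
          tsum T (\<alpha> d1) (\<lambda>a b. tsum T (\<alpha> d3) (\<lambda>x y. tsum T (comult H b) (\<lambda>b1 b2.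
            ptensor3 K H D H a (act d2 (x \<otimes>\<^bsub>H\<^esub> b1)) (y \<otimes>\<^bsub>H\<^esub> b2)))))))})"

end

theory Submission
  imports Defs
begin

text \<open>
  A twisted cocycle \<open>\<beta>\<close> on \<open>C \<otimes> H\<close> is equivariant, hence determined by its restriction
  \<open>\<alpha>(c) = \<beta>(c \<otimes> 1)\<close>, namely
  \<open>\<beta>(c \<otimes> h) = S(h1) \<alpha>1(c) h2 \<otimes> S'(h4) \<alpha>2(c) h3\<close> with \<open>S'\<close> the inverse of the antipode
  \<open>S\<close>. Conversely, this formula turns every linear \<open>\<alpha>\<close> into an equivariant map, because \<open>S\<close> and
  \<open>S'\<close> reverse products (\<open>antipode_hmult\<close>), so that conjugation is a right action
  (\<open>twisted_ad_hmult\<close>). The bijection is \<open>\<alpha> \<mapsto> \<beta>\<close>, and what remains is to match the identities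
  imposed on \<open>\<alpha>\<close> and on \<open>\<beta>\<close>. The counit conditions match because \<open>\<epsilon>\<close> is multiplicative and
  invariant under \<open>S\<close>. For the twisted cocycle identity there are two steps.

  First, \<open>h\<close> can be removed from it. The two legs of \<open>\<beta>\<close> are \<open>L(h, a) = S(h1) a h2\<close> and
  \<open>R(h, b) = S'(h2) b h1\<close>, and the antipode axioms give \<open>h1 L(h2, x) = x h\<close> and
  \<open>h2 R(h1, b) = b h\<close>. With these rules, both sides of the identity at \<open>c \<otimes> h\<close> become the image,
  under one and the same map \<open>u \<otimes> c \<otimes> w \<otimes> z \<mapsto> S(h1) u h2 \<otimes> c \<otimes> w h3 \<otimes> R(h4, z)\<close>, of the two
  sides at \<open>c \<otimes> 1\<close> (\<open>twisted_conj_left\<close>, \<open>twisted_conj_right\<close>). Hence the identity for \<open>\<beta>\<close> is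
  equivalent to the interleaved identity
  \<open>\<alpha>1(c1) \<alpha>1(c3)_1 \<otimes> c2 \<otimes> \<alpha>2(c1) \<alpha>1(c3)_2 \<otimes> \<alpha>2(c3) =
  \<alpha>1(c1) \<otimes> c2 \<otimes> \<alpha>1(c3) \<alpha>2(c1)_1 \<otimes> \<alpha>2(c3) \<alpha>2(c1)_2\<close>.

  Second, for counital \<open>\<alpha>\<close> the interleaved identity is equivalent to the Harrison identity together
  with centrality, that is, the symmetry \<open>\<alpha>(c2) \<otimes> c1 = \<alpha>(c1) \<otimes> c2\<close>. Centrality is what remains of
  the interleaved identity if \<open>\<epsilon>\<close> is applied to the third leg (\<open>interleaved_imp_central\<close>); applying
  \<open>\<epsilon>\<close> to \<open>c2\<close> and reordering by centrality gives the Harrison identity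
  (\<open>interleaved_imp_harrison\<close>). Conversely, centrality moves \<open>c2\<close> out of the way, so that the
  Harrison identity applies to two adjacent factors (\<open>harrison_imp_interleaved\<close>).

  The computations are carried out with Sweedler sums, written with \<open>tsum\<close>. Such a sum runs over a
  chosen representative of a tensor, so sums over independent tensors commute, and linear maps can be
  moved into sums, for arbitrary summands. Multilinearity matters only when the tensor itself is
  replaced by an equal one, as in coassociativity. In the summands below every summation variable
  occurs exactly once, so that their linearity follows by backward chaining with the rules collected
  under the names \<open>lin_...\<close>.
\<close>

section \<open>Linear maps and sums over tensors\<close>

lemma linear_mapI:
  assumes "\<And>x. x \<in> carrier M \<Longrightarrow> f x \<in> carrier N"
    and "\<And>x y. x \<in> carrier M \<Longrightarrow> y \<in> carrier M \<Longrightarrow> f (x \<oplus>\<^bsub>M\<^esub> y) = f x \<oplus>\<^bsub>N\<^esub> f y"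
    and "\<And>a x. a \<in> carrier K \<Longrightarrow> x \<in> carrier M \<Longrightarrow> f (a \<odot>\<^bsub>M\<^esub> x) = a \<odot>\<^bsub>N\<^esub> f x"
  shows "linear_map K M N f"
  using assms unfolding linear_map_def by blast

lemma
  assumes "linear_map K M N f"
  shows linear_map_closed: "x \<in> carrier M \<Longrightarrow> f x \<in> carrier N"
    and linear_map_add: "x \<in> carrier M \<Longrightarrow> y \<in> carrier M \<Longrightarrow> f (x \<oplus>\<^bsub>M\<^esub> y) = f x \<oplus>\<^bsub>N\<^esub> f y"
    and linear_map_smult: "a \<in> carrier K \<Longrightarrow> x \<in> carrier M \<Longrightarrow> f (a \<odot>\<^bsub>M\<^esub> x) = a \<odot>\<^bsub>N\<^esub> f x"
  using assms unfolding linear_map_def by blast+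

lemma linear_map_zero:
  assumes "module K M" "module K N" "linear_map K M N f"
  shows "f \<zero>\<^bsub>M\<^esub> = \<zero>\<^bsub>N\<^esub>"
proof -
  interpret M: module K M by fact
  interpret N: module K N by fact
  show ?thesis
    using linear_map_add[OF assms(3), of "\<zero>\<^bsub>M\<^esub>" "\<zero>\<^bsub>M\<^esub>"] linear_map_closed[OF assms(3), of "\<zero>\<^bsub>M\<^esub>"]
      N.M.add.l_cancel_one by auto
qed

lemma linear_map_smult_const:
  assumes "module K M" "a \<in> carrier K"
  shows "linear_map K M M (\<lambda>x. a \<odot>\<^bsub>M\<^esub> x)"
proof (rule linear_mapI)
  interpret M: module K M by fact
  show "a \<odot>\<^bsub>M\<^esub> (x \<oplus>\<^bsub>M\<^esub> y) = a \<odot>\<^bsub>M\<^esub> x \<oplus>\<^bsub>M\<^esub> a \<odot>\<^bsub>M\<^esub> y"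
    if "x \<in> carrier M" "y \<in> carrier M" for x y using that assms by (simp add: M.smult_r_distr)
  show "a \<odot>\<^bsub>M\<^esub> (b \<odot>\<^bsub>M\<^esub> x) = b \<odot>\<^bsub>M\<^esub> (a \<odot>\<^bsub>M\<^esub> x)"
    if "b \<in> carrier K" "x \<in> carrier M" for b x
    using that assms by (metis M.smult_assoc1 M.R.m_comm)
qed (use assms in \<open>simp add: module.smult_closed\<close>)

lemma linear_map_comp:
  assumes "linear_map K M N f" "linear_map K N U g"
  shows "linear_map K M U (\<lambda>x. g (f x))"
  using assms unfolding linear_map_def by (simp add: Pi_iff)

lemma linear_map_cong:
  assumes "module K M" "linear_map K M N f" "\<And>x. x \<in> carrier M \<Longrightarrow> f x = g x"
  shows "linear_map K M N g"
proof -
  interpret M: module K M by fact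
  show ?thesis using assms(2,3) unfolding linear_map_def by (simp add: Pi_iff)
qed

lemma bilinear_mapI:
  assumes "\<And>y. y \<in> carrier N \<Longrightarrow> linear_map K M U (\<lambda>x. f x y)"
    and "\<And>x. x \<in> carrier M \<Longrightarrow> linear_map K N U (\<lambda>y. f x y)"
  shows "bilinear_map K M N U f"
  using assms unfolding bilinear_map_def by blast

lemma
  assumes "bilinear_map K M N U f"
  shows bilinear_map_left: "y \<in> carrier N \<Longrightarrow> linear_map K M U (\<lambda>x. f x y)"
    and bilinear_map_right: "x \<in> carrier M \<Longrightarrow> linear_map K N U (\<lambda>y. f x y)"
    and bilinear_map_closed: "x \<in> carrier M \<Longrightarrow> y \<in> carrier N \<Longrightarrow> f x y \<in> carrier U"
  using assms unfolding bilinear_map_def by (simp_all add: linear_map_def Pi_iff)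

lemma tensor_product_carrier:
  "carrier (tensor_product K M N) = tensor_class K M N ` {xs. set xs \<subseteq> carrier M \<times> carrier N}"
  by (simp add: tensor_product_def)

lemma tensor_rep_carrier:
  assumes "module K M" "module K N" "t \<in> carrier (tensor_product K M N)"
  shows "set (tensor_rep t) \<subseteq> carrier M \<times> carrier N"
proof -
  from assms(3) obtain xs where "set xs \<subseteq> carrier M \<times> carrier N" "t = tensor_class K M N xs"
    unfolding tensor_product_carrier by auto
  then show ?thesis
    using tensor_eq_carrier(2)[OF tensor_rep_tensor_class[of xs] assms(1,2)] by simp
qed

lemma tensor_class_rep:
  assumes "module K M" "module K N" "t \<in> carrier (tensor_product K M N)"
  shows "tensor_class K M N (tensor_rep t) = t"
proof -
  from assms(3) obtain xs where "set xs \<subseteq> carrier M \<times> carrier N" "t = tensor_class K M N xs"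
    unfolding tensor_product_carrier by auto
  then show ?thesis
    using tensor_class_eq[OF tensor_rep_tensor_class[of xs M N K]] by simp
qed

definition pair_sum :: "('u, 'p) ring_scheme \<Rightarrow> ('a \<times> 'b) list \<Rightarrow> ('a \<Rightarrow> 'b \<Rightarrow> 'u) \<Rightarrow> 'u" where
  "pair_sum U xs f = foldr (\<lambda>(v, w) u. f v w \<oplus>\<^bsub>U\<^esub> u) xs \<zero>\<^bsub>U\<^esub>"

lemma pair_sum_Nil [simp]: "pair_sum U [] f = \<zero>\<^bsub>U\<^esub>"
  and pair_sum_Cons [simp]: "pair_sum U ((v, w) # xs) f = f v w \<oplus>\<^bsub>U\<^esub> pair_sum U xs f"
  by (simp_all add: pair_sum_def)

lemma tsum_eq_pair_sum: "tsum U t f = pair_sum U (tensor_rep t) f"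
  by (simp add: tsum_def pair_sum_def)

lemma pair_sum_closed:
  assumes "abelian_monoid U" "set xs \<subseteq> A \<times> B" "\<And>v w. v \<in> A \<Longrightarrow> w \<in> B \<Longrightarrow> f v w \<in> carrier U"
  shows "pair_sum U xs f \<in> carrier U"
proof -
  interpret abelian_monoid U by fact
  show ?thesis using assms(2) by (induction xs) (auto intro!: a_closed assms(3))
qed

lemma pair_sum_cong:
  assumes "set xs \<subseteq> A \<times> B" "\<And>v w. v \<in> A \<Longrightarrow> w \<in> B \<Longrightarrow> f v w = g v w"
  shows "pair_sum U xs f = pair_sum U xs g"
  using assms(1) by (induction xs) (auto simp: assms(2))

lemma pair_sum_add:
  assumes "abelian_monoid U" "set xs \<subseteq> A \<times> B"
    and "\<And>v w. v \<in> A \<Longrightarrow> w \<in> B \<Longrightarrow> f v w \<in> carrier U" "\<And>v w. v \<in> A \<Longrightarrow> w \<in> B \<Longrightarrow> g v w \<in> carrier U"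
  shows "pair_sum U xs (\<lambda>v w. f v w \<oplus>\<^bsub>U\<^esub> g v w) = pair_sum U xs f \<oplus>\<^bsub>U\<^esub> pair_sum U xs g"
proof -
  interpret abelian_monoid U by fact
  show ?thesis using assms(2)
  proof (induction xs)
    case (Cons x xs)
    obtain v w where x: "x = (v, w)" "v \<in> A" "w \<in> B" using Cons.prems by (cases x) auto
    have "set xs \<subseteq> A \<times> B" using Cons.prems by simp
    note cl = pair_sum_closed[OF assms(1) this assms(3)] pair_sum_closed[OF assms(1) this assms(4)]
    show ?case using Cons x cl by (simp add: assms(3,4) add.m_ac)
  qed simp
qed

lemma pair_sum_zero:
  assumes "abelian_monoid U"
  shows "pair_sum U xs (\<lambda>v w. \<zero>\<^bsub>U\<^esub>) = \<zero>\<^bsub>U\<^esub>"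
proof -
  interpret abelian_monoid U by fact
  show ?thesis by (induction xs) auto
qed

lemma pair_sum_linear_image:
  assumes "module K U" "module K V" "linear_map K U V \<phi>" "set xs \<subseteq> A \<times> B"
    and "\<And>v w. v \<in> A \<Longrightarrow> w \<in> B \<Longrightarrow> f v w \<in> carrier U"
  shows "\<phi> (pair_sum U xs f) = pair_sum V xs (\<lambda>v w. \<phi> (f v w))"
proof -
  interpret U: module K U by fact
  show ?thesis using assms(4)
  proof (induction xs)
    case Nil
    then show ?case by (simp add: linear_map_zero[OF assms(1-3)])
  next
    case (Cons x xs)
    then show ?case
      using pair_sum_closed[OF U.M.abelian_monoid_axioms _ assms(5), of xs]
      by (cases x) (auto simp: linear_map_add[OF assms(3)] assms(5))
  qed
qed

lemma pair_sum_append: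
  assumes "abelian_monoid U" "set xs \<subseteq> A \<times> B" "set ys \<subseteq> A \<times> B"
    "\<And>v w. v \<in> A \<Longrightarrow> w \<in> B \<Longrightarrow> f v w \<in> carrier U"
  shows "pair_sum U (xs @ ys) f = pair_sum U xs f \<oplus>\<^bsub>U\<^esub> pair_sum U ys f"
proof -
  interpret abelian_monoid U by fact
  note c = pair_sum_closed[OF assms(1) _ assms(4)]
  show ?thesis using assms(2)
    by (induction xs) (auto simp: add.m_assoc assms(4) c[OF assms(3)] c)
qed

lemma pair_sum_swap:
  assumes "abelian_monoid U" "set xs \<subseteq> A \<times> B" "set ys \<subseteq> A' \<times> B'"
    "\<And>v w x y. v \<in> A \<Longrightarrow> w \<in> B \<Longrightarrow> x \<in> A' \<Longrightarrow> y \<in> B' \<Longrightarrow> f v w x y \<in> carrier U"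
  shows "pair_sum U xs (\<lambda>v w. pair_sum U ys (\<lambda>x y. f v w x y)) =
    pair_sum U ys (\<lambda>x y. pair_sum U xs (\<lambda>v w. f v w x y))"
  using assms(2)
proof (induction xs)
  case Nil
  then show ?case by (simp add: pair_sum_zero[OF assms(1)])
next
  case (Cons x xs)
  then obtain v w where x: "x = (v, w)" "v \<in> A" "w \<in> B" by (cases x) auto
  have "set xs \<subseteq> A \<times> B" using Cons.prems by simp
  then show ?case using Cons x
    by (simp add: pair_sum_add[OF assms(1,3)] assms(4) pair_sum_closed[OF assms(1)])
qed

locale three_modules =
  fixes K :: "('k, 'p) ring_scheme" and M :: "('k, 'a, 'q) module_scheme"
    and N :: "('k, 'b, 'r) module_scheme" and U :: "('k, 'u, 's) module_scheme"
  assumes M: "module K M" and N: "module K N" and U: "module K U"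
begin

lemma abelian_monoid_U: "abelian_monoid U"
  using U by (simp add: module_def abelian_group_def)

lemma tsum_closed:
  assumes "t \<in> carrier (tensor_product K M N)"
    and "\<And>v w. v \<in> carrier M \<Longrightarrow> w \<in> carrier N \<Longrightarrow> f v w \<in> carrier U"
  shows "tsum U t f \<in> carrier U"
  unfolding tsum_eq_pair_sum
  by (rule pair_sum_closed[OF abelian_monoid_U tensor_rep_carrier[OF M N assms(1)]]) fact

lemma linear_map_tsum_summand:
  assumes "module K P" "t \<in> carrier (tensor_product K M N)"
    and lin: "\<And>v w. v \<in> carrier M \<Longrightarrow> w \<in> carrier N \<Longrightarrow> linear_map K P U (\<lambda>x. F x v w)"
  shows "linear_map K P U (\<lambda>x. tsum U t (F x))"
proof (rule linear_mapI)
  interpret U: module K U by (rule U)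
  interpret P: module K P by fact
  note rep = tensor_rep_carrier[OF M N assms(2)]
  note cl = linear_map_closed[OF lin]
  fix x assume x: "x \<in> carrier P"
  show "tsum U t (F x) \<in> carrier U"
    by (rule tsum_closed[OF assms(2) cl]) (auto simp: x)
  {
    fix y assume y: "y \<in> carrier P"
    have "tsum U t (F (x \<oplus>\<^bsub>P\<^esub> y)) = pair_sum U (tensor_rep t) (\<lambda>v w. F x v w \<oplus>\<^bsub>U\<^esub> F y v w)"
      unfolding tsum_eq_pair_sum using x y by (intro pair_sum_cong[OF rep] linear_map_add[OF lin])
    also have "\<dots> = tsum U t (F x) \<oplus>\<^bsub>U\<^esub> tsum U t (F y)"
      unfolding tsum_eq_pair_sum using x y by (intro pair_sum_add[OF abelian_monoid_U rep] cl)
    finally show "tsum U t (F (x \<oplus>\<^bsub>P\<^esub> y)) = tsum U t (F x) \<oplus>\<^bsub>U\<^esub> tsum U t (F y)" .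
  }
  fix a assume a: "a \<in> carrier K"
  have "tsum U t (F (a \<odot>\<^bsub>P\<^esub> x)) = pair_sum U (tensor_rep t) (\<lambda>v w. a \<odot>\<^bsub>U\<^esub> F x v w)"
    unfolding tsum_eq_pair_sum using x a by (intro pair_sum_cong[OF rep] linear_map_smult[OF lin])
  also have "\<dots> = a \<odot>\<^bsub>U\<^esub> tsum U t (F x)"
    unfolding tsum_eq_pair_sum
    by (rule pair_sum_linear_image[OF U U _ rep, symmetric])
      (use a x in \<open>auto intro!: cl linear_map_smult_const[OF U]\<close>)
  finally show "tsum U t (F (a \<odot>\<^bsub>P\<^esub> x)) = a \<odot>\<^bsub>U\<^esub> tsum U t (F x)" .
qed

lemma tsum_ptensor:
  assumes "bilinear_map K M N U f" "v \<in> carrier M" "w \<in> carrier N"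
  shows "tsum U (ptensor K M N v w) f = f v w"
proof -
  interpret U: module K U by (rule U)
  show ?thesis unfolding ptensor_def
    by (subst tsum_tensor_class[OF M N U assms(1)])
      (use assms in \<open>auto simp: bilinear_map_closed[OF assms(1)]\<close>)
qed

lemma linear_map_tsum:
  assumes f: "bilinear_map K M N U f"
  shows "linear_map K (tensor_product K M N) U (\<lambda>t. tsum U t f)"
proof (rule linear_mapI)
  interpret U: module K U by (rule U)
  interpret M: module K M by (rule M)
  note cl = bilinear_map_closed[OF f]
  fix s assume s: "s \<in> carrier (tensor_product K M N)"
  note rs = tensor_rep_carrier[OF M N s]
  show "tsum U s f \<in> carrier U" by (rule tsum_closed[OF s cl])
  {
    fix t assume t: "t \<in> carrier (tensor_product K M N)"
    note rt = tensor_rep_carrier[OF M N t]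
    have "s \<oplus>\<^bsub>tensor_product K M N\<^esub> t = tensor_class K M N (tensor_rep s @ tensor_rep t)"
      by (simp add: tensor_product_def)
    then have "tsum U (s \<oplus>\<^bsub>tensor_product K M N\<^esub> t) f = pair_sum U (tensor_rep s @ tensor_rep t) f"
      using rs rt by (simp add: tsum_tensor_class[OF M N U f] pair_sum_def)
    also have "\<dots> = tsum U s f \<oplus>\<^bsub>U\<^esub> tsum U t f"
      unfolding tsum_eq_pair_sum by (intro pair_sum_append[OF abelian_monoid_U rs rt] cl)
    finally show "tsum U (s \<oplus>\<^bsub>tensor_product K M N\<^esub> t) f = tsum U s f \<oplus>\<^bsub>U\<^esub> tsum U t f" .
  }
  fix a assume a: "a \<in> carrier K"
  have "a \<odot>\<^bsub>tensor_product K M N\<^esub> s = tensor_class K M N [(a \<odot>\<^bsub>M\<^esub> v, w). (v, w) \<leftarrow> tensor_rep s]"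
    by (simp add: tensor_product_def)
  then have "tsum U (a \<odot>\<^bsub>tensor_product K M N\<^esub> s) f
      = pair_sum U [(a \<odot>\<^bsub>M\<^esub> v, w). (v, w) \<leftarrow> tensor_rep s] f"
    using rs a by (subst pair_sum_def) (auto intro!: tsum_tensor_class[OF M N U f] M.smult_closed)
  also have "\<dots> = pair_sum U (tensor_rep s) (\<lambda>v w. f (a \<odot>\<^bsub>M\<^esub> v) w)"
    by (simp add: pair_sum_def foldr_map o_def case_prod_unfold)
  also have "\<dots> = pair_sum U (tensor_rep s) (\<lambda>v w. a \<odot>\<^bsub>U\<^esub> f v w)"
    using a by (intro pair_sum_cong[OF rs] linear_map_smult[OF bilinear_map_left[OF f]])
  also have "\<dots> = a \<odot>\<^bsub>U\<^esub> tsum U s f"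
    unfolding tsum_eq_pair_sum
    by (rule pair_sum_linear_image[OF U U _ rs, symmetric])
      (use a in \<open>auto intro!: cl linear_map_smult_const[OF U]\<close>)
  finally show "tsum U (a \<odot>\<^bsub>tensor_product K M N\<^esub> s) f = a \<odot>\<^bsub>U\<^esub> tsum U s f" .
qed

end

lemmas tsum_closed = three_modules.tsum_closed[OF three_modules.intro]
lemmas linear_map_tsum_summand = three_modules.linear_map_tsum_summand[OF three_modules.intro]
lemmas tsum_ptensor = three_modules.tsum_ptensor[OF three_modules.intro]
lemmas linear_map_tsum = three_modules.linear_map_tsum[OF three_modules.intro]

lemma tsum_cong:
  assumes "module K M" "module K N" "t \<in> carrier (tensor_product K M N)"
    "\<And>v w. v \<in> carrier M \<Longrightarrow> w \<in> carrier N \<Longrightarrow> f v w = g v w"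
  shows "tsum U t f = tsum U t g"
  unfolding tsum_eq_pair_sum by (intro pair_sum_cong[OF tensor_rep_carrier[OF assms(1-3)]] assms(4))

lemma linear_map_of_tsum:
  assumes "module K M" "module K N" "t \<in> carrier (tensor_product K M N)" "module K U" "module K V"
    and "linear_map K U V \<phi>"
    and "\<And>v w. v \<in> carrier M \<Longrightarrow> w \<in> carrier N \<Longrightarrow> f v w \<in> carrier U"
  shows "\<phi> (tsum U t f) = tsum V t (\<lambda>v w. \<phi> (f v w))"
  unfolding tsum_eq_pair_sum
  by (intro pair_sum_linear_image[OF assms(4-6) tensor_rep_carrier[OF assms(1-3)]] assms(7))

lemma tsum_swap:
  assumes "module K M" "module K N" "s \<in> carrier (tensor_product K M N)"
    "module K P" "module K Q" "t \<in> carrier (tensor_product K P Q)" "module K U"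
    "\<And>v w x y. v \<in> carrier M \<Longrightarrow> w \<in> carrier N \<Longrightarrow> x \<in> carrier P \<Longrightarrow> y \<in> carrier Q \<Longrightarrow>
      f v w x y \<in> carrier U"
  shows "tsum U s (\<lambda>v w. tsum U t (\<lambda>x y. f v w x y)) = tsum U t (\<lambda>x y. tsum U s (\<lambda>v w. f v w x y))"
  unfolding tsum_eq_pair_sum
  by (intro pair_sum_swap[OF _ tensor_rep_carrier[OF assms(1-3)] tensor_rep_carrier[OF assms(4-6)]]
      assms(8)) (use \<open>module K U\<close> in \<open>simp_all add: module_def abelian_group_def\<close>)

lemma ptensor_closed:
  "v \<in> carrier M \<Longrightarrow> w \<in> carrier N \<Longrightarrow> ptensor K M N v w \<in> carrier (tensor_product K M N)"
  unfolding ptensor_def tensor_product_carrier by auto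

lemma tensor_add_class:
  assumes "set xs \<subseteq> carrier M \<times> carrier N" "set ys \<subseteq> carrier M \<times> carrier N"
  shows "tensor_class K M N xs \<oplus>\<^bsub>tensor_product K M N\<^esub> tensor_class K M N ys = tensor_class K M N (xs @ ys)"
  unfolding tensor_product_def using assms
  by (auto intro!: tensor_class_eq tensor_eq.append tensor_eq.sym[OF tensor_rep_tensor_class])

text \<open>
  Additivity and balancedness of \<open>\<otimes>\<close> are built into the congruence. The point that needs an argument
  is \<open>a (v \<otimes> w) = (a v) \<otimes> w\<close>: scaling of formal sums has to respect the congruence, since the left-hand
  side scales an arbitrary representative.
\<close>
lemma bilinear_map_ptensor:
  fixes N :: "('k, 'c, 'r) module_scheme"
  assumes "module K M" "module K N"
  shows "bilinear_map K M N (tensor_product K M N) (ptensor K M N)"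
proof -
  interpret M: module K M by fact
  interpret N: module K N by fact
  let ?T = "tensor_product K M N"
  define scale where "scale a = map (\<lambda>(v, w). (a \<odot>\<^bsub>M\<^esub> v, w :: 'c))" for a
  have scale_eq: "tensor_eq K M N (scale a xs) (scale a ys)"
    if "tensor_eq K M N xs ys" and a: "a \<in> carrier K" for a xs ys
    using that(1)
  proof (induction rule: tensor_eq.induct)
    case (sym xs ys) show ?case by (rule tensor_eq.sym) fact
  next
    case (append xs xs' ys ys') then show ?case unfolding scale_def map_append by (intro tensor_eq.append)
  next
    case (trans xs ys zs) show ?case by (rule tensor_eq.trans) fact+
  next
    case (balanced b v w)
    have "a \<odot>\<^bsub>M\<^esub> (b \<odot>\<^bsub>M\<^esub> v) = b \<odot>\<^bsub>M\<^esub> (a \<odot>\<^bsub>M\<^esub> v)"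
      using balanced a by (metis M.smult_assoc1 M.R.m_comm)
    then show ?case using a balanced by (simp add: scale_def tensor_eq.balanced)
  next
    case (refl xs)
    then show ?case using a by (intro tensor_eq.refl) (auto simp: scale_def intro!: M.smult_closed)
  next
    case (comm xs ys)
    then show ?case using a unfolding scale_def map_append
      by (intro tensor_eq.comm) (auto intro!: M.smult_closed)
  qed (use a in \<open>simp_all add: scale_def M.smult_r_distr tensor_eq.zero tensor_eq.add_left tensor_eq.add_right\<close>)
  have smult: "a \<odot>\<^bsub>?T\<^esub> ptensor K M N v w = ptensor K M N (a \<odot>\<^bsub>M\<^esub> v) w"
    if a: "a \<in> carrier K" and v: "v \<in> carrier M" and w: "w \<in> carrier N" for a v w
  proof -
    have "a \<odot>\<^bsub>?T\<^esub> ptensor K M N v w = tensor_class K M N (scale a (tensor_rep (ptensor K M N v w)))"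
      by (simp add: tensor_product_def scale_def)
    also have "\<dots> = tensor_class K M N (scale a [(v, w)])"
      unfolding ptensor_def using v w
      by (intro tensor_class_eq scale_eq[OF _ a] tensor_eq.sym[OF tensor_rep_tensor_class]) auto
    finally show ?thesis by (simp add: scale_def ptensor_def)
  qed
  show ?thesis
  proof (intro bilinear_mapI linear_mapI)
    fix u v w assume "u \<in> carrier M" "v \<in> carrier M" "w \<in> carrier N"
    then show "ptensor K M N (u \<oplus>\<^bsub>M\<^esub> v) w = ptensor K M N u w \<oplus>\<^bsub>?T\<^esub> ptensor K M N v w"
      unfolding ptensor_def
      by (subst tensor_add_class) (simp_all add: tensor_class_eq tensor_eq.add_left)
  next
    fix u v w assume "u \<in> carrier M" "v \<in> carrier N" "w \<in> carrier N"
    then show "ptensor K M N u (v \<oplus>\<^bsub>N\<^esub> w) = ptensor K M N u v \<oplus>\<^bsub>?T\<^esub> ptensor K M N u w"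
      unfolding ptensor_def
      by (subst tensor_add_class) (simp_all add: tensor_class_eq tensor_eq.add_right)
  next
    fix a v w assume a: "a \<in> carrier K" "v \<in> carrier M" "w \<in> carrier N"
    have "ptensor K M N (a \<odot>\<^bsub>M\<^esub> v) w = ptensor K M N v (a \<odot>\<^bsub>N\<^esub> w)"
      unfolding ptensor_def by (intro tensor_class_eq tensor_eq.balanced a)
    then show "ptensor K M N v (a \<odot>\<^bsub>N\<^esub> w) = a \<odot>\<^bsub>?T\<^esub> ptensor K M N v w"
      using a by (simp add: smult)
  qed (auto simp: ptensor_closed smult)
qed

lemma tsum_ptensor_id:
  assumes "module K M" "module K N" "t \<in> carrier (tensor_product K M N)"
  shows "tsum (tensor_product K M N) t (ptensor K M N) = t"
proof -
  have *: "pair_sum (tensor_product K M N) xs (ptensor K M N) = tensor_class K M N xs"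
    if "set xs \<subseteq> carrier M \<times> carrier N" for xs
    using that
  proof (induction xs)
    case Nil
    then show ?case by (simp add: tensor_product_def)
  next
    case (Cons x xs)
    then show ?case
      by (cases x) (auto simp: ptensor_def tensor_add_class)
  qed
  show ?thesis
    using *[OF tensor_rep_carrier[OF assms]] tensor_class_rep[OF assms]
    by (simp add: tsum_eq_pair_sum)
qed

section \<open>Multilinear maps out of tensor products\<close>

lemma module_self [simp, intro]:
  assumes "cring K"
  shows "module K (self_module K)"
proof -
  interpret cring K by fact
  have "abelian_group (self_module K)"
    by (rule abelian_groupI)
      (auto simp: self_module_def a_ac intro!: bexI[of _ "\<ominus>\<^bsub>K\<^esub> _"] l_neg)
  then show ?thesis
    by (intro moduleI assms) (auto simp: self_module_def l_distr r_distr m_assoc)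
qed

lemma module_imp_cring: "module K M \<Longrightarrow> cring K"
  by (simp add: module_def)

lemma linear_map_id: "linear_map K M M (\<lambda>x. x)"
  by (rule linear_mapI) auto

text \<open>
  In \<open>tsum U t F\<close> a variable occurs either in the tensor \<open>t\<close>, where \<open>F\<close> has to be bilinear, or in the
  summand, where \<open>t\<close> is arbitrary. The order of the premises matters for backward chaining: the first
  one determines the two factors of the tensor product.
\<close>
lemma linear_map_tsum_arg:
  assumes "linear_map K P (tensor_product K M N) t"
    and "\<And>y. y \<in> carrier N \<Longrightarrow> linear_map K M U (\<lambda>x. F x y)"
    and "\<And>x. x \<in> carrier M \<Longrightarrow> linear_map K N U (\<lambda>y. F x y)"
    and "module K M" "module K N" "module K U"
  shows "linear_map K P U (\<lambda>x. tsum U (t x) F)"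
  using assms by (intro linear_map_comp[OF assms(1)] linear_map_tsum bilinear_mapI)

lemma linear_map_tsum_body:
  assumes "t \<in> carrier (tensor_product K M N)"
    and "\<And>v w. v \<in> carrier M \<Longrightarrow> w \<in> carrier N \<Longrightarrow> linear_map K P U (\<lambda>x. F x v w)"
    and "module K M" "module K N" "module K U" "module K P"
  shows "linear_map K P U (\<lambda>x. tsum U t (\<lambda>v w. F x v w))"
  using assms by (intro linear_map_tsum_summand[where M = M and N = N])

lemma linear_map_ptensor_left:
  assumes "linear_map K P M f" "w \<in> carrier N" "module K M" "module K N"
  shows "linear_map K P (tensor_product K M N) (\<lambda>x. ptensor K M N (f x) w)"
  using linear_map_comp[OF assms(1) bilinear_map_left[OF bilinear_map_ptensor[OF assms(3,4)] assms(2)]] .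

lemma linear_map_ptensor_right:
  assumes "linear_map K P N f" "v \<in> carrier M" "module K M" "module K N"
  shows "linear_map K P (tensor_product K M N) (\<lambda>x. ptensor K M N v (f x))"
  using linear_map_comp[OF assms(1) bilinear_map_right[OF bilinear_map_ptensor[OF assms(3,4)] assms(2)]] .

lemma linear_map_smult_left:
  assumes "linear_map K P (self_module K) f" "m \<in> carrier M" "module K M"
  shows "linear_map K P M (\<lambda>x. f x \<odot>\<^bsub>M\<^esub> m)"
proof -
  interpret M: module K M by fact
  have "linear_map K (self_module K) M (\<lambda>a. a \<odot>\<^bsub>M\<^esub> m)"
    by (rule linear_mapI) (use assms(2) in \<open>auto simp: self_module_def M.smult_l_distr M.smult_assoc1\<close>)
  from linear_map_comp[OF assms(1) this] show ?thesis .
qed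

lemma linear_map_smult_right:
  assumes "linear_map K P M f" "a \<in> carrier K" "module K M"
  shows "linear_map K P M (\<lambda>x. a \<odot>\<^bsub>M\<^esub> f x)"
  using linear_map_comp[OF assms(1) linear_map_smult_const[OF assms(3,2)]] .

lemma tsum_ptensor_eq:
  assumes "v \<in> carrier M" "w \<in> carrier N"
    and "\<And>y. y \<in> carrier N \<Longrightarrow> linear_map K M U (\<lambda>x. F x y)"
    and "\<And>x. x \<in> carrier M \<Longrightarrow> linear_map K N U (\<lambda>y. F x y)"
    and "module K M" "module K N" "module K U"
  shows "tsum U (ptensor K M N v w) F = F v w"
  using assms by (intro tsum_ptensor bilinear_mapI)

lemma tsum_tsum:
  assumes "t \<in> carrier (tensor_product K P Q)"
    and "\<And>x y. x \<in> carrier P \<Longrightarrow> y \<in> carrier Q \<Longrightarrow> g x y \<in> carrier (tensor_product K M N)"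
    and "\<And>y. y \<in> carrier N \<Longrightarrow> linear_map K M U (\<lambda>x. F x y)"
    and "\<And>x. x \<in> carrier M \<Longrightarrow> linear_map K N U (\<lambda>y. F x y)"
    and "module K M" "module K N" "module K P" "module K Q" "module K U"
  shows "tsum U (tsum (tensor_product K M N) t g) F = tsum U t (\<lambda>x y. tsum U (g x y) F)"
  by (rule linear_map_of_tsum[OF assms(7,8,1) tensor_product_module[OF assms(5,6)] assms(9)
        linear_map_tsum[OF assms(5,6,9) bilinear_mapI]])
    (use assms in auto)

lemma tsum_in_carrier:
  assumes "t \<in> carrier (tensor_product K M N)"
    and "\<And>v w. v \<in> carrier M \<Longrightarrow> w \<in> carrier N \<Longrightarrow> f v w \<in> carrier U"
    and "module K M" "module K N" "module K U"
  shows "tsum U t f \<in> carrier U"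
  using assms by (intro tsum_closed[OF assms(3-5)])

lemmas lin_basic = linear_map_id linear_map_ptensor_left linear_map_ptensor_right
  linear_map_tsum_arg linear_map_tsum_body linear_map_smult_left linear_map_smult_right

text \<open>
  In this form the rule can be iterated, and pushes a linear map through any number of nested sums.
\<close>
lemma linear_map_of_tsum_eq:
  assumes "t \<in> carrier (tensor_product K M N)"
    and "\<And>v w. v \<in> carrier M \<Longrightarrow> w \<in> carrier N \<Longrightarrow> \<phi> (f v w) = g v w"
    and "\<And>v w. v \<in> carrier M \<Longrightarrow> w \<in> carrier N \<Longrightarrow> f v w \<in> carrier U"
    and "linear_map K U V \<phi>" "module K M" "module K N" "module K U" "module K V"
  shows "\<phi> (tsum U t f) = tsum V t g"
  using linear_map_of_tsum[OF assms(5,6,1,7,8,4,3)] tsum_cong[OF assms(5,6,1,2)] by simp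

text \<open>
  Axioms such as coassociativity are equations in a threefold tensor product. Composition with the lift
  \<open>\<phi>\<close> turns them into equations between sums of values of an arbitrary trilinear map.
\<close>
lemma tensor3_lift:
  assumes M: "module K M" and N: "module K N" and P: "module K P" and U: "module K U"
    and F1: "\<And>y z. y \<in> carrier N \<Longrightarrow> z \<in> carrier P \<Longrightarrow> linear_map K M U (\<lambda>x. F x y z)"
    and F2: "\<And>x z. x \<in> carrier M \<Longrightarrow> z \<in> carrier P \<Longrightarrow> linear_map K N U (\<lambda>y. F x y z)"
    and F3: "\<And>x y. x \<in> carrier M \<Longrightarrow> y \<in> carrier N \<Longrightarrow> linear_map K P U (\<lambda>z. F x y z)"
  obtains \<phi> where "linear_map K (tensor_product3 K M N P) U \<phi>"
    and "\<And>x y z. x \<in> carrier M \<Longrightarrow> y \<in> carrier N \<Longrightarrow> z \<in> carrier P \<Longrightarrow>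
      \<phi> (ptensor3 K M N P x y z) = F x y z"
proof
  let ?\<phi> = "\<lambda>t. tsum U t (\<lambda>x r. tsum U r (\<lambda>y z. F x y z))"
  note F = linear_map_comp[OF _ F1] linear_map_comp[OF _ F2] linear_map_comp[OF _ F3]
  note mods = M N P U tensor_product_module
  show "linear_map K (tensor_product3 K M N P) U ?\<phi>"
    by (rule lin_basic F mods | assumption | simp)+
  fix x y z assume xyz: "x \<in> carrier M" "y \<in> carrier N" "z \<in> carrier P"
  have "?\<phi> (ptensor3 K M N P x y z) = tsum U (ptensor K N P y z) (\<lambda>y z. F x y z)"
    using xyz by - (rule tsum_ptensor_eq, (rule ptensor_closed lin_basic F mods | assumption | simp)+)
  also have "\<dots> = F x y z"
    using xyz by - (rule tsum_ptensor_eq, (rule lin_basic F mods | assumption | simp)+)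
  finally show "?\<phi> (ptensor3 K M N P x y z) = F x y z" .
qed

lemma tensor_linear_map_eqI:
  assumes "linear_map K (tensor_product K M N) U f" "linear_map K (tensor_product K M N) U g"
    and "\<And>v w. v \<in> carrier M \<Longrightarrow> w \<in> carrier N \<Longrightarrow> f (ptensor K M N v w) = g (ptensor K M N v w)"
    and "t \<in> carrier (tensor_product K M N)" "module K M" "module K N" "module K U"
  shows "f t = g t"
proof -
  let ?T = "tensor_product K M N"
  have T: "module K ?T" using assms by (intro tensor_product_module)
  have *: "h t = tsum U t (\<lambda>v w. h (ptensor K M N v w))" if "linear_map K ?T U h" for h
    using linear_map_of_tsum[OF assms(5,6,4) T assms(7) that, of "ptensor K M N"]
    by (simp add: tsum_ptensor_id[OF assms(5,6,4)] ptensor_closed)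
  show ?thesis
    unfolding *[OF assms(1)] *[OF assms(2)] by (intro tsum_cong[OF assms(5,6,4)] assms(3))
qed

section \<open>Sweedler sums in a coalgebra\<close>

context coalgebra
begin

lemma module_C [simp, intro]: "module K C"
  by (rule local.module_axioms)

lemma module_K [simp, intro]: "module K (self_module K)"
  by (rule module_self) (rule module_imp_cring[OF module_C])

lemma module_CC [simp, intro]: "module K (tensor_product K C C)"
  by (simp add: tensor_product_module)

lemma comult_closed [simp]: "c \<in> carrier C \<Longrightarrow> comult C c \<in> carrier (tensor_product K C C)"
  by (rule linear_map_closed[OF comult_linear])

lemma counit_closed [simp]: "c \<in> carrier C \<Longrightarrow> counit C c \<in> carrier K"
  using linear_map_closed[OF counit_linear] by (simp add: self_module_def)

lemmas linear_comult = linear_map_comp[OF _ comult_linear]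
lemmas linear_counit = linear_map_comp[OF _ counit_linear]
lemmas lin_coalg = lin_basic linear_comult linear_counit

lemma comult_sum_cong:
  assumes "c \<in> carrier C"
    "\<And>p q. p \<in> carrier C \<Longrightarrow> q \<in> carrier C \<Longrightarrow> f p q = g p q"
  shows "tsum U (comult C c) f = tsum U (comult C c) g"
  using assms by (intro tsum_cong[OF module_C module_C comult_closed])

lemma comult_sum_swap:
  assumes "c \<in> carrier C" "d \<in> carrier C" "module K U"
    "\<And>v w x y. v \<in> carrier C \<Longrightarrow> w \<in> carrier C \<Longrightarrow> x \<in> carrier C \<Longrightarrow> y \<in> carrier C \<Longrightarrow>
      f v w x y \<in> carrier U"
  shows "tsum U (comult C c) (\<lambda>v w. tsum U (comult C d) (\<lambda>x y. f v w x y)) =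
    tsum U (comult C d) (\<lambda>x y. tsum U (comult C c) (\<lambda>v w. f v w x y))"
  using assms by (intro tsum_swap[OF module_C module_C comult_closed module_C module_C comult_closed]) auto

lemma coassoc_sum:
  assumes c: "c \<in> carrier C" and U [simp]: "module K U"
    and F1: "\<And>y z. y \<in> carrier C \<Longrightarrow> z \<in> carrier C \<Longrightarrow> linear_map K C U (\<lambda>x. F x y z)"
    and F2: "\<And>x z. x \<in> carrier C \<Longrightarrow> z \<in> carrier C \<Longrightarrow> linear_map K C U (\<lambda>y. F x y z)"
    and F3: "\<And>x y. x \<in> carrier C \<Longrightarrow> y \<in> carrier C \<Longrightarrow> linear_map K C U (\<lambda>z. F x y z)"
  shows "tsum U (comult C c) (\<lambda>s r. tsum U (comult C s) (\<lambda>p q. F p q r)) =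
    tsum U (comult C c) (\<lambda>p s. tsum U (comult C s) (\<lambda>q r. F p q r))"
proof -
  let ?T = "tensor_product3 K C C C"
  obtain \<phi> where \<phi>: "linear_map K ?T U \<phi>"
    and ev: "\<And>x y z. x \<in> carrier C \<Longrightarrow> y \<in> carrier C \<Longrightarrow> z \<in> carrier C \<Longrightarrow>
      \<phi> (ptensor3 K C C C x y z) = F x y z"
    using tensor3_lift[OF module_C module_C module_C U F1 F2 F3] by blast
  note push = linear_map_of_tsum_eq[where \<phi> = \<phi>] comult_closed ev \<phi> tsum_in_carrier ptensor_closed
    module_C tensor_product_module U
  have "tsum U (comult C c) (\<lambda>s r. tsum U (comult C s) (\<lambda>p q. F p q r)) =
      \<phi> (tsum ?T (comult C c) (\<lambda>s r. tsum ?T (comult C s) (\<lambda>p q. ptensor3 K C C C p q r)))"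
    using c by - (rule HOL.sym, (rule push | assumption)+)
  also have "\<dots> = \<phi> (tsum ?T (comult C c) (\<lambda>s r. tsum ?T (comult C r) (\<lambda>p q. ptensor3 K C C C s p q)))"
    using c by (simp add: coassoc)
  also have "\<dots> = tsum U (comult C c) (\<lambda>p s. tsum U (comult C s) (\<lambda>q r. F p q r))"
    using c by - (rule push | assumption)+
  finally show ?thesis .
qed

text \<open>
  Two rebracketings of the fourfold comultiplication that the antipode computations use. The first
  brings the two middle factors of \<open>(p \<otimes> q) \<otimes> (r \<otimes> s)\<close> under a common comultiplication, so that they
  can cancel.
\<close>

lemma
  assumes c: "c \<in> carrier C" and U: "module K U"
    and F1: "\<And>q r s. q \<in> carrier C \<Longrightarrow> r \<in> carrier C \<Longrightarrow> s \<in> carrier C \<Longrightarrow> linear_map K C U (\<lambda>p. F p q r s)"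
    and F2: "\<And>p r s. p \<in> carrier C \<Longrightarrow> r \<in> carrier C \<Longrightarrow> s \<in> carrier C \<Longrightarrow> linear_map K C U (\<lambda>q. F p q r s)"
    and F3: "\<And>p q s. p \<in> carrier C \<Longrightarrow> q \<in> carrier C \<Longrightarrow> s \<in> carrier C \<Longrightarrow> linear_map K C U (\<lambda>r. F p q r s)"
    and F4: "\<And>p q r. p \<in> carrier C \<Longrightarrow> q \<in> carrier C \<Longrightarrow> r \<in> carrier C \<Longrightarrow> linear_map K C U (\<lambda>s. F p q r s)"
  shows coassoc_sum_balanced_to_middle:
    "tsum U (comult C c) (\<lambda>u v. tsum U (comult C v) (\<lambda>r s. tsum U (comult C u) (\<lambda>p q. F p q r s))) =
     tsum U (comult C c) (\<lambda>p v. tsum U (comult C v) (\<lambda>u s. tsum U (comult C u) (\<lambda>q r. F p q r s)))"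
      (is "?balanced = ?middle")
    and coassoc_sum_right_to_left:
    "tsum U (comult C c) (\<lambda>p v. tsum U (comult C v) (\<lambda>q u. tsum U (comult C u) (\<lambda>r s. F p q r s))) =
     tsum U (comult C c) (\<lambda>v s. tsum U (comult C v) (\<lambda>u r. tsum U (comult C u) (\<lambda>p q. F p q r s)))"
      (is "?right = ?left")
proof -
  note F = linear_map_comp[OF _ F1] linear_map_comp[OF _ F2] linear_map_comp[OF _ F3] linear_map_comp[OF _ F4]
  note lin = lin_coalg F comult_closed module_C U
  have middle: "?right = ?middle"
    by (rule comult_sum_cong[OF c], rule coassoc_sum[symmetric], (rule lin | assumption)+)
  have "?balanced = tsum U (comult C c) (\<lambda>u v. tsum U (comult C u) (\<lambda>p q. tsum U (comult C v) (\<lambda>r s. F p q r s)))"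
    using c U linear_map_closed[OF F1] by (intro comult_sum_cong comult_sum_swap) simp_all
  also have "\<dots> = ?right"
    using c by - (rule coassoc_sum, (rule lin | assumption)+)
  also note middle
  finally show "?balanced = ?middle" .
  have "?middle = tsum U (comult C c) (\<lambda>w s. tsum U (comult C w) (\<lambda>p u. tsum U (comult C u) (\<lambda>q r. F p q r s)))"
    using c by - (rule coassoc_sum[symmetric], (rule lin | assumption)+)
  also have "\<dots> = ?left"
    by (rule comult_sum_cong[OF c], rule coassoc_sum[symmetric], (rule lin | assumption)+)
  finally show "?right = ?left" using middle by simp
qed

lemma counit_left_sum:
  assumes "c \<in> carrier C" "module K U" "linear_map K C U f"
  shows "tsum U (comult C c) (\<lambda>p q. counit C p \<odot>\<^bsub>U\<^esub> f q) = f c"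
proof -
  have "f c = f (tsum C (comult C c) (\<lambda>p q. counit C p \<odot>\<^bsub>C\<^esub> q))"
    using assms by (simp add: counit_left)
  also have "\<dots> = tsum U (comult C c) (\<lambda>p q. f (counit C p \<odot>\<^bsub>C\<^esub> q))"
    using assms by (intro linear_map_of_tsum[OF module_C module_C]) auto
  also have "\<dots> = tsum U (comult C c) (\<lambda>p q. counit C p \<odot>\<^bsub>U\<^esub> f q)"
    using assms by (intro comult_sum_cong linear_map_smult[OF assms(3)]) auto
  finally show ?thesis by simp
qed

lemma counit_right_sum:
  assumes "c \<in> carrier C" "module K U" "linear_map K C U f"
  shows "tsum U (comult C c) (\<lambda>p q. counit C q \<odot>\<^bsub>U\<^esub> f p) = f c"
proof -
  have "f c = f (tsum C (comult C c) (\<lambda>p q. counit C q \<odot>\<^bsub>C\<^esub> p))"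
    using assms by (simp add: counit_right)
  also have "\<dots> = tsum U (comult C c) (\<lambda>p q. f (counit C q \<odot>\<^bsub>C\<^esub> p))"
    using assms by (intro linear_map_of_tsum[OF module_C module_C]) auto
  also have "\<dots> = tsum U (comult C c) (\<lambda>p q. counit C q \<odot>\<^bsub>U\<^esub> f p)"
    using assms by (intro comult_sum_cong linear_map_smult[OF assms(3)]) auto
  finally show ?thesis by simp
qed

end

section \<open>The antipode of a Hopf algebra\<close>

context hopf_algebra
begin

abbreviation hmult (infixl "\<cdot>" 70) where "x \<cdot> y \<equiv> x \<otimes>\<^bsub>H\<^esub> y"

abbreviation "hsum U h f \<equiv> tsum U (comult H h) f"

lemma hmult_closed [simp]: "x \<in> carrier H \<Longrightarrow> y \<in> carrier H \<Longrightarrow> x \<cdot> y \<in> carrier H"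
  and hmult_assoc: "x \<in> carrier H \<Longrightarrow> y \<in> carrier H \<Longrightarrow> z \<in> carrier H \<Longrightarrow> x \<cdot> y \<cdot> z = x \<cdot> (y \<cdot> z)"
  and hone_closed [simp]: "\<one>\<^bsub>H\<^esub> \<in> carrier H"
  and hmult_one [simp]: "x \<in> carrier H \<Longrightarrow> x \<cdot> \<one>\<^bsub>H\<^esub> = x" "x \<in> carrier H \<Longrightarrow> \<one>\<^bsub>H\<^esub> \<cdot> x = x"
  and hsmult_closed [simp]: "a \<in> carrier K \<Longrightarrow> x \<in> carrier H \<Longrightarrow> a \<odot>\<^bsub>H\<^esub> x \<in> carrier H"
  by (simp_all add: M.m_assoc module.smult_closed[OF module_C])

lemma bilinear_hmult: "bilinear_map K H H H (\<lambda>x y. x \<cdot> y)"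
  by (intro bilinear_mapI linear_mapI)
    (simp_all add: M.l_distr M.r_distr smult_mult_left smult_mult_right)

lemmas linear_hmult_left = linear_map_comp[OF _ bilinear_map_left[OF bilinear_hmult]]
lemmas linear_hmult_right = linear_map_comp[OF _ bilinear_map_right[OF bilinear_hmult]]
lemmas linear_antipode = linear_map_comp[OF _ antipode_linear]

lemma antipode_closed [simp]: "x \<in> carrier H \<Longrightarrow> antipode H x \<in> carrier H"
  by (rule linear_map_closed[OF antipode_linear])

lemmas lin = lin_coalg linear_hmult_left linear_hmult_right linear_antipode comult_closed ptensor_closed
  tsum_in_carrier module_C tensor_product_module

text \<open>
  The product of two tensors is defined by all pairwise products of entries of representatives; a
  sum over it is therefore literally a double sum.
\<close>
lemma comult_hmult_sum:
  assumes x: "x \<in> carrier H" and y: "y \<in> carrier H" and U: "module K U"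
    and F1: "\<And>w. w \<in> carrier H \<Longrightarrow> linear_map K H U (\<lambda>v. f v w)"
    and F2: "\<And>v. v \<in> carrier H \<Longrightarrow> linear_map K H U (\<lambda>w. f v w)"
  shows "hsum U (x \<cdot> y) f =
    hsum U x (\<lambda>x1 x2. hsum U y (\<lambda>y1 y2. f (x1 \<cdot> y1) (x2 \<cdot> y2)))"
proof -
  let ?X = "tensor_rep (comult H x)" and ?Y = "tensor_rep (comult H y)"
  interpret U: module K U by (rule U)
  have rep: "set (tensor_rep (comult H z)) \<subseteq> carrier H \<times> carrier H" if "z \<in> carrier H" for z
    using that by (intro tensor_rep_carrier[OF module_C module_C]) simp
  have cl: "f v w \<in> carrier U" if "v \<in> carrier H" "w \<in> carrier H" for v w
    using linear_map_closed[OF F1] that by simp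
  have ab: "abelian_monoid U" by (rule U.M.abelian_monoid_axioms)
  have inner: "pair_sum U [(a \<cdot> c, b \<cdot> d). (c, d) \<leftarrow> ys] f = pair_sum U ys (\<lambda>c d. f (a \<cdot> c) (b \<cdot> d))"
    for a b ys by (simp add: pair_sum_def foldr_map o_def case_prod_unfold)
  have outer: "pair_sum U [(a \<cdot> c, b \<cdot> d). (a, b) \<leftarrow> xs, (c, d) \<leftarrow> ?Y] f =
      pair_sum U xs (\<lambda>a b. pair_sum U ?Y (\<lambda>c d. f (a \<cdot> c) (b \<cdot> d)))"
    if "set xs \<subseteq> carrier H \<times> carrier H" for xs
    using that
  proof (induction xs)
    case (Cons z xs)
    obtain a b where z: "z = (a, b)" "a \<in> carrier H" "b \<in> carrier H" using Cons.prems by (cases z) auto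
    have "set [(a \<cdot> c, b \<cdot> d). (c, d) \<leftarrow> ?Y] \<subseteq> carrier H \<times> carrier H"
      "set [(a \<cdot> c, b \<cdot> d). (a, b) \<leftarrow> xs, (c, d) \<leftarrow> ?Y] \<subseteq> carrier H \<times> carrier H"
      using z Cons.prems rep[OF y] by auto
    from pair_sum_append[OF ab this cl] show ?case
      using Cons z by (simp add: inner)
  qed simp
  have "comult H (x \<cdot> y) = tensor_class K H H [(a \<cdot> c, b \<cdot> d). (a, b) \<leftarrow> ?X, (c, d) \<leftarrow> ?Y]"
    using x y by (simp add: comult_mult tensor_product_def)
  then have "hsum U (x \<cdot> y) f = pair_sum U [(a \<cdot> c, b \<cdot> d). (a, b) \<leftarrow> ?X, (c, d) \<leftarrow> ?Y] f"
    using rep[OF x] rep[OF y]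
    by (subst pair_sum_def)
      (auto intro!: tsum_tensor_class[OF module_C module_C U] bilinear_mapI F1 F2 hmult_closed simp: subset_iff)
  then show ?thesis by (simp add: outer[OF rep[OF x]] tsum_eq_pair_sum)
qed

lemma comult_one_sum:
  assumes "module K U"
    and "\<And>w. w \<in> carrier H \<Longrightarrow> linear_map K H U (\<lambda>v. f v w)"
    and "\<And>v. v \<in> carrier H \<Longrightarrow> linear_map K H U (\<lambda>w. f v w)"
  shows "hsum U \<one>\<^bsub>H\<^esub> f = f \<one>\<^bsub>H\<^esub> \<one>\<^bsub>H\<^esub>"
proof -
  have "comult H \<one>\<^bsub>H\<^esub> = ptensor K H H \<one>\<^bsub>H\<^esub> \<one>\<^bsub>H\<^esub>"
    by (simp add: comult_one tensor_product_def)
  then show ?thesis using tsum_ptensor_eq[OF hone_closed hone_closed assms(2,3) module_C module_C assms(1)] by simp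
qed

lemma antipode_left_sum:
  assumes h: "h \<in> carrier H" and U: "module K U" and f: "linear_map K H U f"
  shows "hsum U h (\<lambda>p q. f (antipode H p \<cdot> q)) = counit H h \<odot>\<^bsub>U\<^esub> f \<one>\<^bsub>H\<^esub>"
proof -
  have "hsum U h (\<lambda>p q. f (antipode H p \<cdot> q)) = f (hsum H h (\<lambda>p q. antipode H p \<cdot> q))"
    using h by (intro linear_map_of_tsum[OF module_C module_C _ module_C U f, symmetric]) simp_all
  then show ?thesis
    using h by (simp add: antipode_left linear_map_smult[OF f])
qed

lemma antipode_right_sum:
  assumes h: "h \<in> carrier H" and U: "module K U" and f: "linear_map K H U f"
  shows "hsum U h (\<lambda>p q. f (p \<cdot> antipode H q)) = counit H h \<odot>\<^bsub>U\<^esub> f \<one>\<^bsub>H\<^esub>"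
proof -
  have "hsum U h (\<lambda>p q. f (p \<cdot> antipode H q)) = f (hsum H h (\<lambda>p q. p \<cdot> antipode H q))"
    using h by (intro linear_map_of_tsum[OF module_C module_C _ module_C U f, symmetric]) simp_all
  then show ?thesis
    using h by (simp add: antipode_right linear_map_smult[OF f])
qed

lemma antipode_one: "antipode H \<one>\<^bsub>H\<^esub> = \<one>\<^bsub>H\<^esub>"
proof -
  have "hsum H \<one>\<^bsub>H\<^esub> (\<lambda>p q. antipode H p \<cdot> q) = antipode H \<one>\<^bsub>H\<^esub> \<cdot> \<one>\<^bsub>H\<^esub>"
    by - (rule comult_one_sum[where f = "\<lambda>p q. antipode H p \<cdot> q"], (rule lin | assumption | simp)+)
  then show ?thesis
    by (simp add: antipode_left counit_one module.smult_one[OF module_C])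
qed

lemma self_smult [simp]: "a \<odot>\<^bsub>self_module K\<^esub> b = a \<otimes>\<^bsub>K\<^esub> b"
  and self_carrier [simp]: "carrier (self_module K) = carrier K"
  by (simp_all add: self_module_def)

lemma counit_antipode:
  assumes h: "h \<in> carrier H"
  shows "counit H (antipode H h) = counit H h"
proof -
  have "counit H (antipode H h) =
      tsum (self_module K) (comult H h) (\<lambda>p q. counit H q \<odot>\<^bsub>self_module K\<^esub> counit H (antipode H p))"
    using h by - (rule counit_right_sum[symmetric, where f = "\<lambda>p. counit H (antipode H p)"], (rule lin | assumption | simp)+)
  also have "\<dots> = tsum (self_module K) (comult H h) (\<lambda>p q. counit H (antipode H p \<cdot> q))"
    using h by (intro comult_sum_cong) (simp_all add: counit_mult R.m_comm)
  also have "\<dots> = counit H h"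
    using h by (subst antipode_left_sum[OF h module_K counit_linear]) (simp add: counit_one)
  finally show ?thesis .
qed

lemma antipode_right_absorb_fst:
  assumes h: "h \<in> carrier H" and U: "module K U"
    and F1: "\<And>y. y \<in> carrier H \<Longrightarrow> linear_map K H U (\<lambda>x. F x y)"
    and F2: "\<And>x. x \<in> carrier H \<Longrightarrow> linear_map K H U (\<lambda>y. F x y)"
  shows "hsum U h (\<lambda>s t. hsum U s (\<lambda>p q. F (p \<cdot> antipode H q) t)) = F \<one>\<^bsub>H\<^esub> h"
proof -
  have "hsum U h (\<lambda>s t. hsum U s (\<lambda>p q. F (p \<cdot> antipode H q) t)) =
      hsum U h (\<lambda>s t. counit H s \<odot>\<^bsub>U\<^esub> F \<one>\<^bsub>H\<^esub> t)"
    using h by (intro comult_sum_cong antipode_right_sum U F1) simp_all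
  also have "\<dots> = F \<one>\<^bsub>H\<^esub> h"
    using h by (intro counit_left_sum U F2) simp_all
  finally show ?thesis .
qed

lemma antipode_right_absorb_snd:
  assumes h: "h \<in> carrier H" and U: "module K U"
    and F1: "\<And>y. y \<in> carrier H \<Longrightarrow> linear_map K H U (\<lambda>x. F x y)"
    and F2: "\<And>x. x \<in> carrier H \<Longrightarrow> linear_map K H U (\<lambda>y. F x y)"
  shows "hsum U h (\<lambda>s t. hsum U t (\<lambda>p q. F s (p \<cdot> antipode H q))) = F h \<one>\<^bsub>H\<^esub>"
proof -
  have "hsum U h (\<lambda>s t. hsum U t (\<lambda>p q. F s (p \<cdot> antipode H q))) =
      hsum U h (\<lambda>s t. counit H t \<odot>\<^bsub>U\<^esub> F s \<one>\<^bsub>H\<^esub>)"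
    using h by (intro comult_sum_cong antipode_right_sum U F2) simp_all
  also have "\<dots> = F h \<one>\<^bsub>H\<^esub>"
    using h by (intro counit_right_sum U F1) simp_all
  finally show ?thesis .
qed

lemma sum_smult:
  assumes "module K U" "a \<in> carrier K" "t \<in> carrier (tensor_product K H H)"
    and "\<And>v w. v \<in> carrier H \<Longrightarrow> w \<in> carrier H \<Longrightarrow> f v w \<in> carrier U"
  shows "tsum U t (\<lambda>v w. a \<odot>\<^bsub>U\<^esub> f v w) = a \<odot>\<^bsub>U\<^esub> tsum U t f"
  using linear_map_of_tsum[OF module_C module_C assms(3) assms(1,1) linear_map_smult_const[OF assms(1,2)] assms(4)]
  by simp

text \<open>
  Multiplicativity of the comultiplication gives \<open>S(x1 y1) x2 y2 = \<epsilon>(x) \<epsilon>(y)\<close>. Multiplying by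
  \<open>S(y3)\<close> from the right cancels \<open>y2\<close>.
\<close>
lemma antipode_hmult_aux:
  assumes x: "x \<in> carrier H" and y: "y \<in> carrier H"
  shows "hsum H x (\<lambda>a u. antipode H (a \<cdot> y) \<cdot> u) = counit H x \<odot>\<^bsub>H\<^esub> antipode H y"
proof -
  let ?S = "antipode H"
  have "hsum H x (\<lambda>a u. ?S (a \<cdot> y) \<cdot> u) = hsum H x (\<lambda>a u. ?S (a \<cdot> y) \<cdot> (u \<cdot> \<one>\<^bsub>H\<^esub>))"
    using x y by (intro comult_sum_cong) simp_all
  also have "\<dots> = hsum H y (\<lambda>b s. hsum H s (\<lambda>m n.
      hsum H x (\<lambda>a u. ?S (a \<cdot> b) \<cdot> (u \<cdot> (m \<cdot> ?S n)))))"
    using x y by - (rule antipode_right_absorb_snd[symmetric,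
        where F = "\<lambda>b z. hsum H x (\<lambda>a u. ?S (a \<cdot> b) \<cdot> (u \<cdot> z))"], (rule lin | assumption | simp)+)
  also have "\<dots> = hsum H y (\<lambda>s n. hsum H s (\<lambda>b m.
      hsum H x (\<lambda>a u. ?S (a \<cdot> b) \<cdot> (u \<cdot> (m \<cdot> ?S n)))))"
    using x y by - (rule coassoc_sum[symmetric], (rule lin | assumption | simp)+)
  also have "\<dots> = hsum H y (\<lambda>s n. hsum H x (\<lambda>a u. hsum H s (\<lambda>b m.
      ?S (a \<cdot> b) \<cdot> (u \<cdot> (m \<cdot> ?S n)))))"
    using x y by (intro comult_sum_cong comult_sum_swap) simp_all
  also have "\<dots> = hsum H y (\<lambda>s n. hsum H x (\<lambda>a u. hsum H s (\<lambda>b m.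
      ?S (a \<cdot> b) \<cdot> (u \<cdot> m) \<cdot> ?S n)))"
    using x y by (intro comult_sum_cong) (simp_all add: hmult_assoc)
  also have "\<dots> = hsum H y (\<lambda>s n. hsum H (x \<cdot> s) (\<lambda>p q. ?S p \<cdot> q \<cdot> ?S n))"
  proof (intro comult_sum_cong y)
    fix s n assume "s \<in> carrier H" "n \<in> carrier H"
    then show "hsum H x (\<lambda>a u. hsum H s (\<lambda>b m. ?S (a \<cdot> b) \<cdot> (u \<cdot> m) \<cdot> ?S n)) =
        hsum H (x \<cdot> s) (\<lambda>p q. ?S p \<cdot> q \<cdot> ?S n)"
      using x by - (rule comult_hmult_sum[symmetric, where f = "\<lambda>p q. ?S p \<cdot> q \<cdot> ?S n"],
          (rule lin | assumption | simp)+)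
  qed
  also have "\<dots> = hsum H y (\<lambda>s n. counit H (x \<cdot> s) \<odot>\<^bsub>H\<^esub> (\<one>\<^bsub>H\<^esub> \<cdot> ?S n))"
  proof (intro comult_sum_cong y)
    fix s n assume "s \<in> carrier H" "n \<in> carrier H"
    then show "hsum H (x \<cdot> s) (\<lambda>p q. ?S p \<cdot> q \<cdot> ?S n) = counit H (x \<cdot> s) \<odot>\<^bsub>H\<^esub> (\<one>\<^bsub>H\<^esub> \<cdot> ?S n)"
      using x by - (rule antipode_left_sum[where f = "\<lambda>z. z \<cdot> ?S n"], (rule lin | assumption | simp)+)
  qed
  also have "\<dots> = hsum H y (\<lambda>s n. counit H x \<odot>\<^bsub>H\<^esub> (counit H s \<odot>\<^bsub>H\<^esub> ?S n))"
    using x y by (intro comult_sum_cong) (simp_all add: counit_mult module.smult_assoc1[OF module_C])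
  also have "\<dots> = counit H x \<odot>\<^bsub>H\<^esub> hsum H y (\<lambda>s n. counit H s \<odot>\<^bsub>H\<^esub> ?S n)"
    using x y by (intro sum_smult) simp_all
  also have "\<dots> = counit H x \<odot>\<^bsub>H\<^esub> ?S y"
    using y by (simp add: counit_left_sum antipode_linear)
  finally show ?thesis .
qed

text \<open>
  \<open>S(x y) = S(x1 y) x2 S(x3) = \<epsilon>(x1) S(y) S(x2) = S(y) S(x)\<close>.
\<close>
lemma antipode_hmult:
  assumes x: "x \<in> carrier H" and y: "y \<in> carrier H"
  shows "antipode H (x \<cdot> y) = antipode H y \<cdot> antipode H x"
proof -
  let ?S = "antipode H"
  have "?S (x \<cdot> y) = ?S (x \<cdot> y) \<cdot> \<one>\<^bsub>H\<^esub>" using x y by simp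
  also have "\<dots> = hsum H x (\<lambda>a r. hsum H r (\<lambda>u v. ?S (a \<cdot> y) \<cdot> (u \<cdot> ?S v)))"
    using x y by - (rule antipode_right_absorb_snd[symmetric, where F = "\<lambda>a z. ?S (a \<cdot> y) \<cdot> z"],
        (rule lin | assumption | simp)+)
  also have "\<dots> = hsum H x (\<lambda>s v. hsum H s (\<lambda>a u. ?S (a \<cdot> y) \<cdot> (u \<cdot> ?S v)))"
    using x y by - (rule coassoc_sum[symmetric], (rule lin | assumption | simp)+)
  also have "\<dots> = hsum H x (\<lambda>s v. hsum H s (\<lambda>a u. ?S (a \<cdot> y) \<cdot> u \<cdot> ?S v))"
    using x y by (intro comult_sum_cong) (simp_all add: hmult_assoc)
  also have "\<dots> = hsum H x (\<lambda>s v. hsum H s (\<lambda>a u. ?S (a \<cdot> y) \<cdot> u) \<cdot> ?S v)"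
  proof (intro comult_sum_cong x)
    fix s v assume "s \<in> carrier H" "v \<in> carrier H"
    then show "hsum H s (\<lambda>a u. ?S (a \<cdot> y) \<cdot> u \<cdot> ?S v) = hsum H s (\<lambda>a u. ?S (a \<cdot> y) \<cdot> u) \<cdot> ?S v"
      using y by - (rule linear_map_of_tsum[OF module_C module_C comult_closed module_C module_C,
            where \<phi> = "\<lambda>z. z \<cdot> ?S v", symmetric], (rule lin | assumption | simp)+)
  qed
  also have "\<dots> = hsum H x (\<lambda>s v. counit H s \<odot>\<^bsub>H\<^esub> (?S y \<cdot> ?S v))"
    using x y by (intro comult_sum_cong) (simp_all add: antipode_hmult_aux smult_mult_left)
  also have "\<dots> = ?S y \<cdot> ?S x"
    using x y by - (rule counit_left_sum[where f = "\<lambda>z. ?S y \<cdot> ?S z"], (rule lin | assumption | simp)+)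
  finally show ?thesis .
qed

end

section \<open>The twisted adjoint action\<close>

locale bijective_hopf_algebra = hopf_algebra K H
  for K :: "('k, 'p) ring_scheme" (structure) and H :: "('k, 'h, 'q) hopf_algebra_scheme" (structure) +
  assumes antipode_bij: "bij_betw (antipode H) (carrier H) (carrier H)"
begin

abbreviation "S \<equiv> antipode H"
abbreviation "S' \<equiv> antipode_inv H"

lemma antipode_inv_closed [simp]: "x \<in> carrier H \<Longrightarrow> S' x \<in> carrier H"
  using bij_betwE[OF bij_betw_inv_into[OF antipode_bij]] by (simp add: antipode_inv_def)

lemma antipode_antipode_inv [simp]: "x \<in> carrier H \<Longrightarrow> S (S' x) = x"
  using antipode_bij by (simp add: antipode_inv_def bij_betw_inv_into_right)

lemma antipode_inj: "x \<in> carrier H \<Longrightarrow> y \<in> carrier H \<Longrightarrow> S x = S y \<Longrightarrow> x = y"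
  using antipode_bij by (meson bij_betw_def inj_onD)

lemma antipode_inv_linear: "linear_map K H H S'"
proof (rule linear_mapI)
  interpret H: module K H by (rule module_C)
  fix x y assume xy: "x \<in> carrier H" "y \<in> carrier H"
  show "S' (x \<oplus>\<^bsub>H\<^esub> y) = S' x \<oplus>\<^bsub>H\<^esub> S' y"
    by (rule antipode_inj) (use xy in \<open>simp_all add: linear_map_add[OF antipode_linear]\<close>)
next
  interpret H: module K H by (rule module_C)
  fix a x assume ax: "a \<in> carrier K" "x \<in> carrier H"
  show "S' (a \<odot>\<^bsub>H\<^esub> x) = a \<odot>\<^bsub>H\<^esub> S' x"
    by (rule antipode_inj) (use ax in \<open>simp_all add: linear_map_smult[OF antipode_linear]\<close>)
qed simp

lemma antipode_inv_hmult: "x \<in> carrier H \<Longrightarrow> y \<in> carrier H \<Longrightarrow> S' (x \<cdot> y) = S' y \<cdot> S' x"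
  by (rule antipode_inj) (simp_all add: antipode_hmult)

lemma antipode_inv_one: "S' \<one>\<^bsub>H\<^esub> = \<one>\<^bsub>H\<^esub>"
  by (rule antipode_inj) (simp_all add: antipode_one)

lemma counit_antipode_inv: "x \<in> carrier H \<Longrightarrow> counit H (S' x) = counit H x"
  using counit_antipode[of "S' x"] by simp

lemmas linear_antipode_inv = linear_map_comp[OF _ antipode_inv_linear]
lemmas lin_inv = lin linear_antipode_inv

text \<open>
  The inverse antipode satisfies the antipode axioms for the opposite comultiplication: apply \<open>S\<close>
  to both sides and use that it reverses products.
\<close>
lemma antipode_inv_right:
  assumes h: "h \<in> carrier H"
  shows "hsum H h (\<lambda>p q. q \<cdot> S' p) = counit H h \<odot>\<^bsub>H\<^esub> \<one>\<^bsub>H\<^esub>"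
proof (rule antipode_inj)
  have "S (hsum H h (\<lambda>p q. q \<cdot> S' p)) = hsum H h (\<lambda>p q. S (q \<cdot> S' p))"
    using h by (intro linear_map_of_tsum[OF module_C module_C _ module_C module_C antipode_linear]) simp_all
  also have "\<dots> = hsum H h (\<lambda>p q. p \<cdot> S q)"
    using h by (intro comult_sum_cong) (simp_all add: antipode_hmult)
  also have "\<dots> = S (counit H h \<odot>\<^bsub>H\<^esub> \<one>\<^bsub>H\<^esub>)"
    using h by (simp add: antipode_right linear_map_smult[OF antipode_linear] antipode_one)
  finally show "S (hsum H h (\<lambda>p q. q \<cdot> S' p)) = S (counit H h \<odot>\<^bsub>H\<^esub> \<one>\<^bsub>H\<^esub>)" .
qed (insert h, (rule lin_inv | assumption | simp)+)

lemma antipode_inv_left: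
  assumes h: "h \<in> carrier H"
  shows "hsum H h (\<lambda>p q. S' q \<cdot> p) = counit H h \<odot>\<^bsub>H\<^esub> \<one>\<^bsub>H\<^esub>"
proof (rule antipode_inj)
  have "S (hsum H h (\<lambda>p q. S' q \<cdot> p)) = hsum H h (\<lambda>p q. S (S' q \<cdot> p))"
    using h by (intro linear_map_of_tsum[OF module_C module_C _ module_C module_C antipode_linear]) simp_all
  also have "\<dots> = hsum H h (\<lambda>p q. S p \<cdot> q)"
    using h by (intro comult_sum_cong) (simp_all add: antipode_hmult)
  also have "\<dots> = S (counit H h \<odot>\<^bsub>H\<^esub> \<one>\<^bsub>H\<^esub>)"
    using h by (simp add: antipode_left linear_map_smult[OF antipode_linear] antipode_one)
  finally show "S (hsum H h (\<lambda>p q. S' q \<cdot> p)) = S (counit H h \<odot>\<^bsub>H\<^esub> \<one>\<^bsub>H\<^esub>)" .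
qed (insert h, (rule lin_inv | assumption | simp)+)

text \<open>
  These are the legs \<open>L(h, a)\<close> and \<open>R(h, b)\<close> of the equivariance condition. \<open>L\<close> is the right adjoint
  action of \<open>H\<close>, and \<open>R\<close> the corresponding action for the opposite comultiplication.
\<close>
definition ad_left :: "'h \<Rightarrow> 'h \<Rightarrow> 'h" where
  "ad_left h a = hsum H h (\<lambda>p q. S p \<cdot> a \<cdot> q)"

definition ad_right :: "'h \<Rightarrow> 'h \<Rightarrow> 'h" where
  "ad_right h b = hsum H h (\<lambda>p q. S' q \<cdot> b \<cdot> p)"

lemma linear_ad_left:
  assumes "linear_map K P H f" "a \<in> carrier H"
  shows "linear_map K P H (\<lambda>x. ad_left (f x) a)"
  unfolding ad_left_def using assms by - (rule lin_inv | assumption | simp)+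

lemma linear_ad_left_arg:
  assumes "linear_map K P H f" "h \<in> carrier H" "module K P"
  shows "linear_map K P H (\<lambda>x. ad_left h (f x))"
  unfolding ad_left_def using assms by - (rule lin_inv | assumption | simp)+

lemma linear_ad_right:
  assumes "linear_map K P H f" "a \<in> carrier H"
  shows "linear_map K P H (\<lambda>x. ad_right (f x) a)"
  unfolding ad_right_def using assms by - (rule lin_inv | assumption | simp)+

lemma linear_ad_right_arg:
  assumes "linear_map K P H f" "h \<in> carrier H" "module K P"
  shows "linear_map K P H (\<lambda>x. ad_right h (f x))"
  unfolding ad_right_def using assms by - (rule lin_inv | assumption | simp)+

lemma ad_left_closed [simp]: "h \<in> carrier H \<Longrightarrow> a \<in> carrier H \<Longrightarrow> ad_left h a \<in> carrier H"
  unfolding ad_left_def by (rule lin_inv | assumption | simp)+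

lemma ad_right_closed [simp]: "h \<in> carrier H \<Longrightarrow> a \<in> carrier H \<Longrightarrow> ad_right h a \<in> carrier H"
  unfolding ad_right_def by (rule lin_inv | assumption | simp)+

lemmas lin_ad = lin_inv linear_ad_left linear_ad_left_arg linear_ad_right linear_ad_right_arg

lemma linear_sum_comult:
  assumes "h \<in> carrier H" "module K U" "linear_map K H U f"
    "\<And>p q. p \<in> carrier H \<Longrightarrow> q \<in> carrier H \<Longrightarrow> g p q \<in> carrier H"
  shows "f (hsum H h g) = hsum U h (\<lambda>p q. f (g p q))"
  using linear_map_of_tsum[OF module_C module_C comult_closed[OF assms(1)] module_C assms(2,3,4)] .

lemma ad_left_one: "h \<in> carrier H \<Longrightarrow> ad_left h \<one>\<^bsub>H\<^esub> = counit H h \<odot>\<^bsub>H\<^esub> \<one>\<^bsub>H\<^esub>"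
  unfolding ad_left_def by (subst antipode_left[symmetric]) (auto intro: comult_sum_cong)

lemma ad_right_one: "h \<in> carrier H \<Longrightarrow> ad_right h \<one>\<^bsub>H\<^esub> = counit H h \<odot>\<^bsub>H\<^esub> \<one>\<^bsub>H\<^esub>"
  unfolding ad_right_def by (subst antipode_inv_left[symmetric]) (auto intro: comult_sum_cong)

lemma one_ad_left: "a \<in> carrier H \<Longrightarrow> ad_left \<one>\<^bsub>H\<^esub> a = a"
  unfolding ad_left_def
  by (subst comult_one_sum[OF module_C], (rule lin_inv | assumption | simp)+) (simp add: antipode_one)

lemma one_ad_right: "a \<in> carrier H \<Longrightarrow> ad_right \<one>\<^bsub>H\<^esub> a = a"
  unfolding ad_right_def
  by (subst comult_one_sum[OF module_C], (rule lin_inv | assumption | simp)+) (simp add: antipode_inv_one)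

lemma counit_ad_left:
  assumes h: "h \<in> carrier H" and a: "a \<in> carrier H"
  shows "counit H (ad_left h a) = counit H h \<otimes>\<^bsub>K\<^esub> counit H a"
proof -
  have "counit H (ad_left h a) = tsum (self_module K) (comult H h) (\<lambda>p q. counit H (S p \<cdot> a \<cdot> q))"
    unfolding ad_left_def using assms by (intro linear_sum_comult counit_linear) simp_all
  also have "\<dots> = tsum (self_module K) (comult H h) (\<lambda>p q. counit H p \<odot>\<^bsub>self_module K\<^esub> (counit H a \<odot>\<^bsub>self_module K\<^esub> counit H q))"
    using assms by (intro comult_sum_cong) (simp_all add: counit_mult counit_antipode R.m_assoc)
  also have "\<dots> = counit H a \<odot>\<^bsub>self_module K\<^esub> counit H h"
    using assms
    by (intro counit_left_sum[where f = "\<lambda>q. counit H a \<odot>\<^bsub>self_module K\<^esub> counit H q"]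
        linear_map_smult_right counit_linear module_K) (simp_all del: self_smult)
  finally show ?thesis using assms by (simp add: R.m_comm)
qed

lemma counit_ad_right:
  assumes h: "h \<in> carrier H" and a: "a \<in> carrier H"
  shows "counit H (ad_right h a) = counit H h \<otimes>\<^bsub>K\<^esub> counit H a"
proof -
  have "counit H (ad_right h a) = tsum (self_module K) (comult H h) (\<lambda>p q. counit H (S' q \<cdot> a \<cdot> p))"
    unfolding ad_right_def using assms by (intro linear_sum_comult counit_linear) simp_all
  also have "\<dots> = tsum (self_module K) (comult H h) (\<lambda>p q. counit H p \<odot>\<^bsub>self_module K\<^esub> (counit H a \<odot>\<^bsub>self_module K\<^esub> counit H q))"
    using assms by (intro comult_sum_cong) (simp_all add: counit_mult counit_antipode_inv R.m_ac)
  also have "\<dots> = counit H a \<odot>\<^bsub>self_module K\<^esub> counit H h"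
    using assms
    by (intro counit_left_sum[where f = "\<lambda>q. counit H a \<odot>\<^bsub>self_module K\<^esub> counit H q"]
        linear_map_smult_right counit_linear module_K) (simp_all del: self_smult)
  finally show ?thesis using assms by (simp add: R.m_comm)
qed

text \<open>
  \<open>h1 S(h2) x h3 = x h\<close>: a factor to the left of \<open>L\<close> cancels its antipode. Together with
  the next lemma, this is what removes \<open>h\<close> from the twisted cocycle identity.
\<close>
lemma ad_left_absorb:
  assumes h: "h \<in> carrier H" and x: "x \<in> carrier H"
  shows "hsum H h (\<lambda>p r. p \<cdot> ad_left r x) = x \<cdot> h"
proof -
  have "hsum H h (\<lambda>p r. p \<cdot> ad_left r x) =
      hsum H h (\<lambda>p r. hsum H r (\<lambda>q t. p \<cdot> (S q \<cdot> x \<cdot> t)))"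
    unfolding ad_left_def using assms
    by (intro comult_sum_cong linear_sum_comult linear_hmult_right linear_map_id) simp_all
  also have "\<dots> = hsum H h (\<lambda>s t. hsum H s (\<lambda>p q. p \<cdot> (S q \<cdot> x \<cdot> t)))"
    using assms by - (rule coassoc_sum[symmetric], (rule lin_inv | assumption | simp)+)
  also have "\<dots> = hsum H h (\<lambda>s t. hsum H s (\<lambda>p q. (p \<cdot> S q) \<cdot> (x \<cdot> t)))"
    using assms by (intro comult_sum_cong) (simp_all add: hmult_assoc)
  also have "\<dots> = \<one>\<^bsub>H\<^esub> \<cdot> (x \<cdot> h)"
    using assms by - (rule antipode_right_absorb_fst[where F = "\<lambda>z t. z \<cdot> (x \<cdot> t)"], (rule lin_inv | assumption | simp)+)
  finally show ?thesis using assms by simp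
qed

text \<open>
  A factor to the left of \<open>R\<close> cancels the inverse antipode: \<open>h3 S'(h2) b h1 = b h\<close>.
\<close>
lemma ad_right_absorb:
  assumes h: "h \<in> carrier H" and b: "b \<in> carrier H"
  shows "hsum H h (\<lambda>r t. t \<cdot> ad_right r b) = b \<cdot> h"
proof -
  have "hsum H h (\<lambda>r t. t \<cdot> ad_right r b) =
      hsum H h (\<lambda>r t. hsum H r (\<lambda>p q. t \<cdot> (S' q \<cdot> b \<cdot> p)))"
    unfolding ad_right_def using assms
    by (intro comult_sum_cong linear_sum_comult linear_hmult_right linear_map_id) simp_all
  also have "\<dots> = hsum H h (\<lambda>p r. hsum H r (\<lambda>q t. t \<cdot> (S' q \<cdot> b \<cdot> p)))"
    using assms by - (rule coassoc_sum, (rule lin_inv | assumption | simp)+)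
  also have "\<dots> = hsum H h (\<lambda>p r. hsum H r (\<lambda>q t. t \<cdot> S' q \<cdot> (b \<cdot> p)))"
    using assms by (intro comult_sum_cong) (simp_all add: hmult_assoc)
  also have "\<dots> = hsum H h (\<lambda>p r. hsum H r (\<lambda>q t. t \<cdot> S' q) \<cdot> (b \<cdot> p))"
    using assms by (intro comult_sum_cong linear_sum_comult[where f = "\<lambda>z. z \<cdot> (b \<cdot> _)", symmetric]
       linear_hmult_left linear_map_id) simp_all
  also have "\<dots> = hsum H h (\<lambda>p r. counit H r \<odot>\<^bsub>H\<^esub> (b \<cdot> p))"
    using assms by (intro comult_sum_cong) (simp_all add: antipode_inv_right smult_mult_left)
  also have "\<dots> = b \<cdot> h"
    using assms by - (rule counit_right_sum, (rule lin_inv | assumption | simp)+)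
  finally show ?thesis .
qed

lemma ad_left_hmult:
  assumes h: "h \<in> carrier H" and g: "g \<in> carrier H" and a: "a \<in> carrier H"
  shows "ad_left (h \<cdot> g) a = ad_left g (ad_left h a)"
proof -
  have "ad_left (h \<cdot> g) a = hsum H h (\<lambda>p q. hsum H g (\<lambda>s t. S (p \<cdot> s) \<cdot> a \<cdot> (q \<cdot> t)))"
    unfolding ad_left_def using assms
    by - (rule comult_hmult_sum[where f = "\<lambda>p q. S p \<cdot> a \<cdot> q"], (rule lin_inv | assumption | simp)+)
  also have "\<dots> = hsum H g (\<lambda>s t. hsum H h (\<lambda>p q. S (p \<cdot> s) \<cdot> a \<cdot> (q \<cdot> t)))"
    using assms by (intro comult_sum_swap) simp_all
  also have "\<dots> = hsum H g (\<lambda>s t. hsum H h (\<lambda>p q. S s \<cdot> (S p \<cdot> a \<cdot> q) \<cdot> t))"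
    using assms by (intro comult_sum_cong) (simp_all add: antipode_hmult hmult_assoc)
  also have "\<dots> = hsum H g (\<lambda>s t. S s \<cdot> ad_left h a \<cdot> t)"
    unfolding ad_left_def using assms
    by (intro comult_sum_cong linear_sum_comult[where f = "\<lambda>z. S _ \<cdot> z \<cdot> _", symmetric]
       linear_hmult_left linear_hmult_right linear_map_id) simp_all
  finally show ?thesis unfolding ad_left_def[of g] .
qed

lemma ad_right_hmult:
  assumes h: "h \<in> carrier H" and g: "g \<in> carrier H" and a: "a \<in> carrier H"
  shows "ad_right (h \<cdot> g) a = ad_right g (ad_right h a)"
proof -
  have "ad_right (h \<cdot> g) a = hsum H h (\<lambda>p q. hsum H g (\<lambda>s t. S' (q \<cdot> t) \<cdot> a \<cdot> (p \<cdot> s)))"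
    unfolding ad_right_def using assms
    by - (rule comult_hmult_sum[where f = "\<lambda>p q. S' q \<cdot> a \<cdot> p"], (rule lin_inv | assumption | simp)+)
  also have "\<dots> = hsum H g (\<lambda>s t. hsum H h (\<lambda>p q. S' (q \<cdot> t) \<cdot> a \<cdot> (p \<cdot> s)))"
    using assms by (intro comult_sum_swap) simp_all
  also have "\<dots> = hsum H g (\<lambda>s t. hsum H h (\<lambda>p q. S' t \<cdot> (S' q \<cdot> a \<cdot> p) \<cdot> s))"
    using assms by (intro comult_sum_cong) (simp_all add: antipode_inv_hmult hmult_assoc)
  also have "\<dots> = hsum H g (\<lambda>s t. S' t \<cdot> ad_right h a \<cdot> s)"
    unfolding ad_right_def using assms
    by (intro comult_sum_cong linear_sum_comult[where f = "\<lambda>z. S' _ \<cdot> z \<cdot> _", symmetric]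
       linear_hmult_left linear_hmult_right linear_map_id) simp_all
  finally show ?thesis unfolding ad_right_def[of g] .
qed

abbreviation "HH \<equiv> tensor_product K H H"

text \<open>
  This is \<open>a \<otimes> b \<mapsto> S(h1) a h2 \<otimes> S'(h4) b h3\<close>, with the four factors grouped into the two legs; the
  ungrouped form is \<open>twisted_ad_expand\<close> below.
\<close>
definition twisted_ad :: "'h \<Rightarrow> ('h, 'h) tensor \<Rightarrow> ('h, 'h) tensor" where
  "twisted_ad h t = hsum HH h (\<lambda>p q. tsum HH t (\<lambda>a b. ptensor K H H (ad_left p a) (ad_right q b)))"

lemma linear_twisted_ad:
  assumes "linear_map K P H f" "t \<in> carrier HH" "module K P"
  shows "linear_map K P HH (\<lambda>x. twisted_ad (f x) t)"
  unfolding twisted_ad_def using assms by - (rule lin_ad | assumption | simp)+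

lemma linear_twisted_ad_arg:
  assumes "linear_map K P HH f" "h \<in> carrier H" "module K P"
  shows "linear_map K P HH (\<lambda>x. twisted_ad h (f x))"
  unfolding twisted_ad_def using assms by - (rule lin_ad | assumption | simp)+

lemma twisted_ad_closed [simp]: "h \<in> carrier H \<Longrightarrow> t \<in> carrier HH \<Longrightarrow> twisted_ad h t \<in> carrier HH"
  unfolding twisted_ad_def by (rule lin_ad | assumption | simp)+

lemmas lin_twisted = lin_ad linear_twisted_ad linear_twisted_ad_arg twisted_ad_closed

lemma tensor_sum_cong:
  assumes "t \<in> carrier HH" "\<And>a b. a \<in> carrier H \<Longrightarrow> b \<in> carrier H \<Longrightarrow> f a b = g a b"
  shows "tsum U t f = tsum U t g"
  using assms by (intro tsum_cong[OF module_C module_C])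

lemma twisted_ad_sum:
  assumes h: "h \<in> carrier H" and t: "t \<in> carrier HH" and U: "module K U"
    and F1: "\<And>y. y \<in> carrier H \<Longrightarrow> linear_map K H U (\<lambda>x. F x y)"
    and F2: "\<And>x. x \<in> carrier H \<Longrightarrow> linear_map K H U (\<lambda>y. F x y)"
  shows "tsum U (twisted_ad h t) F =
    hsum U h (\<lambda>p q. tsum U t (\<lambda>a b. F (ad_left p a) (ad_right q b)))"
proof -
  note F = linear_map_comp[OF _ F1] linear_map_comp[OF _ F2]
  have "tsum U (twisted_ad h t) F = hsum U h
      (\<lambda>p q. tsum U (tsum HH t (\<lambda>a b. ptensor K H H (ad_left p a) (ad_right q b))) F)"
    unfolding twisted_ad_def using h t U
    by - (rule tsum_tsum, (rule lin_ad F1 F2 | assumption | simp)+)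
  also have "\<dots> = hsum U h
      (\<lambda>p q. tsum U t (\<lambda>a b. tsum U (ptensor K H H (ad_left p a) (ad_right q b)) F))"
    using h t U
    by (intro comult_sum_cong) (assumption, rule tsum_tsum, (rule lin_ad F1 F2 | assumption | simp)+)
  also have "\<dots> = hsum U h (\<lambda>p q. tsum U t (\<lambda>a b. F (ad_left p a) (ad_right q b)))"
    using h t U by (intro comult_sum_cong tensor_sum_cong tsum_ptensor_eq F1 F2) simp_all
  finally show ?thesis .
qed

lemma twisted_ad_one:
  assumes t: "t \<in> carrier HH"
  shows "twisted_ad \<one>\<^bsub>H\<^esub> t = t"
proof -
  have "twisted_ad \<one>\<^bsub>H\<^esub> t = tsum HH t (\<lambda>a b. ptensor K H H (ad_left \<one>\<^bsub>H\<^esub> a) (ad_right \<one>\<^bsub>H\<^esub> b))"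
    unfolding twisted_ad_def using t
    by - (rule comult_one_sum[where f = "\<lambda>p q. tsum HH t (\<lambda>a b. ptensor K H H (ad_left p a) (ad_right q b))"],
      (rule lin_ad | assumption | simp)+)
  also have "\<dots> = tsum HH t (ptensor K H H)"
    using t by (intro tensor_sum_cong) (simp_all add: one_ad_left one_ad_right)
  also have "\<dots> = t" using t by (simp add: tsum_ptensor_id)
  finally show ?thesis .
qed

lemma tensor_sum_swap:
  assumes "t \<in> carrier HH" "s \<in> carrier HH" "module K U"
    "\<And>v w x y. v \<in> carrier H \<Longrightarrow> w \<in> carrier H \<Longrightarrow> x \<in> carrier H \<Longrightarrow> y \<in> carrier H \<Longrightarrow>
      f v w x y \<in> carrier U"
  shows "tsum U t (\<lambda>v w. tsum U s (\<lambda>x y. f v w x y)) = tsum U s (\<lambda>x y. tsum U t (\<lambda>v w. f v w x y))"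
  using assms by (intro tsum_swap[OF module_C module_C _ module_C module_C]) auto

lemma twisted_ad_hmult:
  assumes h: "h \<in> carrier H" and g: "g \<in> carrier H" and t: "t \<in> carrier HH"
  shows "twisted_ad (h \<cdot> g) t = twisted_ad g (twisted_ad h t)"
proof -
  have "twisted_ad (h \<cdot> g) t = hsum HH h (\<lambda>p q. hsum HH g (\<lambda>s r.
      tsum HH t (\<lambda>a b. ptensor K H H (ad_left (p \<cdot> s) a) (ad_right (q \<cdot> r) b))))"
    unfolding twisted_ad_def using assms
    by - (rule comult_hmult_sum[where f = "\<lambda>p q. tsum HH t (\<lambda>a b. ptensor K H H (ad_left p a) (ad_right q b))"],
        (rule lin_ad | assumption | simp)+)
  also have "\<dots> = hsum HH g (\<lambda>s r. hsum HH h (\<lambda>p q.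
      tsum HH t (\<lambda>a b. ptensor K H H (ad_left (p \<cdot> s) a) (ad_right (q \<cdot> r) b))))"
    using assms by - (rule comult_sum_swap, (rule lin_ad | assumption | simp)+)
  also have "\<dots> = hsum HH g (\<lambda>s r. hsum HH h (\<lambda>p q.
      tsum HH t (\<lambda>a b. ptensor K H H (ad_left s (ad_left p a)) (ad_right r (ad_right q b)))))"
    using assms by (intro comult_sum_cong tensor_sum_cong) (simp_all add: ad_left_hmult ad_right_hmult)
  also have "\<dots> = hsum HH g (\<lambda>s r. tsum HH (twisted_ad h t)
       (\<lambda>a b. ptensor K H H (ad_left s a) (ad_right r b)))"
  proof (intro comult_sum_cong g)
    fix s r assume "s \<in> carrier H" "r \<in> carrier H"
    then show "hsum HH h (\<lambda>p q.
        tsum HH t (\<lambda>a b. ptensor K H H (ad_left s (ad_left p a)) (ad_right r (ad_right q b)))) =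
      tsum HH (twisted_ad h t) (\<lambda>a b. ptensor K H H (ad_left s a) (ad_right r b))"
      using assms by - (rule twisted_ad_sum[symmetric,
            where F = "\<lambda>a b. ptensor K H H (ad_left s a) (ad_right r b)"], (rule lin_ad | assumption | simp)+)
  qed
  finally show ?thesis unfolding twisted_ad_def[of g] .
qed

lemma twisted_ad_expand:
  assumes h: "h \<in> carrier H" and t: "t \<in> carrier HH"
  shows "hsum HH h (\<lambda>h1 r. hsum HH r (\<lambda>h2 s. hsum HH s (\<lambda>h3 h4.
      tsum HH t (\<lambda>a b. ptensor K H H (S h1 \<cdot> a \<cdot> h2) (S' h4 \<cdot> b \<cdot> h3))))) = twisted_ad h t"
proof -
  have "twisted_ad h t = hsum HH h (\<lambda>p q. tsum HH t (\<lambda>a b.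
      hsum HH p (\<lambda>h1 h2. ptensor K H H (S h1 \<cdot> a \<cdot> h2) (ad_right q b))))"
    unfolding twisted_ad_def ad_left_def using assms
    by (intro comult_sum_cong tensor_sum_cong linear_sum_comult[where f = "\<lambda>z. ptensor K H H z _"],
         simp_all) (rule lin_ad | assumption | simp)+
  also have "\<dots> = hsum HH h (\<lambda>p q. hsum HH p (\<lambda>h1 h2. tsum HH t (\<lambda>a b.
       ptensor K H H (S h1 \<cdot> a \<cdot> h2) (ad_right q b))))"
    using assms by (intro comult_sum_cong tensor_sum_swap) (simp_all add: ptensor_closed)
  also have "\<dots> = hsum HH h (\<lambda>h1 r. hsum HH r (\<lambda>h2 s. tsum HH t (\<lambda>a b.
       ptensor K H H (S h1 \<cdot> a \<cdot> h2) (ad_right s b))))"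
    using assms by - (rule coassoc_sum, (rule lin_ad | assumption | simp)+)
  also have "\<dots> = hsum HH h (\<lambda>h1 r. hsum HH r (\<lambda>h2 s. tsum HH t (\<lambda>a b.
       hsum HH s (\<lambda>h3 h4. ptensor K H H (S h1 \<cdot> a \<cdot> h2) (S' h4 \<cdot> b \<cdot> h3)))))"
    unfolding ad_right_def using assms
    by (intro comult_sum_cong tensor_sum_cong linear_sum_comult[where f = "\<lambda>z. ptensor K H H _ z"],
         simp_all) (rule lin_ad | assumption | simp)+
  also have "\<dots> = hsum HH h (\<lambda>h1 r. hsum HH r (\<lambda>h2 s.
      hsum HH s (\<lambda>h3 h4. tsum HH t (\<lambda>a b. ptensor K H H (S h1 \<cdot> a \<cdot> h2) (S' h4 \<cdot> b \<cdot> h3)))))"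
    using assms by (intro comult_sum_cong tensor_sum_swap) (simp_all add: ptensor_closed)
  finally show ?thesis by simp
qed

section \<open>Conjugating the two sides of the cocycle identity\<close>

lemma sum_ad_left_absorb:
  assumes "h \<in> carrier H" "x \<in> carrier H" "module K U" "linear_map K H U f"
  shows "hsum U h (\<lambda>p r. f (p \<cdot> ad_left r x)) = f (x \<cdot> h)"
  using linear_sum_comult[OF assms(1,3,4), of "\<lambda>p r. p \<cdot> ad_left r x"] assms by (simp add: ad_left_absorb)

lemma sum_ad_right_absorb:
  assumes "h \<in> carrier H" "b \<in> carrier H" "module K U" "linear_map K H U f"
  shows "hsum U h (\<lambda>r t. f (t \<cdot> ad_right r b)) = f (b \<cdot> h)"
  using linear_sum_comult[OF assms(1,3,4), of "\<lambda>r t. t \<cdot> ad_right r b"] assms by (simp add: ad_right_absorb)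

lemma ad_left_expand:
  assumes "h \<in> carrier H" "x \<in> carrier H" "module K U" "linear_map K H U f"
  shows "f (ad_left h x) = hsum U h (\<lambda>p q. f (S p \<cdot> x \<cdot> q))"
  unfolding ad_left_def using assms by (intro linear_sum_comult) simp_all

lemma ad_right_expand:
  assumes "h \<in> carrier H" "x \<in> carrier H" "module K U" "linear_map K H U f"
  shows "f (ad_right h x) = hsum U h (\<lambda>p q. f (S' q \<cdot> x \<cdot> p))"
  unfolding ad_right_def using assms by (intro linear_sum_comult) simp_all

lemma twisted_ad_pure_sum:
  assumes g: "g \<in> carrier H" and cd: "c \<in> carrier H" "d \<in> carrier H" and U: "module K U"
    and G1: "\<And>y. y \<in> carrier H \<Longrightarrow> linear_map K H U (\<lambda>x. G x y)"
    and G2: "\<And>x. x \<in> carrier H \<Longrightarrow> linear_map K H U (\<lambda>y. G x y)"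
  shows "tsum U (twisted_ad g (ptensor K H H c d)) G =
    hsum U g (\<lambda>p q. G (ad_left p c) (ad_right q d))"
proof -
  note G = linear_map_comp[OF _ G1] linear_map_comp[OF _ G2]
  have "tsum U (twisted_ad g (ptensor K H H c d)) G =
    hsum U g (\<lambda>p q. tsum U (ptensor K H H c d) (\<lambda>a b. G (ad_left p a) (ad_right q b)))"
    using g cd by (intro twisted_ad_sum U G1 G2) (simp_all add: ptensor_closed)
  also have "\<dots> = hsum U g (\<lambda>p q. G (ad_left p c) (ad_right q d))"
    using g cd U by - (rule comult_sum_cong, assumption, rule tsum_ptensor_eq,
      (rule G lin_twisted | assumption | simp)+)
  finally show ?thesis .
qed

text \<open>
  Both sides are linear in \<open>t\<close> and \<open>u\<close>, so that it suffices to compare them on pure tensors. The variable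
  \<open>h2\<close> is the factor that the twisted cocycle identity puts on the middle leg.
\<close>
lemma twisted_ad_pair_sum:
  assumes h: "h \<in> carrier H" and t: "t \<in> carrier HH" and u: "u \<in> carrier HH" and U: "module K U"
    and W1: "\<And>b e x y. b \<in> carrier H \<Longrightarrow> e \<in> carrier H \<Longrightarrow> x \<in> carrier H \<Longrightarrow> y \<in> carrier H \<Longrightarrow>
      linear_map K H U (\<lambda>a. W a b e x y)"
    and W2: "\<And>a e x y. a \<in> carrier H \<Longrightarrow> e \<in> carrier H \<Longrightarrow> x \<in> carrier H \<Longrightarrow> y \<in> carrier H \<Longrightarrow>
      linear_map K H U (\<lambda>b. W a b e x y)"
    and W3: "\<And>a b x y. a \<in> carrier H \<Longrightarrow> b \<in> carrier H \<Longrightarrow> x \<in> carrier H \<Longrightarrow> y \<in> carrier H \<Longrightarrow>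
      linear_map K H U (\<lambda>e. W a b e x y)"
    and W4: "\<And>a b e y. a \<in> carrier H \<Longrightarrow> b \<in> carrier H \<Longrightarrow> e \<in> carrier H \<Longrightarrow> y \<in> carrier H \<Longrightarrow>
      linear_map K H U (\<lambda>x. W a b e x y)"
    and W5: "\<And>a b e x. a \<in> carrier H \<Longrightarrow> b \<in> carrier H \<Longrightarrow> e \<in> carrier H \<Longrightarrow> x \<in> carrier H \<Longrightarrow>
      linear_map K H U (\<lambda>y. W a b e x y)"
  shows "hsum U h (\<lambda>h1 s. hsum U s (\<lambda>h2 h3.
      tsum U (twisted_ad h1 t) (\<lambda>a b. tsum U (twisted_ad h3 u) (\<lambda>x y. W a b h2 x y)))) =
    tsum U t (\<lambda>a b. tsum U u (\<lambda>x y. hsum U h (\<lambda>h1 s. hsum U s (\<lambda>h2 h3.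
      hsum U h1 (\<lambda>p q. hsum U h3 (\<lambda>m n.
        W (ad_left p a) (ad_right q b) h2 (ad_left m x) (ad_right n y)))))))" (is "?l t u = ?r t u")
proof -
  note rules = linear_map_comp[OF _ W1] linear_map_comp[OF _ W2] linear_map_comp[OF _ W3]
    linear_map_comp[OF _ W4] linear_map_comp[OF _ W5] linear_map_closed[OF W1] U lin_twisted
    ad_left_closed ad_right_closed
  have lin1: "linear_map K HH U (\<lambda>t. ?l t u)" "linear_map K HH U (\<lambda>t. ?r t u)" if "u \<in> carrier HH" for u
    using h that by - (rule rules | assumption)+
  have lin2: "linear_map K HH U (\<lambda>u. ?l t u)" "linear_map K HH U (\<lambda>u. ?r t u)" if "t \<in> carrier HH" for t
    using h that by - (rule rules | assumption)+
  have pure: "?l (ptensor K H H a b) (ptensor K H H x y) = ?r (ptensor K H H a b) (ptensor K H H x y)"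
    if ab: "a \<in> carrier H" "b \<in> carrier H" and xy: "x \<in> carrier H" "y \<in> carrier H" for a b x y
  proof -
    let ?W = "\<lambda>a b x y. hsum U h (\<lambda>h1 s. hsum U s (\<lambda>h2 h3.
      hsum U h1 (\<lambda>p q. hsum U h3 (\<lambda>m n.
        W (ad_left p a) (ad_right q b) h2 (ad_left m x) (ad_right n y)))))"
    have "?l (ptensor K H H a b) (ptensor K H H x y) =
      hsum U h (\<lambda>h1 s. hsum U s (\<lambda>h2 h3.
      tsum U (twisted_ad h1 (ptensor K H H a b)) (\<lambda>a b. hsum U h3 (\<lambda>m n.
        W a b h2 (ad_left m x) (ad_right n y)))))"
      using ab xy by (intro comult_sum_cong tensor_sum_cong h twisted_ad_pure_sum U W4 W5)
        (simp_all add: ptensor_closed)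
    also have "\<dots> = ?W a b x y"
    proof (intro comult_sum_cong h)
      fix h1 s h2 h3 assume "h1 \<in> carrier H" "h2 \<in> carrier H" "h3 \<in> carrier H"
      then show "tsum U (twisted_ad h1 (ptensor K H H a b)) (\<lambda>a b. hsum U h3 (\<lambda>m n.
          W a b h2 (ad_left m x) (ad_right n y))) =
        hsum U h1 (\<lambda>p q. hsum U h3 (\<lambda>m n.
          W (ad_left p a) (ad_right q b) h2 (ad_left m x) (ad_right n y)))"
        using ab xy by - (rule twisted_ad_pure_sum[where G = "\<lambda>a b. hsum U h3 (\<lambda>m n.
          W a b h2 (ad_left m x) (ad_right n y))"], (rule rules | assumption)+)
    qed
    also have "\<dots> = tsum U (ptensor K H H x y) (\<lambda>x y. ?W a b x y)"
      using h ab xy by - (rule tsum_ptensor_eq[symmetric, where F = "\<lambda>x y. ?W a b x y"],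
        (rule rules | assumption)+)
    also have "\<dots> = ?r (ptensor K H H a b) (ptensor K H H x y)"
      using h ab xy by - (rule tsum_ptensor_eq[symmetric,
          where F = "\<lambda>a b. tsum U (ptensor K H H x y) (\<lambda>x y. ?W a b x y)"], (rule rules | assumption)+)
    finally show ?thesis .
  qed
  have "?l t (ptensor K H H x y) = ?r t (ptensor K H H x y)" if xy: "x \<in> carrier H" "y \<in> carrier H" for x y
    by (rule tensor_linear_map_eqI[where f = "\<lambda>t. ?l t (ptensor K H H x y)" and g = "\<lambda>t. ?r t (ptensor K H H x y)"])
      (rule lin1 ptensor_closed pure t module_C U xy | assumption)+
  then show ?thesis
    by (intro tensor_linear_map_eqI[where f = "\<lambda>u. ?l t u" and g = "\<lambda>u. ?r t u"])
      (rule lin2 t u module_C U | assumption)+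
qed

text \<open>
  The map \<open>u \<otimes> w \<otimes> z \<mapsto> S(h1) u h2 \<otimes> w h3 \<otimes> R(h4, z)\<close>, followed by the linear extension of \<open>F\<close>. Both
  sides of the twisted cocycle identity at \<open>c \<otimes> h\<close> are images of the sides at \<open>c \<otimes> 1\<close> under this map.
\<close>
definition twisted_conj ::
    "('k, 'u, 's) module_scheme \<Rightarrow> ('h \<Rightarrow> 'h \<Rightarrow> 'h \<Rightarrow> 'u) \<Rightarrow> 'h \<Rightarrow> 'h \<Rightarrow> 'h \<Rightarrow> 'h \<Rightarrow> 'u" where
  "twisted_conj U F h u w z =
    hsum U h (\<lambda>p s. hsum U s (\<lambda>r n. hsum U r (\<lambda>r1 r2.
      F (S p \<cdot> u \<cdot> r1) (w \<cdot> r2) (ad_right n z))))"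

context
  fixes U :: "('k, 'u, 's) module_scheme" and F :: "'h \<Rightarrow> 'h \<Rightarrow> 'h \<Rightarrow> 'u"
  assumes U: "module K U"
    and F1: "\<And>y z. y \<in> carrier H \<Longrightarrow> z \<in> carrier H \<Longrightarrow> linear_map K H U (\<lambda>x. F x y z)"
    and F2: "\<And>x z. x \<in> carrier H \<Longrightarrow> z \<in> carrier H \<Longrightarrow> linear_map K H U (\<lambda>y. F x y z)"
    and F3: "\<And>x y. x \<in> carrier H \<Longrightarrow> y \<in> carrier H \<Longrightarrow> linear_map K H U (\<lambda>z. F x y z)"
begin

lemmas F = linear_map_comp[OF _ F1] linear_map_comp[OF _ F2] linear_map_comp[OF _ F3]

lemmas lin_F = U F lin_twisted linear_map_closed[OF F1]

lemma twisted_conj_one: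
  assumes "u \<in> carrier H" "w \<in> carrier H" "z \<in> carrier H"
  shows "twisted_conj U F \<one>\<^bsub>H\<^esub> u w z = F u w z"
proof -
  have "twisted_conj U F \<one>\<^bsub>H\<^esub> u w z = hsum U \<one>\<^bsub>H\<^esub> (\<lambda>r n. hsum U r (\<lambda>r1 r2.
      F (S \<one>\<^bsub>H\<^esub> \<cdot> u \<cdot> r1) (w \<cdot> r2) (ad_right n z)))"
    unfolding twisted_conj_def using assms
    by - (rule comult_one_sum[where f = "\<lambda>p s. hsum U s (\<lambda>r n. hsum U r (\<lambda>r1 r2.
      F (S p \<cdot> u \<cdot> r1) (w \<cdot> r2) (ad_right n z)))"], (rule lin_F | assumption | simp)+)
  also have "\<dots> = hsum U \<one>\<^bsub>H\<^esub> (\<lambda>r1 r2. F (S \<one>\<^bsub>H\<^esub> \<cdot> u \<cdot> r1) (w \<cdot> r2) (ad_right \<one>\<^bsub>H\<^esub> z))"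
    using assms by - (rule comult_one_sum[where f = "\<lambda>r n. hsum U r (\<lambda>r1 r2.
      F (S \<one>\<^bsub>H\<^esub> \<cdot> u \<cdot> r1) (w \<cdot> r2) (ad_right n z))"], (rule lin_F | assumption | simp)+)
  also have "\<dots> = F (S \<one>\<^bsub>H\<^esub> \<cdot> u \<cdot> \<one>\<^bsub>H\<^esub>) (w \<cdot> \<one>\<^bsub>H\<^esub>) (ad_right \<one>\<^bsub>H\<^esub> z)"
    using assms by - (rule comult_one_sum[where f = "\<lambda>r1 r2. F (S \<one>\<^bsub>H\<^esub> \<cdot> u \<cdot> r1) (w \<cdot> r2) (ad_right \<one>\<^bsub>H\<^esub> z)"],
       (rule lin_F | assumption | simp)+)
  finally show ?thesis using assms by (simp add: antipode_one one_ad_right)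
qed

text \<open>
  With \<open>p, q\<close> from \<open>h1\<close> and \<open>m, n\<close> from \<open>h3\<close>, the factor \<open>h2\<close> first meets \<open>R(q, b)\<close>, and absorbing it leaves
  \<open>b k\<close>. Expanding \<open>L(p, a) = S(p1) a p2\<close>, the remaining factors \<open>p2\<close> and \<open>k\<close> multiply the two legs of the
  coproduct of \<open>L(m, x)\<close> from the left. Since they come from one comultiplication, this is the coproduct
  of a product \<open>e L(m, x)\<close>, in which \<open>e\<close> is absorbed as well and leaves \<open>x w\<close>.
\<close>
lemma twisted_conj_left_pure:
  assumes h: "h \<in> carrier H"
    and ab: "a \<in> carrier H" "b \<in> carrier H" and xy: "x \<in> carrier H" "y \<in> carrier H"
  shows "hsum U h (\<lambda>h1 s. hsum U s (\<lambda>h2 h3.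
      hsum U h1 (\<lambda>p q. hsum U h3 (\<lambda>m n.
        hsum U (ad_left m x) (\<lambda>x1 x2. F (ad_left p a \<cdot> x1) (h2 \<cdot> (ad_right q b \<cdot> x2)) (ad_right n y)))))) =
    hsum U x (\<lambda>x1 x2. twisted_conj U F h (a \<cdot> x1) (b \<cdot> x2) y)" (is "?lhs = ?rhs")
proof -
  note ax = h ab xy
  have "?lhs = hsum U h (\<lambda>p s. hsum U s (\<lambda>k h3. hsum U k (\<lambda>q h2.
      hsum U h3 (\<lambda>m n. hsum U (ad_left m x) (\<lambda>x1 x2.
        F (ad_left p a \<cdot> x1) (h2 \<cdot> (ad_right q b \<cdot> x2)) (ad_right n y))))))"
    using ax by - (rule coassoc_sum_balanced_to_middle[where F = "\<lambda>p q h2 h3.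
      hsum U h3 (\<lambda>m n. hsum U (ad_left m x) (\<lambda>x1 x2.
        F (ad_left p a \<cdot> x1) (h2 \<cdot> (ad_right q b \<cdot> x2)) (ad_right n y)))"], (rule lin_F | assumption | simp)+)
  also have "\<dots> = hsum U h (\<lambda>p s. hsum U s (\<lambda>k h3.
      hsum U h3 (\<lambda>m n. hsum U (ad_left m x) (\<lambda>x1 x2.
        F (ad_left p a \<cdot> x1) ((b \<cdot> k) \<cdot> x2) (ad_right n y)))))"
  proof (intro comult_sum_cong h)
    fix p s k h3 assume c: "p \<in> carrier H" "s \<in> carrier H" "k \<in> carrier H" "h3 \<in> carrier H"
    have "hsum U k (\<lambda>q h2. hsum U h3 (\<lambda>m n. hsum U (ad_left m x) (\<lambda>x1 x2.
        F (ad_left p a \<cdot> x1) (h2 \<cdot> (ad_right q b \<cdot> x2)) (ad_right n y)))) =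
      hsum U k (\<lambda>q h2. hsum U h3 (\<lambda>m n. hsum U (ad_left m x) (\<lambda>x1 x2.
        F (ad_left p a \<cdot> x1) ((h2 \<cdot> ad_right q b) \<cdot> x2) (ad_right n y))))"
      using c ax by (intro comult_sum_cong) (simp_all add: hmult_assoc)
    also have "\<dots> = hsum U h3 (\<lambda>m n. hsum U (ad_left m x) (\<lambda>x1 x2.
        F (ad_left p a \<cdot> x1) ((b \<cdot> k) \<cdot> x2) (ad_right n y)))"
      using c ax by - (rule sum_ad_right_absorb[where f = "\<lambda>z. hsum U h3 (\<lambda>m n.
        hsum U (ad_left m x) (\<lambda>x1 x2. F (ad_left p a \<cdot> x1) (z \<cdot> x2) (ad_right n y)))"],
        (rule lin_F | assumption | simp)+)
    finally show "hsum U k (\<lambda>q h2. hsum U h3 (\<lambda>m n. hsum U (ad_left m x) (\<lambda>x1 x2.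
        F (ad_left p a \<cdot> x1) (h2 \<cdot> (ad_right q b \<cdot> x2)) (ad_right n y)))) = \<dots>" .
  qed
  also have "\<dots> = hsum U h (\<lambda>p s. hsum U p (\<lambda>p1 p2. hsum U s (\<lambda>k h3.
      hsum U h3 (\<lambda>m n. hsum U (ad_left m x) (\<lambda>x1 x2.
        F ((S p1 \<cdot> a \<cdot> p2) \<cdot> x1) ((b \<cdot> k) \<cdot> x2) (ad_right n y))))))"
  proof (rule comult_sum_cong[OF h])
    fix p s assume "p \<in> carrier H" "s \<in> carrier H"
    then show "hsum U s (\<lambda>k h3.
      hsum U h3 (\<lambda>m n. hsum U (ad_left m x) (\<lambda>x1 x2.
        F (ad_left p a \<cdot> x1) ((b \<cdot> k) \<cdot> x2) (ad_right n y)))) =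
      hsum U p (\<lambda>p1 p2. hsum U s (\<lambda>k h3.
      hsum U h3 (\<lambda>m n. hsum U (ad_left m x) (\<lambda>x1 x2.
        F ((S p1 \<cdot> a \<cdot> p2) \<cdot> x1) ((b \<cdot> k) \<cdot> x2) (ad_right n y)))))"
      using ax by - (rule ad_left_expand[where f = "\<lambda>z. hsum U s (\<lambda>k h3.
        hsum U h3 (\<lambda>m n. hsum U (ad_left m x) (\<lambda>x1 x2.
        F (z \<cdot> x1) ((b \<cdot> k) \<cdot> x2) (ad_right n y))))"], (rule lin_F | assumption | simp)+)
  qed
  also have "\<dots> = hsum U h (\<lambda>p1 s. hsum U s (\<lambda>p2 r. hsum U r (\<lambda>k h3.
      hsum U h3 (\<lambda>m n. hsum U (ad_left m x) (\<lambda>x1 x2.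
        F ((S p1 \<cdot> a \<cdot> p2) \<cdot> x1) ((b \<cdot> k) \<cdot> x2) (ad_right n y))))))"
    using ax by - (rule coassoc_sum, (rule lin_F | assumption | simp)+)
  also have "\<dots> = hsum U h (\<lambda>p1 s. hsum U s (\<lambda>w n. hsum U w (\<lambda>e m.
      hsum U e (\<lambda>p2 k. hsum U (ad_left m x) (\<lambda>x1 x2.
        F ((S p1 \<cdot> a \<cdot> p2) \<cdot> x1) ((b \<cdot> k) \<cdot> x2) (ad_right n y))))))"
    using ax by - (rule comult_sum_cong[OF h], rule coassoc_sum_right_to_left,
      (rule lin_F | assumption | simp)+)
  also have "\<dots> = hsum U h (\<lambda>p1 s. hsum U s (\<lambda>w n. hsum U w (\<lambda>e m.
      hsum U e (\<lambda>p2 k. hsum U (ad_left m x) (\<lambda>x1 x2.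
        F (S p1 \<cdot> a \<cdot> (p2 \<cdot> x1)) (b \<cdot> (k \<cdot> x2)) (ad_right n y))))))"
    using ax by (intro comult_sum_cong) (simp_all add: hmult_assoc)
  also have "\<dots> = hsum U h (\<lambda>p1 s. hsum U s (\<lambda>w n. hsum U w (\<lambda>e m.
      hsum U (e \<cdot> ad_left m x) (\<lambda>z1 z2. F (S p1 \<cdot> a \<cdot> z1) (b \<cdot> z2) (ad_right n y)))))"
  proof (intro comult_sum_cong h)
    fix p1 s w n e m assume "p1 \<in> carrier H" "n \<in> carrier H" "e \<in> carrier H" "m \<in> carrier H"
    then show "hsum U e (\<lambda>p2 k. hsum U (ad_left m x) (\<lambda>x1 x2.
        F (S p1 \<cdot> a \<cdot> (p2 \<cdot> x1)) (b \<cdot> (k \<cdot> x2)) (ad_right n y))) =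
      hsum U (e \<cdot> ad_left m x) (\<lambda>z1 z2. F (S p1 \<cdot> a \<cdot> z1) (b \<cdot> z2) (ad_right n y))"
      using ax by - (rule comult_hmult_sum[symmetric, where f = "\<lambda>z1 z2. F (S p1 \<cdot> a \<cdot> z1) (b \<cdot> z2) (ad_right n y)"],
        (rule lin_F | assumption | simp)+)
  qed
  also have "\<dots> = hsum U h (\<lambda>p1 s. hsum U s (\<lambda>w n.
      hsum U (x \<cdot> w) (\<lambda>z1 z2. F (S p1 \<cdot> a \<cdot> z1) (b \<cdot> z2) (ad_right n y))))"
  proof (intro comult_sum_cong h)
    fix p1 s w n assume "p1 \<in> carrier H" "n \<in> carrier H" "w \<in> carrier H"
    then show "hsum U w (\<lambda>e m.
      hsum U (e \<cdot> ad_left m x) (\<lambda>z1 z2. F (S p1 \<cdot> a \<cdot> z1) (b \<cdot> z2) (ad_right n y))) =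
      hsum U (x \<cdot> w) (\<lambda>z1 z2. F (S p1 \<cdot> a \<cdot> z1) (b \<cdot> z2) (ad_right n y))"
      using ax by - (rule sum_ad_left_absorb[where f = "\<lambda>z. hsum U z (\<lambda>z1 z2. F (S p1 \<cdot> a \<cdot> z1) (b \<cdot> z2) (ad_right n y))"],
        (rule lin_F | assumption | simp)+)
  qed
  also have "\<dots> = hsum U h (\<lambda>p1 s. hsum U s (\<lambda>w n.
      hsum U x (\<lambda>x1 x2. hsum U w (\<lambda>w1 w2. F (S p1 \<cdot> a \<cdot> (x1 \<cdot> w1)) (b \<cdot> (x2 \<cdot> w2)) (ad_right n y)))))"
  proof (intro comult_sum_cong h)
    fix p1 s w n assume "p1 \<in> carrier H" "n \<in> carrier H" "w \<in> carrier H"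
    then show "hsum U (x \<cdot> w) (\<lambda>z1 z2. F (S p1 \<cdot> a \<cdot> z1) (b \<cdot> z2) (ad_right n y)) =
      hsum U x (\<lambda>x1 x2. hsum U w (\<lambda>w1 w2. F (S p1 \<cdot> a \<cdot> (x1 \<cdot> w1)) (b \<cdot> (x2 \<cdot> w2)) (ad_right n y)))"
      using ax by - (rule comult_hmult_sum[where f = "\<lambda>z1 z2. F (S p1 \<cdot> a \<cdot> z1) (b \<cdot> z2) (ad_right n y)"],
        (rule lin_F | assumption | simp)+)
  qed
  also have "\<dots> = hsum U h (\<lambda>p1 s. hsum U s (\<lambda>w n.
      hsum U x (\<lambda>x1 x2. hsum U w (\<lambda>w1 w2. F (S p1 \<cdot> (a \<cdot> x1) \<cdot> w1) ((b \<cdot> x2) \<cdot> w2) (ad_right n y)))))"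
    using ax by (intro comult_sum_cong) (simp_all add: hmult_assoc)
  also have "\<dots> = hsum U h (\<lambda>p1 s. hsum U x (\<lambda>x1 x2. hsum U s (\<lambda>w n.
       hsum U w (\<lambda>w1 w2. F (S p1 \<cdot> (a \<cdot> x1) \<cdot> w1) ((b \<cdot> x2) \<cdot> w2) (ad_right n y)))))"
    using ax by - (rule comult_sum_cong[OF h], rule comult_sum_swap, (rule lin_F | assumption | simp)+)
  also have "\<dots> = hsum U x (\<lambda>x1 x2. hsum U h (\<lambda>p1 s. hsum U s (\<lambda>w n.
       hsum U w (\<lambda>w1 w2. F (S p1 \<cdot> (a \<cdot> x1) \<cdot> w1) ((b \<cdot> x2) \<cdot> w2) (ad_right n y)))))"
    using ax by - (rule comult_sum_swap, (rule lin_F | assumption | simp)+)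
  finally show ?thesis unfolding twisted_conj_def .
qed

text \<open>
  The same map with the bracketing \<open>L(h1, u) \<otimes> w h2 \<otimes> S'(h4) z h3\<close>, in which the computation for the
  right-hand side ends.
\<close>
lemma twisted_conj_alt:
  assumes h: "h \<in> carrier H" and uwz: "u \<in> carrier H" "w \<in> carrier H" "z \<in> carrier H"
  shows "twisted_conj U F h u w z = hsum U h (\<lambda>p s. hsum U s (\<lambda>r n.
    hsum U r (\<lambda>r1 r2. F (ad_left p u) (w \<cdot> r1) (S' n \<cdot> z \<cdot> r2))))" (is "_ = ?rhs")
proof -
  note ax = h uwz
  have "?rhs = hsum U h (\<lambda>p s. hsum U p (\<lambda>p1 p2. hsum U s (\<lambda>r n.
    hsum U r (\<lambda>r1 r2. F (S p1 \<cdot> u \<cdot> p2) (w \<cdot> r1) (S' n \<cdot> z \<cdot> r2)))))"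
  proof (rule comult_sum_cong[OF h])
    fix p s assume "p \<in> carrier H" "s \<in> carrier H"
    then show "hsum U s (\<lambda>r n. hsum U r (\<lambda>r1 r2. F (ad_left p u) (w \<cdot> r1) (S' n \<cdot> z \<cdot> r2))) =
      hsum U p (\<lambda>p1 p2. hsum U s (\<lambda>r n.
        hsum U r (\<lambda>r1 r2. F (S p1 \<cdot> u \<cdot> p2) (w \<cdot> r1) (S' n \<cdot> z \<cdot> r2))))"
      using ax by - (rule ad_left_expand[where f = "\<lambda>v. hsum U s (\<lambda>r n.
        hsum U r (\<lambda>r1 r2. F v (w \<cdot> r1) (S' n \<cdot> z \<cdot> r2)))"], (rule lin_F | assumption | simp)+)
  qed
  also have "\<dots> = hsum U h (\<lambda>p1 s. hsum U s (\<lambda>p2 t. hsum U t (\<lambda>r n.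
    hsum U r (\<lambda>r1 r2. F (S p1 \<cdot> u \<cdot> p2) (w \<cdot> r1) (S' n \<cdot> z \<cdot> r2)))))"
    using ax by - (rule coassoc_sum, (rule lin_F | assumption | simp)+)
  also have "\<dots> = hsum U h (\<lambda>p1 s. hsum U s (\<lambda>u' v. hsum U v (\<lambda>r2 n.
    hsum U u' (\<lambda>p2 r1. F (S p1 \<cdot> u \<cdot> p2) (w \<cdot> r1) (S' n \<cdot> z \<cdot> r2)))))"
    using ax by - (rule comult_sum_cong[OF h], rule coassoc_sum_balanced_to_middle[symmetric],
      (rule lin_F | assumption | simp)+)
  also have "\<dots> = hsum U h (\<lambda>p1 s. hsum U s (\<lambda>u' v.
    hsum U u' (\<lambda>p2 r1. hsum U v (\<lambda>r2 n. F (S p1 \<cdot> u \<cdot> p2) (w \<cdot> r1) (S' n \<cdot> z \<cdot> r2)))))"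
    using ax by - (rule comult_sum_cong[OF h], rule comult_sum_cong, assumption, rule comult_sum_swap,
      (rule lin_F | assumption | simp)+)
  also have "\<dots> = twisted_conj U F h u w z"
    unfolding twisted_conj_def
  proof (intro comult_sum_cong h)
    fix p1 s u' v p2 r1 assume "p1 \<in> carrier H" "v \<in> carrier H" "p2 \<in> carrier H" "r1 \<in> carrier H"
    then show "hsum U v (\<lambda>r2 n. F (S p1 \<cdot> u \<cdot> p2) (w \<cdot> r1) (S' n \<cdot> z \<cdot> r2)) =
        F (S p1 \<cdot> u \<cdot> p2) (w \<cdot> r1) (ad_right v z)"
      using ax by - (rule ad_right_expand[symmetric, where f = "\<lambda>z. F (S p1 \<cdot> u \<cdot> p2) (w \<cdot> r1) z"],
        (rule lin_F | assumption | simp)+)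
  qed
  finally show ?thesis by (rule HOL.sym)
qed

text \<open>
  Here \<open>h2\<close> meets \<open>L(m, x)\<close> first and leaves \<open>x k\<close>. Expanding \<open>R(n, y) = S'(n2) y n1\<close>, the factors \<open>k\<close>
  and \<open>n1\<close> multiply the two legs of the coproduct of \<open>R(q, b)\<close> and are absorbed by it.
\<close>
lemma twisted_conj_right_pure:
  assumes h: "h \<in> carrier H"
    and ab: "a \<in> carrier H" "b \<in> carrier H" and xy: "x \<in> carrier H" "y \<in> carrier H"
  shows "hsum U h (\<lambda>h1 s. hsum U s (\<lambda>h2 h3.
      hsum U h1 (\<lambda>p q. hsum U h3 (\<lambda>m n.
        hsum U (ad_right q b) (\<lambda>b1 b2. F (ad_left p a) (h2 \<cdot> (ad_left m x \<cdot> b1)) (ad_right n y \<cdot> b2)))))) =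
    hsum U b (\<lambda>b1 b2. twisted_conj U F h a (x \<cdot> b1) (y \<cdot> b2))" (is "?lhs = ?rhs")
proof -
  note ax = h ab xy
  \<comment> \<open>The sums over \<open>h1\<close> take no part until \<open>k\<close> and \<open>n1\<close> are available; \<open>Q\<close> hides them.\<close>
  define Q where "Q h1 c z = hsum U h1 (\<lambda>p q. hsum U (ad_right q b)
    (\<lambda>b1 b2. F (ad_left p a) (c \<cdot> b1) (z \<cdot> b2)))" for h1 c z
  have Q1: "linear_map K H U (\<lambda>h1. Q h1 c z)" if "c \<in> carrier H" "z \<in> carrier H" for c z
    unfolding Q_def using ax that by - (rule lin_F | assumption | simp)+
  have Q2: "linear_map K H U (\<lambda>c. Q h1 c z)" if "h1 \<in> carrier H" "z \<in> carrier H" for h1 z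
    unfolding Q_def using ax that by - (rule lin_F | assumption | simp)+
  have Q3: "linear_map K H U (\<lambda>z. Q h1 c z)" if "h1 \<in> carrier H" "c \<in> carrier H" for h1 c
    unfolding Q_def using ax that by - (rule lin_F | assumption | simp)+
  note lin_Q = linear_map_comp[OF _ Q1] linear_map_comp[OF _ Q2] linear_map_comp[OF _ Q3] lin_F
  have "?lhs = hsum U h (\<lambda>h1 s. hsum U s (\<lambda>h2 h3. hsum U h3 (\<lambda>m n.
      Q h1 (h2 \<cdot> ad_left m x) (ad_right n y))))"
  proof (intro comult_sum_cong h)
    fix h1 s h2 h3 assume "h1 \<in> carrier H" "h2 \<in> carrier H" "h3 \<in> carrier H"
    then have "hsum U h1 (\<lambda>p q. hsum U h3 (\<lambda>m n.
        hsum U (ad_right q b) (\<lambda>b1 b2. F (ad_left p a) (h2 \<cdot> (ad_left m x \<cdot> b1)) (ad_right n y \<cdot> b2)))) =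
      hsum U h3 (\<lambda>m n. hsum U h1 (\<lambda>p q.
        hsum U (ad_right q b) (\<lambda>b1 b2. F (ad_left p a) (h2 \<cdot> (ad_left m x \<cdot> b1)) (ad_right n y \<cdot> b2))))"
      using ax by - (rule comult_sum_swap, (rule lin_F | assumption | simp)+)
    also have "\<dots> = hsum U h3 (\<lambda>m n. Q h1 (h2 \<cdot> ad_left m x) (ad_right n y))"
      unfolding Q_def using ax \<open>h1 \<in> _\<close> \<open>h2 \<in> _\<close> \<open>h3 \<in> _\<close>
      by (intro comult_sum_cong) (simp_all add: hmult_assoc)
    finally show "hsum U h1 (\<lambda>p q. hsum U h3 (\<lambda>m n.
        hsum U (ad_right q b) (\<lambda>b1 b2. F (ad_left p a) (h2 \<cdot> (ad_left m x \<cdot> b1)) (ad_right n y \<cdot> b2)))) =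
      hsum U h3 (\<lambda>m n. Q h1 (h2 \<cdot> ad_left m x) (ad_right n y))" .
  qed
  also have "\<dots> = hsum U h (\<lambda>h1 s. hsum U s (\<lambda>k n. hsum U k (\<lambda>h2 m.
      Q h1 (h2 \<cdot> ad_left m x) (ad_right n y))))"
    using ax by - (rule comult_sum_cong[OF h], rule coassoc_sum[symmetric], (rule lin_Q | assumption | simp)+)
  also have "\<dots> = hsum U h (\<lambda>h1 s. hsum U s (\<lambda>k n. Q h1 (x \<cdot> k) (ad_right n y)))"
  proof (intro comult_sum_cong h)
    fix h1 s k n assume "h1 \<in> carrier H" "k \<in> carrier H" "n \<in> carrier H"
    then show "hsum U k (\<lambda>h2 m. Q h1 (h2 \<cdot> ad_left m x) (ad_right n y)) = Q h1 (x \<cdot> k) (ad_right n y)"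
      using ax by - (rule sum_ad_left_absorb[where f = "\<lambda>c. Q h1 c (ad_right n y)"], (rule lin_Q | assumption | simp)+)
  qed
  also have "\<dots> = hsum U h (\<lambda>h1 s. hsum U s (\<lambda>k n.
      hsum U n (\<lambda>n1 n2. Q h1 (x \<cdot> k) (S' n2 \<cdot> y \<cdot> n1))))"
  proof (intro comult_sum_cong h)
    fix h1 s k n assume "h1 \<in> carrier H" "k \<in> carrier H" "n \<in> carrier H"
    then show "Q h1 (x \<cdot> k) (ad_right n y) = hsum U n (\<lambda>n1 n2. Q h1 (x \<cdot> k) (S' n2 \<cdot> y \<cdot> n1))"
      using ax by - (rule ad_right_expand[where f = "\<lambda>z. Q h1 (x \<cdot> k) z"], (rule lin_Q | assumption | simp)+)
  qed
  also have "\<dots> = hsum U h (\<lambda>h1 s. hsum U s (\<lambda>v n2.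
      hsum U v (\<lambda>k n1. Q h1 (x \<cdot> k) (S' n2 \<cdot> y \<cdot> n1))))"
    using ax by - (rule comult_sum_cong[OF h], rule coassoc_sum[symmetric], (rule lin_Q | assumption | simp)+)
  also have "\<dots> = hsum U h (\<lambda>h1 s. hsum U s (\<lambda>v n2. hsum U h1 (\<lambda>p q.
      hsum U v (\<lambda>k n1. hsum U (ad_right q b)
        (\<lambda>b1 b2. F (ad_left p a) (x \<cdot> k \<cdot> b1) (S' n2 \<cdot> y \<cdot> n1 \<cdot> b2))))))"
    unfolding Q_def
    using ax by - (rule comult_sum_cong[OF h], rule comult_sum_cong, assumption, rule comult_sum_swap,
      (rule lin_F | assumption | simp)+)
  also have "\<dots> = hsum U h (\<lambda>p s. hsum U s (\<lambda>w n2. hsum U w (\<lambda>q v.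
      hsum U v (\<lambda>k n1. hsum U (ad_right q b)
        (\<lambda>b1 b2. F (ad_left p a) (x \<cdot> k \<cdot> b1) (S' n2 \<cdot> y \<cdot> n1 \<cdot> b2))))))"
    using ax by - (rule coassoc_sum_balanced_to_middle, (rule lin_F | assumption | simp)+)
  also have "\<dots> = hsum U h (\<lambda>p s. hsum U s (\<lambda>w n2. hsum U w (\<lambda>q v.
      hsum U v (\<lambda>k n1. hsum U (ad_right q b)
        (\<lambda>b1 b2. F (ad_left p a) (x \<cdot> (k \<cdot> b1)) (S' n2 \<cdot> y \<cdot> (n1 \<cdot> b2)))))))"
    using ax by (intro comult_sum_cong) (simp_all add: hmult_assoc)
  also have "\<dots> = hsum U h (\<lambda>p s. hsum U s (\<lambda>w n2. hsum U w (\<lambda>q v.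
      hsum U (v \<cdot> ad_right q b) (\<lambda>z1 z2. F (ad_left p a) (x \<cdot> z1) (S' n2 \<cdot> y \<cdot> z2)))))"
  proof (intro comult_sum_cong h)
    fix p s w n2 q v assume "p \<in> carrier H" "n2 \<in> carrier H" "q \<in> carrier H" "v \<in> carrier H"
    then show "hsum U v (\<lambda>k n1. hsum U (ad_right q b)
        (\<lambda>b1 b2. F (ad_left p a) (x \<cdot> (k \<cdot> b1)) (S' n2 \<cdot> y \<cdot> (n1 \<cdot> b2)))) =
      hsum U (v \<cdot> ad_right q b) (\<lambda>z1 z2. F (ad_left p a) (x \<cdot> z1) (S' n2 \<cdot> y \<cdot> z2))"
      using ax by - (rule comult_hmult_sum[symmetric, where f = "\<lambda>z1 z2. F (ad_left p a) (x \<cdot> z1) (S' n2 \<cdot> y \<cdot> z2)"],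
        (rule lin_F | assumption | simp)+)
  qed
  also have "\<dots> = hsum U h (\<lambda>p s. hsum U s (\<lambda>w n2.
      hsum U (b \<cdot> w) (\<lambda>z1 z2. F (ad_left p a) (x \<cdot> z1) (S' n2 \<cdot> y \<cdot> z2))))"
  proof (intro comult_sum_cong h)
    fix p s w n2 assume "p \<in> carrier H" "n2 \<in> carrier H" "w \<in> carrier H"
    then show "hsum U w (\<lambda>q v.
        hsum U (v \<cdot> ad_right q b) (\<lambda>z1 z2. F (ad_left p a) (x \<cdot> z1) (S' n2 \<cdot> y \<cdot> z2))) =
      hsum U (b \<cdot> w) (\<lambda>z1 z2. F (ad_left p a) (x \<cdot> z1) (S' n2 \<cdot> y \<cdot> z2))"
      using ax by - (rule sum_ad_right_absorb[where f = "\<lambda>z. hsum U z (\<lambda>z1 z2. F (ad_left p a) (x \<cdot> z1) (S' n2 \<cdot> y \<cdot> z2))"],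
        (rule lin_F | assumption | simp)+)
  qed
  also have "\<dots> = hsum U h (\<lambda>p s. hsum U s (\<lambda>w n2. hsum U b (\<lambda>b1 b2.
      hsum U w (\<lambda>w1 w2. F (ad_left p a) (x \<cdot> (b1 \<cdot> w1)) (S' n2 \<cdot> y \<cdot> (b2 \<cdot> w2))))))"
  proof (intro comult_sum_cong h)
    fix p s w n2 assume "p \<in> carrier H" "n2 \<in> carrier H" "w \<in> carrier H"
    then show "hsum U (b \<cdot> w) (\<lambda>z1 z2. F (ad_left p a) (x \<cdot> z1) (S' n2 \<cdot> y \<cdot> z2)) =
      hsum U b (\<lambda>b1 b2.
      hsum U w (\<lambda>w1 w2. F (ad_left p a) (x \<cdot> (b1 \<cdot> w1)) (S' n2 \<cdot> y \<cdot> (b2 \<cdot> w2))))"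
      using ax by - (rule comult_hmult_sum[where f = "\<lambda>z1 z2. F (ad_left p a) (x \<cdot> z1) (S' n2 \<cdot> y \<cdot> z2)"],
        (rule lin_F | assumption | simp)+)
  qed
  also have "\<dots> = hsum U h (\<lambda>p s. hsum U s (\<lambda>w n2. hsum U b (\<lambda>b1 b2.
      hsum U w (\<lambda>w1 w2. F (ad_left p a) (x \<cdot> b1 \<cdot> w1) (S' n2 \<cdot> (y \<cdot> b2) \<cdot> w2)))))"
    using ax by (intro comult_sum_cong) (simp_all add: hmult_assoc)
  also have "\<dots> = hsum U h (\<lambda>p s. hsum U b (\<lambda>b1 b2. hsum U s (\<lambda>w n2.
      hsum U w (\<lambda>w1 w2. F (ad_left p a) (x \<cdot> b1 \<cdot> w1) (S' n2 \<cdot> (y \<cdot> b2) \<cdot> w2)))))"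
    using ax by - (rule comult_sum_cong[OF h], rule comult_sum_swap, (rule lin_F | assumption | simp)+)
  also have "\<dots> = hsum U b (\<lambda>b1 b2. hsum U h (\<lambda>p s. hsum U s (\<lambda>w n2.
      hsum U w (\<lambda>w1 w2. F (ad_left p a) (x \<cdot> b1 \<cdot> w1) (S' n2 \<cdot> (y \<cdot> b2) \<cdot> w2)))))"
    using ax by - (rule comult_sum_swap, (rule lin_F | assumption | simp)+)
  also have "\<dots> = ?rhs"
    using ax by (intro comult_sum_cong) (simp_all add: twisted_conj_alt)
  finally show ?thesis .
qed

lemma twisted_conj_left:
  assumes h: "h \<in> carrier H" and t: "t \<in> carrier HH" and u: "u \<in> carrier HH"
  shows "hsum U h (\<lambda>h1 s. hsum U s (\<lambda>h2 h3.
      tsum U (twisted_ad h1 t) (\<lambda>a b. tsum U (twisted_ad h3 u) (\<lambda>x y.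
        hsum U x (\<lambda>x1 x2. F (a \<cdot> x1) (h2 \<cdot> (b \<cdot> x2)) y))))) =
    tsum U t (\<lambda>a b. tsum U u (\<lambda>x y. hsum U x (\<lambda>x1 x2.
      twisted_conj U F h (a \<cdot> x1) (b \<cdot> x2) y)))" (is "?l = ?r")
proof -
  have "?l = tsum U t (\<lambda>a b. tsum U u (\<lambda>x y. hsum U h (\<lambda>h1 s. hsum U s (\<lambda>h2 h3.
      hsum U h1 (\<lambda>p q. hsum U h3 (\<lambda>m n. hsum U (ad_left m x) (\<lambda>x1 x2.
        F (ad_left p a \<cdot> x1) (h2 \<cdot> (ad_right q b \<cdot> x2)) (ad_right n y))))))))"
    using h t u by - (rule twisted_ad_pair_sum[where W = "\<lambda>a b e x y.
      hsum U x (\<lambda>x1 x2. F (a \<cdot> x1) (e \<cdot> (b \<cdot> x2)) y)"], (rule lin_F | assumption | simp)+)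
  also have "\<dots> = ?r"
    by (intro tensor_sum_cong t u twisted_conj_left_pure h)
  finally show ?thesis .
qed

lemma twisted_conj_right:
  assumes h: "h \<in> carrier H" and t: "t \<in> carrier HH" and u: "u \<in> carrier HH"
  shows "hsum U h (\<lambda>h1 s. hsum U s (\<lambda>h2 h3.
      tsum U (twisted_ad h1 t) (\<lambda>a b. tsum U (twisted_ad h3 u) (\<lambda>x y.
        hsum U b (\<lambda>b1 b2. F a (h2 \<cdot> (x \<cdot> b1)) (y \<cdot> b2)))))) =
    tsum U t (\<lambda>a b. tsum U u (\<lambda>x y. hsum U b (\<lambda>b1 b2.
      twisted_conj U F h a (x \<cdot> b1) (y \<cdot> b2))))" (is "?l = ?r")
proof -
  have "?l = tsum U t (\<lambda>a b. tsum U u (\<lambda>x y. hsum U h (\<lambda>h1 s. hsum U s (\<lambda>h2 h3.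
      hsum U h1 (\<lambda>p q. hsum U h3 (\<lambda>m n. hsum U (ad_right q b) (\<lambda>b1 b2.
        F (ad_left p a) (h2 \<cdot> (ad_left m x \<cdot> b1)) (ad_right n y \<cdot> b2))))))))"
    using h t u by - (rule twisted_ad_pair_sum[where W = "\<lambda>a b e x y.
      hsum U b (\<lambda>b1 b2. F a (e \<cdot> (x \<cdot> b1)) (y \<cdot> b2))"], (rule lin_F | assumption | simp)+)
  also have "\<dots> = ?r"
    by (intro tensor_sum_cong t u twisted_conj_right_pure h)
  finally show ?thesis .
qed

end

end

section \<open>The module coalgebra \<open>C \<otimes> H\<close>\<close>

locale cocycle_setting = bijective_hopf_algebra K H + C: coalgebra K C
  for K :: "('k, 'p) ring_scheme" (structure) and H :: "('k, 'h, 'q) hopf_algebra_scheme" (structure)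
    and C :: "('k, 'c, 'r) coalgebra_scheme" (structure)
begin

abbreviation "D \<equiv> tensor_coalgebra K C H"
abbreviation "CH \<equiv> tensor_product K C H"
abbreviation "ract \<equiv> tensor_right_act K C H"
abbreviation "csum U c f \<equiv> tsum U (comult C c) f"

text \<open>
  \<open>D\<close> and \<open>CH\<close> are the same module, but values of different record types; both occur below because the
  coalgebra structure is defined in terms of \<open>CH\<close>, whereas the cocycle identity takes place over \<open>D\<close>.
\<close>
lemma D_fields [simp]: "carrier D = carrier CH" "add D = add CH" "zero D = zero CH" "smult D = smult CH"
  by (simp_all add: tensor_coalgebra_def Let_def module.defs)

lemma module_CH [simp, intro]: "module K CH"
  by (intro tensor_product_module module_C C.module_C)

lemma module_D [simp, intro]: "module K D"
proof -
  interpret CH: module K CH by (rule module_CH)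
  have "abelian_group D"
    by (rule abelian_groupI) (auto simp: CH.M.a_ac intro: CH.M.l_neg intro!: bexI[of _ "\<ominus>\<^bsub>CH\<^esub> _"])
  then show ?thesis
    by (intro moduleI) (auto simp: CH.smult_l_distr CH.smult_r_distr CH.smult_assoc1 intro: module_imp_cring[OF module_CH])
qed

lemma linear_map_to_D: "linear_map K P D f \<longleftrightarrow> linear_map K P CH f"
  and linear_map_from_D: "linear_map K D U g \<longleftrightarrow> linear_map K CH U g"
  by (simp_all add: linear_map_def)

lemma linear_ptensor_D:
  "linear_map K P C f \<Longrightarrow> w \<in> carrier H \<Longrightarrow> linear_map K P D (\<lambda>x. ptensor K C H (f x) w)"
  "linear_map K P H g \<Longrightarrow> v \<in> carrier C \<Longrightarrow> linear_map K P D (\<lambda>x. ptensor K C H v (g x))"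
  unfolding linear_map_to_D by (rule linear_map_ptensor_left linear_map_ptensor_right | assumption | simp)+

lemma ptensor_in_D: "c \<in> carrier C \<Longrightarrow> h \<in> carrier H \<Longrightarrow> ptensor K C H c h \<in> carrier D"
  by (simp add: ptensor_closed)

lemmas lin_D = linear_ptensor_D ptensor_in_D C.linear_comult C.linear_counit C.comult_closed C.module_C module_D
  lin_twisted

lemma comult_D_eq: "comult D d = tsum (tensor_product K CH CH) d (\<lambda>c e.
    tsum (tensor_product K CH CH) (comult C c) (\<lambda>c1 c2. tsum (tensor_product K CH CH) (comult H e) (\<lambda>e1 e2.
      ptensor K CH CH (ptensor K C H c1 e1) (ptensor K C H c2 e2))))"
  by (simp add: tensor_coalgebra_def Let_def module.defs coalgebra.defs)

text \<open>
  The counit is a sum in the field. Read in \<open>self_module K\<close> it is a sum in a module, like all the others.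
\<close>
lemma counit_D_eq: "counit D d = tsum (self_module K) d (\<lambda>c e. counit C c \<odot>\<^bsub>self_module K\<^esub> counit H e)"
  by (simp add: tensor_coalgebra_def Let_def module.defs coalgebra.defs tsum_def self_module_def)

lemma comult_D_linear: "linear_map K CH (tensor_product K CH CH) (comult D)"
  unfolding comult_D_eq by (rule lin_D | assumption | simp)+

lemma counit_D_linear: "linear_map K CH (self_module K) (counit D)"
  unfolding counit_D_eq by (rule lin_D | assumption | simp del: self_smult)+

lemma comult_D_closed [simp]: "d \<in> carrier CH \<Longrightarrow> comult D d \<in> carrier (tensor_product K CH CH)"
  by (rule linear_map_closed[OF comult_D_linear])

lemma counit_D_pure:
  assumes "c \<in> carrier C" "h \<in> carrier H"
  shows "counit D (ptensor K C H c h) = counit C c \<otimes>\<^bsub>K\<^esub> counit H h"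
proof -
  have "counit D (ptensor K C H c h) = counit C c \<odot>\<^bsub>self_module K\<^esub> counit H h"
    unfolding counit_D_eq using assms
    by - (rule tsum_ptensor_eq, (rule lin_D | assumption | simp del: self_smult)+)
  then show ?thesis by simp
qed

lemma comult_D_pure_sum:
  assumes c: "c \<in> carrier C" and h: "h \<in> carrier H" and U: "module K U"
    and F1: "\<And>y. y \<in> carrier CH \<Longrightarrow> linear_map K CH U (\<lambda>x. F x y)"
    and F2: "\<And>x. x \<in> carrier CH \<Longrightarrow> linear_map K CH U (\<lambda>y. F x y)"
  shows "tsum U (comult D (ptensor K C H c h)) F = csum U c (\<lambda>c1 c2. hsum U h (\<lambda>h1 h2.
    F (ptensor K C H c1 h1) (ptensor K C H c2 h2)))"
proof -
  let ?DD = "tensor_product K CH CH"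
  have "comult D (ptensor K C H c h) = csum ?DD c (\<lambda>c1 c2. hsum ?DD h (\<lambda>e1 e2.
      ptensor K CH CH (ptensor K C H c1 e1) (ptensor K C H c2 e2)))"
    unfolding comult_D_eq using c h by - (rule tsum_ptensor_eq, (rule lin_D | assumption | simp)+)
  moreover have "tsum U \<dots> F = csum U c (\<lambda>c1 c2. hsum U h (\<lambda>h1 h2.
    F (ptensor K C H c1 h1) (ptensor K C H c2 h2)))"
    by (rule linear_map_of_tsum_eq[where \<phi> = "\<lambda>t. tsum U t F"] tsum_ptensor_eq
        linear_map_tsum bilinear_mapI F1 F2 U c h lin_D | assumption)+
  ultimately show ?thesis by simp
qed

lemma ract_pure:
  assumes "c \<in> carrier C" "h \<in> carrier H" "g \<in> carrier H"
  shows "ract (ptensor K C H c h) g = ptensor K C H c (h \<cdot> g)"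
  unfolding tensor_right_act_def using assms
  by - (rule tsum_ptensor_eq, (rule lin_D | assumption | simp)+)

lemma linear_ract:
  assumes "linear_map K P CH f" "g \<in> carrier H"
  shows "linear_map K P CH (\<lambda>x. ract (f x) g)"
  unfolding tensor_right_act_def using assms by - (rule lin_D | assumption | simp)+

lemma linear_ract_arg:
  assumes "linear_map K P H f" "d \<in> carrier CH" "module K P"
  shows "linear_map K P CH (\<lambda>x. ract d (f x))"
  unfolding tensor_right_act_def using assms by - (rule lin_D | assumption | simp)+

lemma ract_closed [simp]: "d \<in> carrier CH \<Longrightarrow> g \<in> carrier H \<Longrightarrow> ract d g \<in> carrier CH"
  unfolding tensor_right_act_def by (rule lin_D | assumption | simp)+

lemma linear_comult_D: "linear_map K P CH f \<Longrightarrow> linear_map K P (tensor_product K CH CH) (\<lambda>x. comult D (f x))"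
  by (rule linear_map_comp[OF _ comult_D_linear])

lemma linear_counit_D: "linear_map K P CH f \<Longrightarrow> linear_map K P (self_module K) (\<lambda>x. counit D (f x))"
  by (rule linear_map_comp[OF _ counit_D_linear])

lemma linear_ract_D:
  "linear_map K P CH f \<Longrightarrow> g \<in> carrier H \<Longrightarrow> linear_map K P D (\<lambda>x. ract (f x) g)"
  "linear_map K P H f' \<Longrightarrow> d \<in> carrier CH \<Longrightarrow> module K P \<Longrightarrow> linear_map K P D (\<lambda>x. ract d (f' x))"
  unfolding linear_map_to_D by (rule linear_ract linear_ract_arg | assumption)+

lemmas lin_act = linear_ract linear_ract_arg linear_ract_D linear_comult_D linear_counit_D ract_closed
  comult_D_closed module_CH lin_D

lemma comult2_D_pure_sum:
  assumes c: "c \<in> carrier C" and h: "h \<in> carrier H" and U: "module K U"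
    and F1: "\<And>y z. y \<in> carrier CH \<Longrightarrow> z \<in> carrier CH \<Longrightarrow> linear_map K CH U (\<lambda>x. F x y z)"
    and F2: "\<And>x z. x \<in> carrier CH \<Longrightarrow> z \<in> carrier CH \<Longrightarrow> linear_map K CH U (\<lambda>y. F x y z)"
    and F3: "\<And>x y. x \<in> carrier CH \<Longrightarrow> y \<in> carrier CH \<Longrightarrow> linear_map K CH U (\<lambda>z. F x y z)"
  shows "tsum U (comult D (ptensor K C H c h)) (\<lambda>d1 r. tsum U (comult D r) (\<lambda>d2 d3. F d1 d2 d3)) =
    csum U c (\<lambda>c1 r. csum U r (\<lambda>c2 c3.
      hsum U h (\<lambda>h1 s. hsum U s (\<lambda>h2 h3.
        F (ptensor K C H c1 h1) (ptensor K C H c2 h2) (ptensor K C H c3 h3)))))"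
proof -
  note F = linear_map_comp[OF _ F1] linear_map_comp[OF _ F2] linear_map_comp[OF _ F3]
  note lin_loc = F lin_act U linear_map_closed[OF F1]
  have "tsum U (comult D (ptensor K C H c h)) (\<lambda>d1 r. tsum U (comult D r) (\<lambda>d2 d3. F d1 d2 d3)) =
    csum U c (\<lambda>c1 r. hsum U h (\<lambda>h1 s.
      tsum U (comult D (ptensor K C H r s)) (\<lambda>d2 d3. F (ptensor K C H c1 h1) d2 d3)))"
    using c h by - (rule comult_D_pure_sum[where F = "\<lambda>d1 r. tsum U (comult D r) (\<lambda>d2 d3. F d1 d2 d3)"],
       (rule lin_loc | assumption | simp)+)
  also have "\<dots> = csum U c (\<lambda>c1 r. hsum U h (\<lambda>h1 s.
      csum U r (\<lambda>c2 c3. hsum U s (\<lambda>h2 h3.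
        F (ptensor K C H c1 h1) (ptensor K C H c2 h2) (ptensor K C H c3 h3)))))"
  proof (intro C.comult_sum_cong comult_sum_cong c h)
    fix c1 r h1 s assume "c1 \<in> carrier C" "r \<in> carrier C" "h1 \<in> carrier H" "s \<in> carrier H"
    then show "tsum U (comult D (ptensor K C H r s)) (\<lambda>d2 d3. F (ptensor K C H c1 h1) d2 d3) =
      csum U r (\<lambda>c2 c3. hsum U s (\<lambda>h2 h3.
        F (ptensor K C H c1 h1) (ptensor K C H c2 h2) (ptensor K C H c3 h3)))"
      by - (rule comult_D_pure_sum[where F = "\<lambda>d2 d3. F (ptensor K C H c1 h1) d2 d3"],
       (rule lin_loc | assumption | simp)+)
  qed
  also have "\<dots> = csum U c (\<lambda>c1 r. csum U r (\<lambda>c2 c3. hsum U h (\<lambda>h1 s.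
      hsum U s (\<lambda>h2 h3.
        F (ptensor K C H c1 h1) (ptensor K C H c2 h2) (ptensor K C H c3 h3)))))"
    using c h by - (rule C.comult_sum_cong, assumption,
       rule tsum_swap[OF module_C module_C comult_closed C.module_C C.module_C C.comult_closed U],
       (rule lin_loc | assumption | simp)+)
  finally show ?thesis .
qed

section \<open>The twisted cocycle identity on pure tensors\<close>

abbreviation "T \<equiv> tensor_product3 K H D H"
abbreviation "ptens4 \<equiv> \<lambda>u c w z. ptensor3 K H D H u (ptensor K C H c w) z"

definition twisted_identity :: "(('c, 'h) tensor \<Rightarrow> ('h, 'h) tensor) \<Rightarrow> ('c, 'h) tensor \<Rightarrow> bool" where
  "twisted_identity \<beta> d \<longleftrightarrow>
    tsum T (comult D d) (\<lambda>d1 r. tsum T (comult D r) (\<lambda>d2 d3.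
      tsum T (\<beta> d1) (\<lambda>a b. tsum T (\<beta> d3) (\<lambda>x y. hsum T x (\<lambda>x1 x2.
        ptensor3 K H D H (a \<cdot> x1) (ract d2 (b \<cdot> x2)) y))))) =
    tsum T (comult D d) (\<lambda>d1 r. tsum T (comult D r) (\<lambda>d2 d3.
      tsum T (\<beta> d1) (\<lambda>a b. tsum T (\<beta> d3) (\<lambda>x y. hsum T b (\<lambda>b1 b2.
        ptensor3 K H D H a (ract d2 (x \<cdot> b1)) (y \<cdot> b2))))))"

text \<open>
  The two sides of the interleaved identity, as the values of an arbitrary map \<open>\<Phi>\<close> in place of
  \<open>u \<otimes> c \<otimes> w \<otimes> z\<close>. It is used for the tensor product itself, for its composite with
  \<open>twisted_conj\<close>, and for its contractions by counits.
\<close>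
definition interleaved_left ::
    "('k, 'u, 's) module_scheme \<Rightarrow> ('c \<Rightarrow> ('h, 'h) tensor) \<Rightarrow> ('h \<Rightarrow> 'c \<Rightarrow> 'h \<Rightarrow> 'h \<Rightarrow> 'u) \<Rightarrow> 'c \<Rightarrow> 'u" where
  "interleaved_left U \<alpha> \<Phi> c = csum U c (\<lambda>c1 r. csum U r (\<lambda>c2 c3.
     tsum U (\<alpha> c1) (\<lambda>a b. tsum U (\<alpha> c3) (\<lambda>x y. hsum U x (\<lambda>x1 x2. \<Phi> (a \<cdot> x1) c2 (b \<cdot> x2) y)))))"

definition interleaved_right ::
    "('k, 'u, 's) module_scheme \<Rightarrow> ('c \<Rightarrow> ('h, 'h) tensor) \<Rightarrow> ('h \<Rightarrow> 'c \<Rightarrow> 'h \<Rightarrow> 'h \<Rightarrow> 'u) \<Rightarrow> 'c \<Rightarrow> 'u" where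
  "interleaved_right U \<alpha> \<Phi> c = csum U c (\<lambda>c1 r. csum U r (\<lambda>c2 c3.
     tsum U (\<alpha> c1) (\<lambda>a b. tsum U (\<alpha> c3) (\<lambda>x y. hsum U b (\<lambda>b1 b2. \<Phi> a c2 (x \<cdot> b1) (y \<cdot> b2))))))"

context
  fixes \<alpha> :: "'c \<Rightarrow> ('h, 'h) tensor"
  assumes \<alpha>: "linear_map K C HH \<alpha>"
begin

lemmas \<alpha>_comp = linear_map_comp[OF _ \<alpha>]
lemmas \<alpha>_closed = linear_map_closed[OF \<alpha>]
lemmas lin_\<alpha> = \<alpha>_comp \<alpha>_closed lin_act

context
  fixes \<beta> :: "('c, 'h) tensor \<Rightarrow> ('h, 'h) tensor"
  assumes \<beta>: "linear_map K CH HH \<beta>"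
    and \<beta>_pure: "\<And>c h. c \<in> carrier C \<Longrightarrow> h \<in> carrier H \<Longrightarrow> \<beta> (ptensor K C H c h) = twisted_ad h (\<alpha> c)"
begin

lemmas \<beta>_comp = linear_map_comp[OF _ \<beta>]
lemmas \<beta>_closed = linear_map_closed[OF \<beta>]
lemmas lin_\<beta> = \<beta>_comp \<beta>_closed lin_\<alpha>

text \<open>
  The comultiplication of \<open>C \<otimes> H\<close> decouples into the sums over \<open>c\<close> and over \<open>h\<close>. The inner sum over \<open>h\<close> is
  the one evaluated by \<open>twisted_conj_left\<close> and \<open>twisted_conj_right\<close>, with \<open>\<alpha>(c1)\<close> and \<open>\<alpha>(c3)\<close> as the
  two tensors.
\<close>
lemma twisted_sides_pure:
  assumes c: "c \<in> carrier C" and h: "h \<in> carrier H"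
  shows "tsum T (comult D (ptensor K C H c h)) (\<lambda>d1 r. tsum T (comult D r) (\<lambda>d2 d3.
      tsum T (\<beta> d1) (\<lambda>a b. tsum T (\<beta> d3) (\<lambda>x y. hsum T x (\<lambda>x1 x2.
        ptensor3 K H D H (a \<cdot> x1) (ract d2 (b \<cdot> x2)) y))))) =
    interleaved_left T \<alpha> (\<lambda>u c w z. twisted_conj T (\<lambda>u w z. ptens4 u c w z) h u w z) c" (is ?left)
  and "tsum T (comult D (ptensor K C H c h)) (\<lambda>d1 r. tsum T (comult D r) (\<lambda>d2 d3.
      tsum T (\<beta> d1) (\<lambda>a b. tsum T (\<beta> d3) (\<lambda>x y. hsum T b (\<lambda>b1 b2.
        ptensor3 K H D H a (ract d2 (x \<cdot> b1)) (y \<cdot> b2)))))) =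
    interleaved_right T \<alpha> (\<lambda>u c w z. twisted_conj T (\<lambda>u w z. ptens4 u c w z) h u w z) c" (is ?right)
proof -
  have act: "ract (ptensor K C H c2 h2) (b \<cdot> x2) = ptensor K C H c2 (h2 \<cdot> (b \<cdot> x2))"
    if "c2 \<in> carrier C" "h2 \<in> carrier H" "b \<in> carrier H" "x2 \<in> carrier H" for c2 h2 b x2
    using that by (simp add: ract_pure)
  have "tsum T (comult D (ptensor K C H c h)) (\<lambda>d1 r. tsum T (comult D r) (\<lambda>d2 d3.
      tsum T (\<beta> d1) (\<lambda>a b. tsum T (\<beta> d3) (\<lambda>x y. hsum T x (\<lambda>x1 x2.
        ptensor3 K H D H (a \<cdot> x1) (ract d2 (b \<cdot> x2)) y))))) =
    csum T c (\<lambda>c1 r. csum T r (\<lambda>c2 c3.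
      hsum T h (\<lambda>h1 s. hsum T s (\<lambda>h2 h3.
      tsum T (\<beta> (ptensor K C H c1 h1)) (\<lambda>a b. tsum T (\<beta> (ptensor K C H c3 h3)) (\<lambda>x y. hsum T x (\<lambda>x1 x2.
        ptensor3 K H D H (a \<cdot> x1) (ract (ptensor K C H c2 h2) (b \<cdot> x2)) y)))))))"
    using c h by - (rule comult2_D_pure_sum[where F = "\<lambda>d1 d2 d3.
      tsum T (\<beta> d1) (\<lambda>a b. tsum T (\<beta> d3) (\<lambda>x y. hsum T x (\<lambda>x1 x2.
        ptensor3 K H D H (a \<cdot> x1) (ract d2 (b \<cdot> x2)) y)))"], (rule lin_\<beta> | assumption | simp)+)
  also have "\<dots> = csum T c (\<lambda>c1 r. csum T r (\<lambda>c2 c3.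
      hsum T h (\<lambda>h1 s. hsum T s (\<lambda>h2 h3.
      tsum T (twisted_ad h1 (\<alpha> c1)) (\<lambda>a b. tsum T (twisted_ad h3 (\<alpha> c3)) (\<lambda>x y. hsum T x (\<lambda>x1 x2.
        ptens4 (a \<cdot> x1) c2 (h2 \<cdot> (b \<cdot> x2)) y)))))))"
    using c h by (intro C.comult_sum_cong comult_sum_cong) (simp_all add: \<beta>_pure,
      intro tensor_sum_cong comult_sum_cong, simp_all add: act \<alpha>_closed)
  also have "\<dots> = interleaved_left T \<alpha> (\<lambda>u c w z. twisted_conj T (\<lambda>u w z. ptens4 u c w z) h u w z) c"
    unfolding interleaved_left_def
    using c h by - (rule C.comult_sum_cong, assumption, rule C.comult_sum_cong, assumption, rule twisted_conj_left,
     (rule lin_\<beta> | assumption | simp)+)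
  finally show ?left .
  have "tsum T (comult D (ptensor K C H c h)) (\<lambda>d1 r. tsum T (comult D r) (\<lambda>d2 d3.
      tsum T (\<beta> d1) (\<lambda>a b. tsum T (\<beta> d3) (\<lambda>x y. hsum T b (\<lambda>b1 b2.
        ptensor3 K H D H a (ract d2 (x \<cdot> b1)) (y \<cdot> b2)))))) =
    csum T c (\<lambda>c1 r. csum T r (\<lambda>c2 c3.
      hsum T h (\<lambda>h1 s. hsum T s (\<lambda>h2 h3.
      tsum T (\<beta> (ptensor K C H c1 h1)) (\<lambda>a b. tsum T (\<beta> (ptensor K C H c3 h3)) (\<lambda>x y. hsum T b (\<lambda>b1 b2.
        ptensor3 K H D H a (ract (ptensor K C H c2 h2) (x \<cdot> b1)) (y \<cdot> b2))))))))"
    using c h by - (rule comult2_D_pure_sum[where F = "\<lambda>d1 d2 d3.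
      tsum T (\<beta> d1) (\<lambda>a b. tsum T (\<beta> d3) (\<lambda>x y. hsum T b (\<lambda>b1 b2.
        ptensor3 K H D H a (ract d2 (x \<cdot> b1)) (y \<cdot> b2))))"], (rule lin_\<beta> | assumption | simp)+)
  also have "\<dots> = csum T c (\<lambda>c1 r. csum T r (\<lambda>c2 c3.
      hsum T h (\<lambda>h1 s. hsum T s (\<lambda>h2 h3.
      tsum T (twisted_ad h1 (\<alpha> c1)) (\<lambda>a b. tsum T (twisted_ad h3 (\<alpha> c3)) (\<lambda>x y. hsum T b (\<lambda>b1 b2.
        ptens4 a c2 (h2 \<cdot> (x \<cdot> b1)) (y \<cdot> b2))))))))"
    using c h by (intro C.comult_sum_cong comult_sum_cong) (simp_all add: \<beta>_pure,
      intro tensor_sum_cong comult_sum_cong, simp_all add: act \<alpha>_closed)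
  also have "\<dots> = interleaved_right T \<alpha> (\<lambda>u c w z. twisted_conj T (\<lambda>u w z. ptens4 u c w z) h u w z) c"
    unfolding interleaved_right_def
    using c h by - (rule C.comult_sum_cong, assumption, rule C.comult_sum_cong, assumption, rule twisted_conj_right,
     (rule lin_\<beta> | assumption | simp)+)
  finally show ?right .
qed

lemma twisted_identity_pure:
  assumes "c \<in> carrier C" and "h \<in> carrier H"
  shows "twisted_identity \<beta> (ptensor K C H c h) \<longleftrightarrow>
    interleaved_left T \<alpha> (\<lambda>u c w z. twisted_conj T (\<lambda>u w z. ptens4 u c w z) h u w z) c =
    interleaved_right T \<alpha> (\<lambda>u c w z. twisted_conj T (\<lambda>u w z. ptens4 u c w z) h u w z) c"
  unfolding twisted_identity_def twisted_sides_pure[OF assms] ..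

end

section \<open>Harrison cocycles and the interleaved identity\<close>

abbreviation "T3 \<equiv> tensor_product3 K H H H"
abbreviation "TC \<equiv> tensor_product3 K H H C"

definition central :: bool where
  "central \<longleftrightarrow> (\<forall>c\<in>carrier C.
    csum TC c (\<lambda>c1 c2. tsum TC (\<alpha> c2) (\<lambda>a b. ptensor3 K H H C a b c1)) =
    csum TC c (\<lambda>c1 c2. tsum TC (\<alpha> c1) (\<lambda>a b. ptensor3 K H H C a b c2)))"

definition harrison_identity :: bool where
  "harrison_identity \<longleftrightarrow> (\<forall>c\<in>carrier C.
    csum T3 c (\<lambda>c1 c2. tsum T3 (\<alpha> c1) (\<lambda>a b. tsum T3 (\<alpha> c2) (\<lambda>x y.
      hsum T3 y (\<lambda>y1 y2. ptensor3 K H H H x (a \<cdot> y1) (b \<cdot> y2))))) =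
    csum T3 c (\<lambda>c1 c2. tsum T3 (\<alpha> c1) (\<lambda>a b. tsum T3 (\<alpha> c2) (\<lambda>x y.
      hsum T3 x (\<lambda>x1 x2. ptensor3 K H H H (a \<cdot> x1) (b \<cdot> x2) y)))))"

lemma \<alpha>_sum_cong:
  assumes "c \<in> carrier C" "\<And>a b. a \<in> carrier H \<Longrightarrow> b \<in> carrier H \<Longrightarrow> f a b = g a b"
  shows "tsum U (\<alpha> c) f = tsum U (\<alpha> c) g"
  using assms by (intro tensor_sum_cong \<alpha>_closed)

lemma central_sum:
  assumes cen: central and c: "c \<in> carrier C" and U: "module K U"
    and F1: "\<And>b x. b \<in> carrier H \<Longrightarrow> x \<in> carrier C \<Longrightarrow> linear_map K H U (\<lambda>a. F a b x)"
    and F2: "\<And>a x. a \<in> carrier H \<Longrightarrow> x \<in> carrier C \<Longrightarrow> linear_map K H U (\<lambda>b. F a b x)"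
    and F3: "\<And>a b. a \<in> carrier H \<Longrightarrow> b \<in> carrier H \<Longrightarrow> linear_map K C U (\<lambda>x. F a b x)"
  shows "csum U c (\<lambda>c1 c2. tsum U (\<alpha> c2) (\<lambda>a b. F a b c1)) =
    csum U c (\<lambda>c1 c2. tsum U (\<alpha> c1) (\<lambda>a b. F a b c2))"
proof -
  obtain \<phi> where \<phi>: "linear_map K TC U \<phi>"
    and ev: "\<And>a b x. a \<in> carrier H \<Longrightarrow> b \<in> carrier H \<Longrightarrow> x \<in> carrier C \<Longrightarrow> \<phi> (ptensor3 K H H C a b x) = F a b x"
    using tensor3_lift[OF module_C module_C C.module_C U F1 F2 F3] by blast
  note push = linear_map_of_tsum_eq[where \<phi> = \<phi>] \<alpha>_closed C.comult_closed ev \<phi> tsum_in_carrier ptensor_closed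
    module_C C.module_C tensor_product_module U
  have "csum U c (\<lambda>c1 c2. tsum U (\<alpha> c2) (\<lambda>a b. F a b c1)) =
      \<phi> (csum TC c (\<lambda>c1 c2. tsum TC (\<alpha> c2) (\<lambda>a b. ptensor3 K H H C a b c1)))"
    using c by - (rule HOL.sym, (rule push | assumption)+)
  also have "\<dots> = \<phi> (csum TC c (\<lambda>c1 c2. tsum TC (\<alpha> c1) (\<lambda>a b. ptensor3 K H H C a b c2)))"
    using cen c by (simp add: central_def)
  also have "\<dots> = csum U c (\<lambda>c1 c2. tsum U (\<alpha> c1) (\<lambda>a b. F a b c2))"
    using c by - (rule push | assumption)+
  finally show ?thesis .
qed

lemma harrison_sum:
  assumes harr: harrison_identity and c: "c \<in> carrier C" and U: "module K U"
    and F1: "\<And>y z. y \<in> carrier H \<Longrightarrow> z \<in> carrier H \<Longrightarrow> linear_map K H U (\<lambda>x. F x y z)"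
    and F2: "\<And>x z. x \<in> carrier H \<Longrightarrow> z \<in> carrier H \<Longrightarrow> linear_map K H U (\<lambda>y. F x y z)"
    and F3: "\<And>x y. x \<in> carrier H \<Longrightarrow> y \<in> carrier H \<Longrightarrow> linear_map K H U (\<lambda>z. F x y z)"
  shows "csum U c (\<lambda>c1 c2. tsum U (\<alpha> c1) (\<lambda>a b. tsum U (\<alpha> c2) (\<lambda>x y.
      hsum U y (\<lambda>y1 y2. F x (a \<cdot> y1) (b \<cdot> y2))))) =
    csum U c (\<lambda>c1 c2. tsum U (\<alpha> c1) (\<lambda>a b. tsum U (\<alpha> c2) (\<lambda>x y.
      hsum U x (\<lambda>x1 x2. F (a \<cdot> x1) (b \<cdot> x2) y))))"
proof -
  obtain \<phi> where \<phi>: "linear_map K T3 U \<phi>"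
    and ev: "\<And>x y z. x \<in> carrier H \<Longrightarrow> y \<in> carrier H \<Longrightarrow> z \<in> carrier H \<Longrightarrow> \<phi> (ptensor3 K H H H x y z) = F x y z"
    using tensor3_lift[OF module_C module_C module_C U F1 F2 F3] by blast
  note push = linear_map_of_tsum_eq[where \<phi> = \<phi>] \<alpha>_closed C.comult_closed comult_closed ev \<phi> tsum_in_carrier
    ptensor_closed hmult_closed module_C C.module_C tensor_product_module U
  have "csum U c (\<lambda>c1 c2. tsum U (\<alpha> c1) (\<lambda>a b. tsum U (\<alpha> c2) (\<lambda>x y.
      hsum U y (\<lambda>y1 y2. F x (a \<cdot> y1) (b \<cdot> y2))))) =
    \<phi> (csum T3 c (\<lambda>c1 c2. tsum T3 (\<alpha> c1) (\<lambda>a b. tsum T3 (\<alpha> c2) (\<lambda>x y.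
      hsum T3 y (\<lambda>y1 y2. ptensor3 K H H H x (a \<cdot> y1) (b \<cdot> y2))))))"
    using c by - (rule HOL.sym, (rule push | assumption)+)
  also have "\<dots> = \<phi> (csum T3 c (\<lambda>c1 c2. tsum T3 (\<alpha> c1) (\<lambda>a b. tsum T3 (\<alpha> c2) (\<lambda>x y.
      hsum T3 x (\<lambda>x1 x2. ptensor3 K H H H (a \<cdot> x1) (b \<cdot> x2) y)))))"
    using harr c by (simp add: harrison_identity_def)
  also have "\<dots> = csum U c (\<lambda>c1 c2. tsum U (\<alpha> c1) (\<lambda>a b. tsum U (\<alpha> c2) (\<lambda>x y.
      hsum U x (\<lambda>x1 x2. F (a \<cdot> x1) (b \<cdot> x2) y))))"
    using c by - (rule push | assumption)+
  finally show ?thesis .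
qed

text \<open>
  Compose with the linear map on \<open>H \<otimes> (C \<otimes> H) \<otimes> H\<close> that \<open>F\<close> induces.
\<close>
lemma interleaved_lift:
  assumes eq: "interleaved_left T \<alpha> ptens4 c = interleaved_right T \<alpha> ptens4 c"
    and c: "c \<in> carrier C" and U: "module K U"
    and F1: "\<And>y w z. y \<in> carrier C \<Longrightarrow> w \<in> carrier H \<Longrightarrow> z \<in> carrier H \<Longrightarrow> linear_map K H U (\<lambda>x. F x y w z)"
    and F2: "\<And>x w z. x \<in> carrier H \<Longrightarrow> w \<in> carrier H \<Longrightarrow> z \<in> carrier H \<Longrightarrow> linear_map K C U (\<lambda>y. F x y w z)"
    and F3: "\<And>x y z. x \<in> carrier H \<Longrightarrow> y \<in> carrier C \<Longrightarrow> z \<in> carrier H \<Longrightarrow> linear_map K H U (\<lambda>w. F x y w z)"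
    and F4: "\<And>x y w. x \<in> carrier H \<Longrightarrow> y \<in> carrier C \<Longrightarrow> w \<in> carrier H \<Longrightarrow> linear_map K H U (\<lambda>z. F x y w z)"
  shows "interleaved_left U \<alpha> F c = interleaved_right U \<alpha> F c"
proof -
  note F = linear_map_comp[OF _ F1] linear_map_comp[OF _ F2] linear_map_comp[OF _ F3] linear_map_comp[OF _ F4]
  obtain \<phi> where \<phi>: "linear_map K T U \<phi>"
    and ev: "\<And>x d z. x \<in> carrier H \<Longrightarrow> d \<in> carrier D \<Longrightarrow> z \<in> carrier H \<Longrightarrow>
      \<phi> (ptensor3 K H D H x d z) = tsum U d (\<lambda>y w. F x y w z)"
    by (rule tensor3_lift[OF module_C module_D module_C U, where F = "\<lambda>x d z. tsum U d (\<lambda>y w. F x y w z)"])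
      (simp_all add: linear_map_from_D, (rule F U lin_act | assumption)+)
  have ev4: "\<phi> (ptens4 x y w z) = F x y w z"
    if "x \<in> carrier H" "y \<in> carrier C" "w \<in> carrier H" "z \<in> carrier H" for x y w z
  proof -
    have "\<phi> (ptens4 x y w z) = tsum U (ptensor K C H y w) (\<lambda>y w. F x y w z)"
      using that by (intro ev) (simp_all add: ptensor_closed)
    also have "\<dots> = F x y w z"
      using that by - (rule tsum_ptensor_eq, (rule F U lin_act | assumption)+)
    finally show ?thesis .
  qed
  note push = linear_map_of_tsum_eq[where \<phi> = \<phi>] \<alpha>_closed C.comult_closed comult_closed ev4 \<phi> tsum_in_carrier
    ptensor_in_D ptensor_closed hmult_closed module_C C.module_C module_D tensor_product_module U
  have "interleaved_left U \<alpha> F c = \<phi> (interleaved_left T \<alpha> ptens4 c)"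
    unfolding interleaved_left_def using c by - (rule HOL.sym, (rule push | assumption)+)
  also have "\<dots> = \<phi> (interleaved_right T \<alpha> ptens4 c)" by (simp add: eq)
  also have "\<dots> = interleaved_right U \<alpha> F c"
    unfolding interleaved_right_def using c by - (rule push | assumption)+
  finally show ?thesis .
qed

lemma \<alpha>_sum_swap:
  assumes "c \<in> carrier C" "d \<in> carrier C" "module K U"
    "\<And>v w x y. v \<in> carrier H \<Longrightarrow> w \<in> carrier H \<Longrightarrow> x \<in> carrier H \<Longrightarrow> y \<in> carrier H \<Longrightarrow>
      f v w x y \<in> carrier U"
  shows "tsum U (\<alpha> c) (\<lambda>v w. tsum U (\<alpha> d) (\<lambda>x y. f v w x y)) =
    tsum U (\<alpha> d) (\<lambda>x y. tsum U (\<alpha> c) (\<lambda>v w. f v w x y))"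
  using assms by (intro tensor_sum_swap \<alpha>_closed)

text \<open>
  In \<open>c1 \<otimes> c2 \<otimes> c3\<close> the map \<open>\<alpha>\<close> is applied to the outer factors. Centrality on \<open>c2 \<otimes> c3\<close> makes
  \<open>c3\<close> the passive factor, so that \<open>\<alpha>\<close> is applied to the adjacent factors \<open>c1 \<otimes> c2\<close>, where the Harrison
  identity applies. It leaves the two values in the wrong order, which centrality on \<open>c1 \<otimes> c2\<close>
  repairs, and a last use of centrality brings the passive factor back into the middle.
\<close>
lemma harrison_imp_interleaved:
  assumes cen: central and harr: harrison_identity and c: "c \<in> carrier C" and U: "module K U"
    and F1: "\<And>y w z. y \<in> carrier C \<Longrightarrow> w \<in> carrier H \<Longrightarrow> z \<in> carrier H \<Longrightarrow> linear_map K H U (\<lambda>x. F x y w z)"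
    and F2: "\<And>x w z. x \<in> carrier H \<Longrightarrow> w \<in> carrier H \<Longrightarrow> z \<in> carrier H \<Longrightarrow> linear_map K C U (\<lambda>y. F x y w z)"
    and F3: "\<And>x y z. x \<in> carrier H \<Longrightarrow> y \<in> carrier C \<Longrightarrow> z \<in> carrier H \<Longrightarrow> linear_map K H U (\<lambda>w. F x y w z)"
    and F4: "\<And>x y w. x \<in> carrier H \<Longrightarrow> y \<in> carrier C \<Longrightarrow> w \<in> carrier H \<Longrightarrow> linear_map K H U (\<lambda>z. F x y w z)"
  shows "interleaved_left U \<alpha> F c = interleaved_right U \<alpha> F c"
proof -
  note F = linear_map_comp[OF _ F1] linear_map_comp[OF _ F2] linear_map_comp[OF _ F3] linear_map_comp[OF _ F4]
  note lin_loc = F U lin_\<alpha> linear_map_closed[OF F1] hmult_closed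
  have "interleaved_left U \<alpha> F c = csum U c (\<lambda>c1 r. csum U r (\<lambda>c2 c3.
     tsum U (\<alpha> c3) (\<lambda>x y. tsum U (\<alpha> c1) (\<lambda>a b. hsum U x (\<lambda>x1 x2. F (a \<cdot> x1) c2 (b \<cdot> x2) y)))))"
    unfolding interleaved_left_def
    using c by - (rule C.comult_sum_cong, assumption, rule C.comult_sum_cong, assumption, rule \<alpha>_sum_swap,
      (rule lin_loc | assumption)+)
  also have "\<dots> = csum U c (\<lambda>c1 r. csum U r (\<lambda>c2 c3.
     tsum U (\<alpha> c2) (\<lambda>x y. tsum U (\<alpha> c1) (\<lambda>a b. hsum U x (\<lambda>x1 x2. F (a \<cdot> x1) c3 (b \<cdot> x2) y)))))"
    using c by - (rule C.comult_sum_cong, assumption, rule central_sum[OF cen], (rule lin_loc | assumption)+)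
  also have "\<dots> = csum U c (\<lambda>s c3. csum U s (\<lambda>c1 c2.
     tsum U (\<alpha> c2) (\<lambda>x y. tsum U (\<alpha> c1) (\<lambda>a b. hsum U x (\<lambda>x1 x2. F (a \<cdot> x1) c3 (b \<cdot> x2) y)))))"
    using c by - (rule C.coassoc_sum[symmetric], (rule lin_loc | assumption)+)
  also have "\<dots> = csum U c (\<lambda>s c3. csum U s (\<lambda>c1 c2.
     tsum U (\<alpha> c1) (\<lambda>a b. tsum U (\<alpha> c2) (\<lambda>x y. hsum U x (\<lambda>x1 x2. F (a \<cdot> x1) c3 (b \<cdot> x2) y)))))"
    using c by - (rule C.comult_sum_cong, assumption, rule C.comult_sum_cong, assumption, rule \<alpha>_sum_swap,
      (rule lin_loc | assumption)+)
  also have "\<dots> = csum U c (\<lambda>s c3. csum U s (\<lambda>c1 c2.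
     tsum U (\<alpha> c1) (\<lambda>a b. tsum U (\<alpha> c2) (\<lambda>x y. hsum U y (\<lambda>y1 y2. F x c3 (a \<cdot> y1) (b \<cdot> y2))))))"
    using c by - (rule C.comult_sum_cong, assumption, rule harrison_sum[OF harr, symmetric], (rule lin_loc | assumption)+)
  also have "\<dots> = csum U c (\<lambda>s c3. csum U s (\<lambda>c1 c2.
     tsum U (\<alpha> c2) (\<lambda>x y. tsum U (\<alpha> c1) (\<lambda>a b. hsum U y (\<lambda>y1 y2. F x c3 (a \<cdot> y1) (b \<cdot> y2))))))"
    using c by - (rule C.comult_sum_cong, assumption, rule C.comult_sum_cong, assumption, rule \<alpha>_sum_swap,
      (rule lin_loc | assumption)+)
  also have "\<dots> = csum U c (\<lambda>s c3. csum U s (\<lambda>c1 c2.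
     tsum U (\<alpha> c1) (\<lambda>x y. tsum U (\<alpha> c2) (\<lambda>a b. hsum U y (\<lambda>y1 y2. F x c3 (a \<cdot> y1) (b \<cdot> y2))))))"
    using c by - (rule C.comult_sum_cong, assumption, rule central_sum[OF cen], (rule lin_loc | assumption)+)
  also have "\<dots> = csum U c (\<lambda>c1 r. csum U r (\<lambda>c2 c3.
     tsum U (\<alpha> c1) (\<lambda>x y. tsum U (\<alpha> c2) (\<lambda>a b. hsum U y (\<lambda>y1 y2. F x c3 (a \<cdot> y1) (b \<cdot> y2))))))"
    using c by - (rule C.coassoc_sum, (rule lin_loc | assumption)+)
  also have "\<dots> = csum U c (\<lambda>c1 r. csum U r (\<lambda>c2 c3.
     tsum U (\<alpha> c2) (\<lambda>a b. tsum U (\<alpha> c1) (\<lambda>x y. hsum U y (\<lambda>y1 y2. F x c3 (a \<cdot> y1) (b \<cdot> y2))))))"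
    using c by - (rule C.comult_sum_cong, assumption, rule C.comult_sum_cong, assumption, rule \<alpha>_sum_swap,
      (rule lin_loc | assumption)+)
  also have "\<dots> = csum U c (\<lambda>c1 r. csum U r (\<lambda>c2 c3.
     tsum U (\<alpha> c3) (\<lambda>a b. tsum U (\<alpha> c1) (\<lambda>x y. hsum U y (\<lambda>y1 y2. F x c2 (a \<cdot> y1) (b \<cdot> y2))))))"
    using c by - (rule C.comult_sum_cong, assumption, rule central_sum[OF cen, symmetric], (rule lin_loc | assumption)+)
  also have "\<dots> = interleaved_right U \<alpha> F c"
    unfolding interleaved_right_def
    using c by - (rule C.comult_sum_cong, assumption, rule C.comult_sum_cong, assumption, rule \<alpha>_sum_swap,
      (rule lin_loc | assumption)+)
  finally show ?thesis .
qed

end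

definition counital :: "('c \<Rightarrow> ('h, 'h) tensor) \<Rightarrow> bool" where
  "counital \<alpha> \<longleftrightarrow> (\<forall>c\<in>carrier C.
    tsum H (\<alpha> c) (\<lambda>a b. counit H a \<odot>\<^bsub>H\<^esub> b) = counit C c \<odot>\<^bsub>H\<^esub> \<one>\<^bsub>H\<^esub> \<and>
    tsum H (\<alpha> c) (\<lambda>a b. counit H b \<odot>\<^bsub>H\<^esub> a) = counit C c \<odot>\<^bsub>H\<^esub> \<one>\<^bsub>H\<^esub>)"

context
  fixes \<alpha> :: "'c \<Rightarrow> ('h, 'h) tensor"
  assumes \<alpha>: "linear_map K C HH \<alpha>" and coun: "counital \<alpha>"
begin

lemmas lin_coun = lin_\<alpha>[OF \<alpha>]

lemma counital_left_sum:
  assumes c: "c \<in> carrier C" and U: "module K U" and f: "linear_map K H U f"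
  shows "tsum U (\<alpha> c) (\<lambda>a b. counit H a \<odot>\<^bsub>U\<^esub> f b) = counit C c \<odot>\<^bsub>U\<^esub> f \<one>\<^bsub>H\<^esub>"
proof -
  have "f (tsum H (\<alpha> c) (\<lambda>a b. counit H a \<odot>\<^bsub>H\<^esub> b)) = tsum U (\<alpha> c) (\<lambda>a b. counit H a \<odot>\<^bsub>U\<^esub> f b)"
    by (rule linear_map_of_tsum_eq[OF linear_map_closed[OF \<alpha> c] _ _ f module_C module_C module_C U])
      (simp_all add: linear_map_smult[OF f])
  then show ?thesis using coun c by (simp add: counital_def linear_map_smult[OF f])
qed

lemma counital_right_sum:
  assumes c: "c \<in> carrier C" and U: "module K U" and f: "linear_map K H U f"
  shows "tsum U (\<alpha> c) (\<lambda>a b. counit H b \<odot>\<^bsub>U\<^esub> f a) = counit C c \<odot>\<^bsub>U\<^esub> f \<one>\<^bsub>H\<^esub>"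
proof -
  have "f (tsum H (\<alpha> c) (\<lambda>a b. counit H b \<odot>\<^bsub>H\<^esub> a)) = tsum U (\<alpha> c) (\<lambda>a b. counit H b \<odot>\<^bsub>U\<^esub> f a)"
    by (rule linear_map_of_tsum_eq[OF linear_map_closed[OF \<alpha> c] _ _ f module_C module_C module_C U])
      (simp_all add: linear_map_smult[OF f])
  then show ?thesis using coun c by (simp add: counital_def linear_map_smult[OF f])
qed

lemma smult_smult:
  assumes "module K U" "a \<in> carrier K" "b \<in> carrier K" "x \<in> carrier U"
  shows "(a \<otimes>\<^bsub>K\<^esub> b) \<odot>\<^bsub>U\<^esub> x = b \<odot>\<^bsub>U\<^esub> (a \<odot>\<^bsub>U\<^esub> x)" "(a \<otimes>\<^bsub>K\<^esub> b) \<odot>\<^bsub>U\<^esub> x = a \<odot>\<^bsub>U\<^esub> (b \<odot>\<^bsub>U\<^esub> x)"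
  using assms by (simp_all add: module.smult_assoc1[symmetric] R.m_comm)

context
  assumes inter: "\<And>c. c \<in> carrier C \<Longrightarrow> interleaved_left T \<alpha> ptens4 c = interleaved_right T \<alpha> ptens4 c"
begin

text \<open>
  Apply \<open>\<epsilon>\<close> to the third leg. On the left this turns \<open>\<alpha>(c1)\<close> into \<open>\<epsilon>(c1) 1\<close> and leaves
  \<open>\<alpha>(c2) \<otimes> c1\<close>; on the right it does the same to \<open>\<alpha>(c3)\<close> and leaves \<open>\<alpha>(c1) \<otimes> c2\<close>.
\<close>
lemma interleaved_imp_central: "central \<alpha>"
  unfolding central_def[OF \<alpha>]
proof
  fix c assume c: "c \<in> carrier C"
  let ?P = "\<lambda>x z y. ptensor3 K H H C x z y"
  let ?F = "\<lambda>x y w z. counit H w \<odot>\<^bsub>TC\<^esub> ?P x z y"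
  have U: "module K TC" by (intro tensor_product_module module_C C.module_C)
  note rules = lin_coun U counit_closed C.counit_closed hmult_closed
    module.smult_closed[OF U]
  have "interleaved_left TC \<alpha> ?F c = csum TC c (\<lambda>c1 r. csum TC r (\<lambda>c2 c3.
     tsum TC (\<alpha> c1) (\<lambda>a b. tsum TC (\<alpha> c3) (\<lambda>x y. hsum TC x (\<lambda>x1 x2.
       counit H x2 \<odot>\<^bsub>TC\<^esub> (counit H b \<odot>\<^bsub>TC\<^esub> ?P (a \<cdot> x1) y c2))))))"
    unfolding interleaved_left_def using c
    by (intro C.comult_sum_cong \<alpha>_sum_cong[OF \<alpha>] comult_sum_cong)
      (simp_all add: counit_mult smult_smult(1)[OF U] ptensor_closed)
  also have "\<dots> = csum TC c (\<lambda>c1 r. csum TC r (\<lambda>c2 c3.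
     tsum TC (\<alpha> c1) (\<lambda>a b. tsum TC (\<alpha> c3) (\<lambda>x y. counit H b \<odot>\<^bsub>TC\<^esub> ?P (a \<cdot> x) y c2))))"
  proof (intro C.comult_sum_cong \<alpha>_sum_cong[OF \<alpha>] c)
    fix c1 r c2 c3 a b x y
    assume "c2 \<in> carrier C" "a \<in> carrier H" "b \<in> carrier H" "x \<in> carrier H" "y \<in> carrier H"
    then show "hsum TC x (\<lambda>x1 x2. counit H x2 \<odot>\<^bsub>TC\<^esub> (counit H b \<odot>\<^bsub>TC\<^esub> ?P (a \<cdot> x1) y c2)) =
      counit H b \<odot>\<^bsub>TC\<^esub> ?P (a \<cdot> x) y c2"
      by - (rule counit_right_sum[where f = "\<lambda>x1. counit H b \<odot>\<^bsub>TC\<^esub> ?P (a \<cdot> x1) y c2"],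
        (rule rules | assumption)+)
  qed
  also have "\<dots> = csum TC c (\<lambda>c1 r. csum TC r (\<lambda>c2 c3.
     tsum TC (\<alpha> c3) (\<lambda>x y. tsum TC (\<alpha> c1) (\<lambda>a b. counit H b \<odot>\<^bsub>TC\<^esub> ?P (a \<cdot> x) y c2))))"
    using c by - (rule C.comult_sum_cong, assumption, rule C.comult_sum_cong, assumption, rule \<alpha>_sum_swap[OF \<alpha>],
      (rule rules | assumption)+)
  also have "\<dots> = csum TC c (\<lambda>c1 r. csum TC r (\<lambda>c2 c3.
     tsum TC (\<alpha> c3) (\<lambda>x y. counit C c1 \<odot>\<^bsub>TC\<^esub> ?P (\<one>\<^bsub>H\<^esub> \<cdot> x) y c2)))"
  proof (intro C.comult_sum_cong \<alpha>_sum_cong[OF \<alpha>] c)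
    fix c1 r c2 c3 x y
    assume "c1 \<in> carrier C" "c2 \<in> carrier C" "x \<in> carrier H" "y \<in> carrier H"
    then show "tsum TC (\<alpha> c1) (\<lambda>a b. counit H b \<odot>\<^bsub>TC\<^esub> ?P (a \<cdot> x) y c2) = counit C c1 \<odot>\<^bsub>TC\<^esub> ?P (\<one>\<^bsub>H\<^esub> \<cdot> x) y c2"
      by - (rule counital_right_sum[where f = "\<lambda>a. ?P (a \<cdot> x) y c2"], (rule rules | assumption)+)
  qed
  also have "\<dots> = csum TC c (\<lambda>c1 r. counit C c1 \<odot>\<^bsub>TC\<^esub> csum TC r (\<lambda>c2 c3.
     tsum TC (\<alpha> c3) (\<lambda>x y. ?P (\<one>\<^bsub>H\<^esub> \<cdot> x) y c2)))"
  proof (rule C.comult_sum_cong[OF c], rule HOL.sym)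
    fix c1 r assume "c1 \<in> carrier C" "r \<in> carrier C"
    then show "counit C c1 \<odot>\<^bsub>TC\<^esub> csum TC r (\<lambda>c2 c3.
     tsum TC (\<alpha> c3) (\<lambda>x y. ?P (\<one>\<^bsub>H\<^esub> \<cdot> x) y c2)) = csum TC r (\<lambda>c2 c3.
     tsum TC (\<alpha> c3) (\<lambda>x y. counit C c1 \<odot>\<^bsub>TC\<^esub> ?P (\<one>\<^bsub>H\<^esub> \<cdot> x) y c2))"
      by - (rule linear_map_of_tsum_eq[where \<phi> = "\<lambda>z. counit C c1 \<odot>\<^bsub>TC\<^esub> z"] HOL.refl rules hone_closed | assumption)+
  qed
  also have "\<dots> = csum TC c (\<lambda>c2 c3. tsum TC (\<alpha> c3) (\<lambda>x y. ?P (\<one>\<^bsub>H\<^esub> \<cdot> x) y c2))"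
    using c by - (rule C.counit_left_sum[where f = "\<lambda>r. csum TC r (\<lambda>c2 c3.
     tsum TC (\<alpha> c3) (\<lambda>x y. ?P (\<one>\<^bsub>H\<^esub> \<cdot> x) y c2))"], (rule rules hone_closed | assumption)+)
  also have "\<dots> = csum TC c (\<lambda>c2 c3. tsum TC (\<alpha> c3) (\<lambda>x y. ?P x y c2))"
    using c by (intro C.comult_sum_cong \<alpha>_sum_cong[OF \<alpha>]) simp_all
  finally have left: "interleaved_left TC \<alpha> ?F c = csum TC c (\<lambda>c1 c2. tsum TC (\<alpha> c2) (\<lambda>a b. ?P a b c1))" .
  have "interleaved_right TC \<alpha> ?F c = csum TC c (\<lambda>c1 r. csum TC r (\<lambda>c2 c3.
     tsum TC (\<alpha> c1) (\<lambda>a b. tsum TC (\<alpha> c3) (\<lambda>x y. hsum TC b (\<lambda>b1 b2.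
       counit H b1 \<odot>\<^bsub>TC\<^esub> (counit H x \<odot>\<^bsub>TC\<^esub> ?P a (y \<cdot> b2) c2))))))"
    unfolding interleaved_right_def using c
    by (intro C.comult_sum_cong \<alpha>_sum_cong[OF \<alpha>] comult_sum_cong)
      (simp_all add: counit_mult smult_smult(1)[OF U] ptensor_closed)
  also have "\<dots> = csum TC c (\<lambda>c1 r. csum TC r (\<lambda>c2 c3.
     tsum TC (\<alpha> c1) (\<lambda>a b. tsum TC (\<alpha> c3) (\<lambda>x y. counit H x \<odot>\<^bsub>TC\<^esub> ?P a (y \<cdot> b) c2))))"
  proof (intro C.comult_sum_cong \<alpha>_sum_cong[OF \<alpha>] c)
    fix c1 r c2 c3 a b x y
    assume "c2 \<in> carrier C" "a \<in> carrier H" "b \<in> carrier H" "x \<in> carrier H" "y \<in> carrier H"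
    then show "hsum TC b (\<lambda>b1 b2. counit H b1 \<odot>\<^bsub>TC\<^esub> (counit H x \<odot>\<^bsub>TC\<^esub> ?P a (y \<cdot> b2) c2)) =
      counit H x \<odot>\<^bsub>TC\<^esub> ?P a (y \<cdot> b) c2"
      by - (rule counit_left_sum[where f = "\<lambda>b2. counit H x \<odot>\<^bsub>TC\<^esub> ?P a (y \<cdot> b2) c2"],
        (rule rules | assumption)+)
  qed
  also have "\<dots> = csum TC c (\<lambda>c1 r. csum TC r (\<lambda>c2 c3.
     tsum TC (\<alpha> c1) (\<lambda>a b. counit C c3 \<odot>\<^bsub>TC\<^esub> ?P a (\<one>\<^bsub>H\<^esub> \<cdot> b) c2)))"
  proof (intro C.comult_sum_cong \<alpha>_sum_cong[OF \<alpha>] c)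
    fix c1 r c2 c3 a b
    assume "c3 \<in> carrier C" "c2 \<in> carrier C" "a \<in> carrier H" "b \<in> carrier H"
    then show "tsum TC (\<alpha> c3) (\<lambda>x y. counit H x \<odot>\<^bsub>TC\<^esub> ?P a (y \<cdot> b) c2) = counit C c3 \<odot>\<^bsub>TC\<^esub> ?P a (\<one>\<^bsub>H\<^esub> \<cdot> b) c2"
      by - (rule counital_left_sum[where f = "\<lambda>y. ?P a (y \<cdot> b) c2"], (rule rules | assumption)+)
  qed
  also have "\<dots> = csum TC c (\<lambda>c1 r. csum TC r (\<lambda>c2 c3.
     counit C c3 \<odot>\<^bsub>TC\<^esub> tsum TC (\<alpha> c1) (\<lambda>a b. ?P a (\<one>\<^bsub>H\<^esub> \<cdot> b) c2)))"
  proof (rule C.comult_sum_cong[OF c], rule C.comult_sum_cong, assumption, rule HOL.sym)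
    fix c1 r c2 c3 assume "c1 \<in> carrier C" "c2 \<in> carrier C" "c3 \<in> carrier C"
    then show "counit C c3 \<odot>\<^bsub>TC\<^esub> tsum TC (\<alpha> c1) (\<lambda>a b. ?P a (\<one>\<^bsub>H\<^esub> \<cdot> b) c2) =
      tsum TC (\<alpha> c1) (\<lambda>a b. counit C c3 \<odot>\<^bsub>TC\<^esub> ?P a (\<one>\<^bsub>H\<^esub> \<cdot> b) c2)"
      by - (rule linear_map_of_tsum_eq[where \<phi> = "\<lambda>z. counit C c3 \<odot>\<^bsub>TC\<^esub> z"] HOL.refl rules hone_closed | assumption)+
  qed
  also have "\<dots> = csum TC c (\<lambda>c1 c2. tsum TC (\<alpha> c1) (\<lambda>a b. ?P a (\<one>\<^bsub>H\<^esub> \<cdot> b) c2))"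
  proof (intro C.comult_sum_cong c)
    fix c1 r assume "c1 \<in> carrier C" "r \<in> carrier C"
    then show "csum TC r (\<lambda>c2 c3.
       counit C c3 \<odot>\<^bsub>TC\<^esub> tsum TC (\<alpha> c1) (\<lambda>a b. ?P a (\<one>\<^bsub>H\<^esub> \<cdot> b) c2)) =
      tsum TC (\<alpha> c1) (\<lambda>a b. ?P a (\<one>\<^bsub>H\<^esub> \<cdot> b) r)"
      by - (rule C.counit_right_sum[where f = "\<lambda>c2. tsum TC (\<alpha> c1) (\<lambda>a b. ?P a (\<one>\<^bsub>H\<^esub> \<cdot> b) c2)"],
        (rule rules hone_closed | assumption)+)
  qed
  also have "\<dots> = csum TC c (\<lambda>c1 c2. tsum TC (\<alpha> c1) (\<lambda>a b. ?P a b c2))"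
    using c by (intro C.comult_sum_cong \<alpha>_sum_cong[OF \<alpha>]) simp_all
  finally have right: "interleaved_right TC \<alpha> ?F c = csum TC c (\<lambda>c1 c2. tsum TC (\<alpha> c1) (\<lambda>a b. ?P a b c2))" .
  have "interleaved_left TC \<alpha> ?F c = interleaved_right TC \<alpha> ?F c"
    by (rule interleaved_lift[OF \<alpha> inter[OF c] c U]) (rule rules | assumption)+
  then show "csum TC c (\<lambda>c1 c2. tsum TC (\<alpha> c2) (\<lambda>a b. ?P a b c1)) =
    csum TC c (\<lambda>c1 c2. tsum TC (\<alpha> c1) (\<lambda>a b. ?P a b c2))"
    by (simp only: left right)
qed

text \<open>
  Apply \<open>\<epsilon>\<close> to the factor \<open>c2\<close>. The left-hand side becomes one side of the Harrison identity; the
  right-hand side becomes the other one with \<open>c1\<close> and \<open>c2\<close> interchanged, which centrality corrects.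
\<close>
lemma interleaved_imp_harrison: "harrison_identity \<alpha>"
  unfolding harrison_identity_def[OF \<alpha>]
proof
  fix c assume c: "c \<in> carrier C"
  let ?P = "\<lambda>x w z. ptensor3 K H H H x w z"
  let ?F = "\<lambda>x y w z. counit C y \<odot>\<^bsub>T3\<^esub> ?P x w z"
  have U: "module K T3" by (intro tensor_product_module module_C)
  note rules = lin_coun U counit_closed C.counit_closed hmult_closed
    module.smult_closed[OF U]
  have "interleaved_left T3 \<alpha> ?F c = csum T3 c (\<lambda>c1 r. csum T3 r (\<lambda>c2 c3.
     counit C c2 \<odot>\<^bsub>T3\<^esub> tsum T3 (\<alpha> c1) (\<lambda>a b. tsum T3 (\<alpha> c3) (\<lambda>x y. hsum T3 x (\<lambda>x1 x2.
       ?P (a \<cdot> x1) (b \<cdot> x2) y)))))"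
    unfolding interleaved_left_def
  proof (rule C.comult_sum_cong[OF c], rule C.comult_sum_cong, assumption, rule HOL.sym)
    fix c1 r c2 c3 assume "c1 \<in> carrier C" "c2 \<in> carrier C" "c3 \<in> carrier C"
    then show "counit C c2 \<odot>\<^bsub>T3\<^esub> tsum T3 (\<alpha> c1) (\<lambda>a b. tsum T3 (\<alpha> c3) (\<lambda>x y. hsum T3 x (\<lambda>x1 x2.
       ?P (a \<cdot> x1) (b \<cdot> x2) y))) = tsum T3 (\<alpha> c1) (\<lambda>a b. tsum T3 (\<alpha> c3) (\<lambda>x y. hsum T3 x (\<lambda>x1 x2.
       ?F (a \<cdot> x1) c2 (b \<cdot> x2) y)))"
      by - (rule linear_map_of_tsum_eq[where \<phi> = "\<lambda>z. counit C c2 \<odot>\<^bsub>T3\<^esub> z"] HOL.refl rules | assumption)+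
  qed
  also have "\<dots> = csum T3 c (\<lambda>c1 c2. tsum T3 (\<alpha> c1) (\<lambda>a b. tsum T3 (\<alpha> c2) (\<lambda>x y.
      hsum T3 x (\<lambda>x1 x2. ?P (a \<cdot> x1) (b \<cdot> x2) y))))"
  proof (intro C.comult_sum_cong c)
    fix c1 r assume "c1 \<in> carrier C" "r \<in> carrier C"
    then show "csum T3 r (\<lambda>c2 c3.
       counit C c2 \<odot>\<^bsub>T3\<^esub> tsum T3 (\<alpha> c1) (\<lambda>a b. tsum T3 (\<alpha> c3) (\<lambda>x y. hsum T3 x (\<lambda>x1 x2.
       ?P (a \<cdot> x1) (b \<cdot> x2) y)))) = tsum T3 (\<alpha> c1) (\<lambda>a b. tsum T3 (\<alpha> r) (\<lambda>x y. hsum T3 x (\<lambda>x1 x2.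
       ?P (a \<cdot> x1) (b \<cdot> x2) y)))"
      by - (rule C.counit_left_sum[where f = "\<lambda>c3. tsum T3 (\<alpha> c1) (\<lambda>a b. tsum T3 (\<alpha> c3) (\<lambda>x y.
         hsum T3 x (\<lambda>x1 x2. ?P (a \<cdot> x1) (b \<cdot> x2) y)))"], (rule rules | assumption)+)
  qed
  finally have left: "interleaved_left T3 \<alpha> ?F c = \<dots>" .
  have "interleaved_right T3 \<alpha> ?F c = csum T3 c (\<lambda>c1 r. csum T3 r (\<lambda>c2 c3.
     counit C c2 \<odot>\<^bsub>T3\<^esub> tsum T3 (\<alpha> c1) (\<lambda>a b. tsum T3 (\<alpha> c3) (\<lambda>x y. hsum T3 b (\<lambda>b1 b2.
       ?P a (x \<cdot> b1) (y \<cdot> b2))))))"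
    unfolding interleaved_right_def
  proof (rule C.comult_sum_cong[OF c], rule C.comult_sum_cong, assumption, rule HOL.sym)
    fix c1 r c2 c3 assume "c1 \<in> carrier C" "c2 \<in> carrier C" "c3 \<in> carrier C"
    then show "counit C c2 \<odot>\<^bsub>T3\<^esub> tsum T3 (\<alpha> c1) (\<lambda>a b. tsum T3 (\<alpha> c3) (\<lambda>x y. hsum T3 b (\<lambda>b1 b2.
       ?P a (x \<cdot> b1) (y \<cdot> b2)))) = tsum T3 (\<alpha> c1) (\<lambda>a b. tsum T3 (\<alpha> c3) (\<lambda>x y. hsum T3 b (\<lambda>b1 b2.
       ?F a c2 (x \<cdot> b1) (y \<cdot> b2))))"
      by - (rule linear_map_of_tsum_eq[where \<phi> = "\<lambda>z. counit C c2 \<odot>\<^bsub>T3\<^esub> z"] HOL.refl rules | assumption)+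
  qed
  also have "\<dots> = csum T3 c (\<lambda>c1 c2. tsum T3 (\<alpha> c1) (\<lambda>a b. tsum T3 (\<alpha> c2) (\<lambda>x y.
      hsum T3 b (\<lambda>b1 b2. ?P a (x \<cdot> b1) (y \<cdot> b2)))))"
  proof (intro C.comult_sum_cong c)
    fix c1 r assume "c1 \<in> carrier C" "r \<in> carrier C"
    then show "csum T3 r (\<lambda>c2 c3.
       counit C c2 \<odot>\<^bsub>T3\<^esub> tsum T3 (\<alpha> c1) (\<lambda>a b. tsum T3 (\<alpha> c3) (\<lambda>x y. hsum T3 b (\<lambda>b1 b2.
       ?P a (x \<cdot> b1) (y \<cdot> b2))))) = tsum T3 (\<alpha> c1) (\<lambda>a b. tsum T3 (\<alpha> r) (\<lambda>x y. hsum T3 b (\<lambda>b1 b2.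
       ?P a (x \<cdot> b1) (y \<cdot> b2))))"
      by - (rule C.counit_left_sum[where f = "\<lambda>c3. tsum T3 (\<alpha> c1) (\<lambda>a b. tsum T3 (\<alpha> c3) (\<lambda>x y.
         hsum T3 b (\<lambda>b1 b2. ?P a (x \<cdot> b1) (y \<cdot> b2))))"], (rule rules | assumption)+)
  qed
  also have "\<dots> = csum T3 c (\<lambda>c1 c2. tsum T3 (\<alpha> c2) (\<lambda>a b. tsum T3 (\<alpha> c1) (\<lambda>x y.
      hsum T3 b (\<lambda>b1 b2. ?P a (x \<cdot> b1) (y \<cdot> b2)))))"
    using c by - (rule central_sum[OF \<alpha> interleaved_imp_central, symmetric], (rule rules | assumption)+)
  also have "\<dots> = csum T3 c (\<lambda>c1 c2. tsum T3 (\<alpha> c1) (\<lambda>x y. tsum T3 (\<alpha> c2) (\<lambda>a b.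
      hsum T3 b (\<lambda>b1 b2. ?P a (x \<cdot> b1) (y \<cdot> b2)))))"
    using c by - (rule C.comult_sum_cong, assumption, rule \<alpha>_sum_swap[OF \<alpha>], (rule rules | assumption)+)
  finally have right: "interleaved_right T3 \<alpha> ?F c = \<dots>" .
  have "interleaved_left T3 \<alpha> ?F c = interleaved_right T3 \<alpha> ?F c"
    by (rule interleaved_lift[OF \<alpha> inter[OF c] c U]) (rule rules | assumption)+
  then show "csum T3 c (\<lambda>c1 c2. tsum T3 (\<alpha> c1) (\<lambda>a b. tsum T3 (\<alpha> c2) (\<lambda>x y.
      hsum T3 y (\<lambda>y1 y2. ptensor3 K H H H x (a \<cdot> y1) (b \<cdot> y2))))) =
    csum T3 c (\<lambda>c1 c2. tsum T3 (\<alpha> c1) (\<lambda>a b. tsum T3 (\<alpha> c2) (\<lambda>x y.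
      hsum T3 x (\<lambda>x1 x2. ptensor3 K H H H (a \<cdot> x1) (b \<cdot> x2) y))))"
    by (simp only: left right)
qed

end

lemma counital_twisted_ad:
  assumes c: "c \<in> carrier C" and h: "h \<in> carrier H"
  shows "tsum H (twisted_ad h (\<alpha> c)) (\<lambda>a b. counit H a \<odot>\<^bsub>H\<^esub> b) = (counit C c \<otimes>\<^bsub>K\<^esub> counit H h) \<odot>\<^bsub>H\<^esub> \<one>\<^bsub>H\<^esub>" (is ?A)
    and "tsum H (twisted_ad h (\<alpha> c)) (\<lambda>a b. counit H b \<odot>\<^bsub>H\<^esub> a) = (counit C c \<otimes>\<^bsub>K\<^esub> counit H h) \<odot>\<^bsub>H\<^esub> \<one>\<^bsub>H\<^esub>" (is ?B)
proof -
  note rules = linear_counit lin_coun counit_closed C.counit_closed ad_left_closed ad_right_closed hone_closed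
    module.smult_closed[OF module_C]
  have "tsum H (twisted_ad h (\<alpha> c)) (\<lambda>a b. counit H a \<odot>\<^bsub>H\<^esub> b) =
    hsum H h (\<lambda>p q. tsum H (\<alpha> c) (\<lambda>a b. counit H (ad_left p a) \<odot>\<^bsub>H\<^esub> ad_right q b))"
    using c h by - (rule twisted_ad_sum, (rule rules | assumption)+)
  also have "\<dots> = hsum H h (\<lambda>p q. tsum H (\<alpha> c) (\<lambda>a b. counit H a \<odot>\<^bsub>H\<^esub> (counit H p \<odot>\<^bsub>H\<^esub> ad_right q b)))"
    using c h by (intro comult_sum_cong \<alpha>_sum_cong[OF \<alpha>]) (simp_all add: counit_ad_left smult_smult(1)[OF module_C])
  also have "\<dots> = hsum H h (\<lambda>p q. counit C c \<odot>\<^bsub>H\<^esub> (counit H p \<odot>\<^bsub>H\<^esub> ad_right q \<one>\<^bsub>H\<^esub>))"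
  proof (intro comult_sum_cong h)
    fix p q assume "p \<in> carrier H" "q \<in> carrier H"
    then show "tsum H (\<alpha> c) (\<lambda>a b. counit H a \<odot>\<^bsub>H\<^esub> (counit H p \<odot>\<^bsub>H\<^esub> ad_right q b)) =
      counit C c \<odot>\<^bsub>H\<^esub> (counit H p \<odot>\<^bsub>H\<^esub> ad_right q \<one>\<^bsub>H\<^esub>)"
      using c by - (rule counital_left_sum[where f = "\<lambda>b. counit H p \<odot>\<^bsub>H\<^esub> ad_right q b"], (rule rules | assumption)+)
  qed
  also have "\<dots> = hsum H h (\<lambda>p q. counit H p \<odot>\<^bsub>H\<^esub> (counit C c \<odot>\<^bsub>H\<^esub> ad_right q \<one>\<^bsub>H\<^esub>))"
    using c h by (intro comult_sum_cong) (simp_all add: smult_smult[OF module_C, symmetric] R.m_comm)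
  also have "\<dots> = counit C c \<odot>\<^bsub>H\<^esub> ad_right h \<one>\<^bsub>H\<^esub>"
    using c h by - (rule counit_left_sum[where f = "\<lambda>q. counit C c \<odot>\<^bsub>H\<^esub> ad_right q \<one>\<^bsub>H\<^esub>"], (rule rules | assumption)+)
  finally show ?A using c h by (simp add: ad_right_one smult_smult(2)[OF module_C])
  have "tsum H (twisted_ad h (\<alpha> c)) (\<lambda>a b. counit H b \<odot>\<^bsub>H\<^esub> a) =
    hsum H h (\<lambda>p q. tsum H (\<alpha> c) (\<lambda>a b. counit H (ad_right q b) \<odot>\<^bsub>H\<^esub> ad_left p a))"
    using c h by - (rule twisted_ad_sum, (rule rules | assumption)+)
  also have "\<dots> = hsum H h (\<lambda>p q. tsum H (\<alpha> c) (\<lambda>a b. counit H b \<odot>\<^bsub>H\<^esub> (counit H q \<odot>\<^bsub>H\<^esub> ad_left p a)))"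
    using c h by (intro comult_sum_cong \<alpha>_sum_cong[OF \<alpha>]) (simp_all add: counit_ad_right smult_smult(1)[OF module_C])
  also have "\<dots> = hsum H h (\<lambda>p q. counit C c \<odot>\<^bsub>H\<^esub> (counit H q \<odot>\<^bsub>H\<^esub> ad_left p \<one>\<^bsub>H\<^esub>))"
  proof (intro comult_sum_cong h)
    fix p q assume "p \<in> carrier H" "q \<in> carrier H"
    then show "tsum H (\<alpha> c) (\<lambda>a b. counit H b \<odot>\<^bsub>H\<^esub> (counit H q \<odot>\<^bsub>H\<^esub> ad_left p a)) =
      counit C c \<odot>\<^bsub>H\<^esub> (counit H q \<odot>\<^bsub>H\<^esub> ad_left p \<one>\<^bsub>H\<^esub>)"
      using c by - (rule counital_right_sum[where f = "\<lambda>a. counit H q \<odot>\<^bsub>H\<^esub> ad_left p a"], (rule rules | assumption)+)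
  qed
  also have "\<dots> = hsum H h (\<lambda>p q. counit H q \<odot>\<^bsub>H\<^esub> (counit C c \<odot>\<^bsub>H\<^esub> ad_left p \<one>\<^bsub>H\<^esub>))"
    using c h by (intro comult_sum_cong) (simp_all add: smult_smult[OF module_C, symmetric] R.m_comm)
  also have "\<dots> = counit C c \<odot>\<^bsub>H\<^esub> ad_left h \<one>\<^bsub>H\<^esub>"
    using c h by - (rule counit_right_sum[where f = "\<lambda>p. counit C c \<odot>\<^bsub>H\<^esub> ad_left p \<one>\<^bsub>H\<^esub>"], (rule rules | assumption)+)
  finally show ?B using c h by (simp add: ad_left_one smult_smult(2)[OF module_C])
qed

end

section \<open>The bijection\<close>

lemma harrison_cocycles_iff:
  "\<alpha> \<in> harrison_cocycles K H C \<longleftrightarrow> \<alpha> \<in> extensional (carrier C) \<and>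
    linear_map K C HH \<alpha> \<and> counital \<alpha> \<and> harrison_identity \<alpha> \<and> central \<alpha>"
  by (auto simp: harrison_cocycles_def Let_def counital_def harrison_identity_def central_def)

lemma twisted_cocycles_iff:
  "\<beta> \<in> twisted_cocycles K H D ract \<longleftrightarrow> \<beta> \<in> extensional (carrier CH) \<and> linear_map K CH HH \<beta> \<and>
    (\<forall>d\<in>carrier CH. tsum H (\<beta> d) (\<lambda>a b. counit H b \<odot>\<^bsub>H\<^esub> a) = counit D d \<odot>\<^bsub>H\<^esub> \<one>\<^bsub>H\<^esub> \<and>
      tsum H (\<beta> d) (\<lambda>a b. counit H a \<odot>\<^bsub>H\<^esub> b) = counit D d \<odot>\<^bsub>H\<^esub> \<one>\<^bsub>H\<^esub>) \<and>
    (\<forall>d\<in>carrier CH. \<forall>h\<in>carrier H. \<beta> (ract d h) = twisted_ad h (\<beta> d)) \<and>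
    (\<forall>d\<in>carrier CH. twisted_identity \<beta> d)"
proof -
  have "twisted_ad h (\<beta> d) = hsum HH h (\<lambda>h1 r. hsum HH r (\<lambda>h2 s. hsum HH s (\<lambda>h3 h4.
      tsum HH (\<beta> d) (\<lambda>a b. ptensor K H H (S h1 \<cdot> a \<cdot> h2) (S' h4 \<cdot> b \<cdot> h3)))))"
    if "linear_map K CH HH \<beta>" "d \<in> carrier CH" "h \<in> carrier H" for d h
    using twisted_ad_expand[OF that(3) linear_map_closed[OF that(1,2)]] by simp
  then show ?thesis
    unfolding twisted_cocycles_def Let_def linear_map_from_D D_fields mem_Collect_eq twisted_identity_def
    by (auto simp del: D_fields)
qed

context
  fixes \<alpha> :: "'c \<Rightarrow> ('h, 'h) tensor" and \<beta> :: "('c, 'h) tensor \<Rightarrow> ('h, 'h) tensor"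
  assumes \<alpha>: "linear_map K C HH \<alpha>" and \<beta>: "linear_map K CH HH \<beta>"
    and pure: "\<And>c h. c \<in> carrier C \<Longrightarrow> h \<in> carrier H \<Longrightarrow> \<beta> (ptensor K C H c h) = twisted_ad h (\<alpha> c)"
begin

lemmas lin_\<alpha>\<beta> = linear_map_comp[OF _ \<beta>] linear_map_closed[OF \<beta>] lin_\<alpha>[OF \<alpha>]

lemma twisted_if_harrison:
  assumes harr: "\<alpha> \<in> harrison_cocycles K H C" and ext: "\<beta> \<in> extensional (carrier CH)"
  shows "\<beta> \<in> twisted_cocycles K H D ract"
proof -
  have coun: "counital \<alpha>" and heq: "harrison_identity \<alpha>" and cen: "central \<alpha>"
    using harr by (auto simp: harrison_cocycles_iff)
  have U: "module K T" by (intro tensor_product_module module_C module_D)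
  have counit_left: "tsum H (\<beta> d) (\<lambda>a b. counit H a \<odot>\<^bsub>H\<^esub> b) = counit D d \<odot>\<^bsub>H\<^esub> \<one>\<^bsub>H\<^esub>"
    if d: "d \<in> carrier CH" for d
    by (rule tensor_linear_map_eqI[OF _ _ _ d C.module_C module_C module_C])
      (rule linear_counit lin_\<alpha>\<beta> counit_closed hone_closed | assumption
        | simp add: pure counital_twisted_ad[OF \<alpha> coun] counit_D_pure)+
  have counit_right: "tsum H (\<beta> d) (\<lambda>a b. counit H b \<odot>\<^bsub>H\<^esub> a) = counit D d \<odot>\<^bsub>H\<^esub> \<one>\<^bsub>H\<^esub>"
    if d: "d \<in> carrier CH" for d
    by (rule tensor_linear_map_eqI[OF _ _ _ d C.module_C module_C module_C])
      (rule linear_counit lin_\<alpha>\<beta> counit_closed hone_closed | assumption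
        | simp add: pure counital_twisted_ad[OF \<alpha> coun] counit_D_pure)+
  have equivariant: "\<beta> (ract d h) = twisted_ad h (\<beta> d)" if d: "d \<in> carrier CH" and h: "h \<in> carrier H" for d h
  proof (rule tensor_linear_map_eqI[OF _ _ _ d C.module_C module_C module_CC])
    show "linear_map K CH HH (\<lambda>d. \<beta> (ract d h))" "linear_map K CH HH (\<lambda>d. twisted_ad h (\<beta> d))"
      using h by - (rule lin_\<alpha>\<beta> | assumption)+
    fix c g assume "c \<in> carrier C" "g \<in> carrier H"
    then show "\<beta> (ract (ptensor K C H c g) h) = twisted_ad h (\<beta> (ptensor K C H c g))"
      using h by (simp add: ract_pure pure twisted_ad_hmult linear_map_closed[OF \<alpha>])
  qed
  have "twisted_identity \<beta> d" if d: "d \<in> carrier CH" for d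
    unfolding twisted_identity_def
  proof (rule tensor_linear_map_eqI[OF _ _ _ d C.module_C module_C U])
    fix c h assume ch: "c \<in> carrier C" "h \<in> carrier H"
    let ?\<Phi> = "\<lambda>u c w z. twisted_conj T (\<lambda>u w z. ptens4 u c w z) h u w z"
    have "linear_map K C T (\<lambda>c. ?\<Phi> u c w z)" if "u \<in> carrier H" "w \<in> carrier H" "z \<in> carrier H" for u w z
      unfolding twisted_conj_def using that ch by - (rule lin_\<alpha>\<beta> hmult_closed antipode_closed ad_right_closed | assumption)+
    moreover have "linear_map K H T (\<lambda>u. ?\<Phi> u c w z)" if "c \<in> carrier C" "w \<in> carrier H" "z \<in> carrier H" for c w z
      unfolding twisted_conj_def using that ch by - (rule lin_\<alpha>\<beta> hmult_closed antipode_closed ad_right_closed | assumption)+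
    moreover have "linear_map K H T (\<lambda>w. ?\<Phi> u c w z)" if "c \<in> carrier C" "u \<in> carrier H" "z \<in> carrier H" for u c z
      unfolding twisted_conj_def using that ch by - (rule lin_\<alpha>\<beta> hmult_closed antipode_closed ad_right_closed | assumption)+
    moreover have "linear_map K H T (\<lambda>z. ?\<Phi> u c w z)" if "c \<in> carrier C" "u \<in> carrier H" "w \<in> carrier H" for u c w
      unfolding twisted_conj_def using that ch by - (rule lin_\<alpha>\<beta> hmult_closed antipode_closed ad_right_closed | assumption)+
    ultimately have "interleaved_left T \<alpha> ?\<Phi> c = interleaved_right T \<alpha> ?\<Phi> c"
      by (intro harrison_imp_interleaved[OF \<alpha> cen heq ch(1) U])
    then have "twisted_identity \<beta> (ptensor K C H c h)"
      by (intro iffD2[OF twisted_identity_pure[OF \<alpha> \<beta>]]) (simp_all add: pure ch)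
    then show "tsum T (comult D (ptensor K C H c h)) (\<lambda>d1 r. tsum T (comult D r) (\<lambda>d2 d3.
      tsum T (\<beta> d1) (\<lambda>a b. tsum T (\<beta> d3) (\<lambda>x y. hsum T x (\<lambda>x1 x2.
        ptensor3 K H D H (a \<cdot> x1) (ract d2 (b \<cdot> x2)) y))))) =
    tsum T (comult D (ptensor K C H c h)) (\<lambda>d1 r. tsum T (comult D r) (\<lambda>d2 d3.
      tsum T (\<beta> d1) (\<lambda>a b. tsum T (\<beta> d3) (\<lambda>x y. hsum T b (\<lambda>b1 b2.
        ptensor3 K H D H a (ract d2 (x \<cdot> b1)) (y \<cdot> b2))))))"
      unfolding twisted_identity_def .
  qed (rule lin_\<alpha>\<beta> hmult_closed | assumption | simp)+
  then show ?thesis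
    unfolding twisted_cocycles_iff using ext \<beta> counit_left counit_right equivariant by blast
qed

text \<open>
  It suffices to evaluate the conditions on \<open>\<beta>\<close> at \<open>c \<otimes> 1\<close>, where \<open>twisted_conj\<close> is trivial.
\<close>
lemma harrison_if_twisted:
  assumes tw: "\<beta> \<in> twisted_cocycles K H D ract" and ext: "\<alpha> \<in> extensional (carrier C)"
  shows "\<alpha> \<in> harrison_cocycles K H C"
proof -
  have one: "\<beta> (ptensor K C H c \<one>\<^bsub>H\<^esub>) = \<alpha> c" "ptensor K C H c \<one>\<^bsub>H\<^esub> \<in> carrier CH" if "c \<in> carrier C" for c
    using that by (simp_all add: pure twisted_ad_one linear_map_closed[OF \<alpha>] ptensor_closed)
  have U: "module K T" by (intro tensor_product_module module_C module_D)
  have coun: "counital \<alpha>"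
    unfolding counital_def
  proof
    fix c assume c: "c \<in> carrier C"
    have "counit D (ptensor K C H c \<one>\<^bsub>H\<^esub>) = counit C c"
      using c by (simp add: counit_D_pure counit_one)
    then show "tsum H (\<alpha> c) (\<lambda>a b. counit H a \<odot>\<^bsub>H\<^esub> b) = counit C c \<odot>\<^bsub>H\<^esub> \<one>\<^bsub>H\<^esub> \<and>
      tsum H (\<alpha> c) (\<lambda>a b. counit H b \<odot>\<^bsub>H\<^esub> a) = counit C c \<odot>\<^bsub>H\<^esub> \<one>\<^bsub>H\<^esub>"
      using tw one[OF c] unfolding twisted_cocycles_iff by metis
  qed
  have inter: "interleaved_left T \<alpha> ptens4 c = interleaved_right T \<alpha> ptens4 c" if c: "c \<in> carrier C" for c
  proof -
    let ?\<Phi> = "\<lambda>u c w z. twisted_conj T (\<lambda>u w z. ptens4 u c w z) \<one>\<^bsub>H\<^esub> u w z"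
    have eq: "?\<Phi> u c w z = ptens4 u c w z"
      if "u \<in> carrier H" "c \<in> carrier C" "w \<in> carrier H" "z \<in> carrier H" for u c w z
      using that by - (rule twisted_conj_one[OF U], (rule lin_\<alpha>\<beta> | assumption)+)
    have "twisted_identity \<beta> (ptensor K C H c \<one>\<^bsub>H\<^esub>)"
      using tw one(2)[OF c] unfolding twisted_cocycles_iff by blast
    then have "interleaved_left T \<alpha> ?\<Phi> c = interleaved_right T \<alpha> ?\<Phi> c"
      by (intro iffD1[OF twisted_identity_pure[OF \<alpha> \<beta>]]) (simp_all add: pure c)
    moreover have "interleaved_left T \<alpha> ?\<Phi> c = interleaved_left T \<alpha> ptens4 c"
      unfolding interleaved_left_def using c
      by (intro C.comult_sum_cong \<alpha>_sum_cong[OF \<alpha>] comult_sum_cong) (simp_all add: eq)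
    moreover have "interleaved_right T \<alpha> ?\<Phi> c = interleaved_right T \<alpha> ptens4 c"
      unfolding interleaved_right_def using c
      by (intro C.comult_sum_cong \<alpha>_sum_cong[OF \<alpha>] comult_sum_cong) (simp_all add: eq)
    ultimately show ?thesis by simp
  qed
  show ?thesis
    unfolding harrison_cocycles_iff
    using ext \<alpha> coun interleaved_imp_harrison[OF \<alpha> coun inter] interleaved_imp_central[OF \<alpha> coun inter] by blast
qed

end

definition twist :: "('c \<Rightarrow> ('h, 'h) tensor) \<Rightarrow> ('c, 'h) tensor \<Rightarrow> ('h, 'h) tensor" where
  "twist \<alpha> = restrict (\<lambda>d. tsum HH d (\<lambda>c h. twisted_ad h (\<alpha> c))) (carrier CH)"

definition untwist :: "(('c, 'h) tensor \<Rightarrow> ('h, 'h) tensor) \<Rightarrow> 'c \<Rightarrow> ('h, 'h) tensor" where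
  "untwist \<beta> = restrict (\<lambda>c. \<beta> (ptensor K C H c \<one>\<^bsub>H\<^esub>)) (carrier C)"

lemma twist_extensional: "twist \<alpha> \<in> extensional (carrier CH)"
  and untwist_extensional: "untwist \<beta> \<in> extensional (carrier C)"
  by (simp_all only: twist_def untwist_def restrict_extensional)

lemma
  assumes \<alpha>: "linear_map K C HH \<alpha>"
  shows linear_twist: "linear_map K CH HH (twist \<alpha>)"
    and twist_pure: "c \<in> carrier C \<Longrightarrow> h \<in> carrier H \<Longrightarrow> twist \<alpha> (ptensor K C H c h) = twisted_ad h (\<alpha> c)"
proof -
  have "linear_map K CH HH (\<lambda>d. tsum HH d (\<lambda>c h. twisted_ad h (\<alpha> c)))"
    by (rule lin_\<alpha>[OF \<alpha>] | assumption)+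
  then show "linear_map K CH HH (twist \<alpha>)"
    unfolding twist_def by (rule linear_map_cong[OF module_CH]) simp
  assume c: "c \<in> carrier C" and h: "h \<in> carrier H"
  have "tsum HH (ptensor K C H c h) (\<lambda>c h. twisted_ad h (\<alpha> c)) = twisted_ad h (\<alpha> c)"
    using c h by - (rule tsum_ptensor_eq, (rule lin_\<alpha>[OF \<alpha>] | assumption)+)
  then show "twist \<alpha> (ptensor K C H c h) = twisted_ad h (\<alpha> c)"
    using c h by (simp add: twist_def ptensor_closed)
qed

lemma
  assumes \<beta>: "\<beta> \<in> twisted_cocycles K H D ract"
  shows linear_untwist: "linear_map K C HH (untwist \<beta>)"
    and untwist_pure: "c \<in> carrier C \<Longrightarrow> h \<in> carrier H \<Longrightarrow> \<beta> (ptensor K C H c h) = twisted_ad h (untwist \<beta> c)"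
proof -
  have lin: "linear_map K CH HH \<beta>" using \<beta> by (simp add: twisted_cocycles_iff)
  have "linear_map K C HH (\<lambda>c. \<beta> (ptensor K C H c \<one>\<^bsub>H\<^esub>))"
    by (rule linear_map_comp[OF _ lin]) (rule lin_act hone_closed)+
  then show "linear_map K C HH (untwist \<beta>)"
    unfolding untwist_def by (rule linear_map_cong[OF C.module_C]) simp
  assume c: "c \<in> carrier C" and h: "h \<in> carrier H"
  have "\<beta> (ptensor K C H c h) = \<beta> (ract (ptensor K C H c \<one>\<^bsub>H\<^esub>) h)"
    using c h by (simp add: ract_pure)
  also have "\<dots> = twisted_ad h (\<beta> (ptensor K C H c \<one>\<^bsub>H\<^esub>))"
    using \<beta> c h by (simp add: twisted_cocycles_iff ptensor_closed)
  finally show "\<beta> (ptensor K C H c h) = twisted_ad h (untwist \<beta> c)"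
    using c by (simp add: untwist_def)
qed

theorem bij_betw_twist:
  "bij_betw twist (harrison_cocycles K H C) (twisted_cocycles K H D ract)"
proof (rule bij_betw_byWitness[where f' = untwist])
  show "twist ` harrison_cocycles K H C \<subseteq> twisted_cocycles K H D ract"
  proof safe
    fix \<alpha> assume harr: "\<alpha> \<in> harrison_cocycles K H C"
    then have \<alpha>: "linear_map K C HH \<alpha>" by (simp add: harrison_cocycles_iff)
    show "twist \<alpha> \<in> twisted_cocycles K H D ract"
      by (rule twisted_if_harrison[OF \<alpha> linear_twist[OF \<alpha>] twist_pure[OF \<alpha>] harr twist_extensional])
  qed
  show "untwist ` twisted_cocycles K H D ract \<subseteq> harrison_cocycles K H C"
  proof safe
    fix \<beta> assume tw: "\<beta> \<in> twisted_cocycles K H D ract"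
    then have \<beta>: "linear_map K CH HH \<beta>" by (simp add: twisted_cocycles_iff)
    show "untwist \<beta> \<in> harrison_cocycles K H C"
      by (rule harrison_if_twisted[OF linear_untwist[OF tw] \<beta> untwist_pure[OF tw] tw untwist_extensional])
  qed
  show "\<forall>\<alpha>\<in>harrison_cocycles K H C. untwist (twist \<alpha>) = \<alpha>"
  proof
    fix \<alpha> assume harr: "\<alpha> \<in> harrison_cocycles K H C"
    then have \<alpha>: "linear_map K C HH \<alpha>" and ext: "\<alpha> \<in> extensional (carrier C)"
      by (simp_all add: harrison_cocycles_iff)
    show "untwist (twist \<alpha>) = \<alpha>"
    proof (rule extensionalityI[OF _ ext])
      fix c assume c: "c \<in> carrier C"
      then show "untwist (twist \<alpha>) c = \<alpha> c"
        by (simp add: untwist_def twist_pure[OF \<alpha>] twisted_ad_one linear_map_closed[OF \<alpha>])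
    qed (rule untwist_extensional)
  qed
  show "\<forall>\<beta>\<in>twisted_cocycles K H D ract. twist (untwist \<beta>) = \<beta>"
  proof
    fix \<beta> assume tw: "\<beta> \<in> twisted_cocycles K H D ract"
    then have \<beta>: "linear_map K CH HH \<beta>" and ext: "\<beta> \<in> extensional (carrier CH)"
      by (simp_all add: twisted_cocycles_iff)
    note \<alpha> = linear_untwist[OF tw]
    show "twist (untwist \<beta>) = \<beta>"
    proof (rule extensionalityI[OF _ ext])
      fix d assume d: "d \<in> carrier CH"
      show "twist (untwist \<beta>) d = \<beta> d"
        by (rule tensor_linear_map_eqI[OF linear_twist[OF \<alpha>] \<beta> _ d C.module_C module_C module_CC])
          (simp add: twist_pure[OF \<alpha>] untwist_pure[OF tw])
    qed (rule twist_extensional)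
  qed
qed

end

theorem proposition2p3:
  fixes K :: "('k, 'p) ring_scheme"
    and H :: "('k, 'h, 'q) hopf_algebra_scheme"
    and C :: "('k, 'c, 'r) coalgebra_scheme"
    and act :: "'c \<Rightarrow> 'h \<Rightarrow> 'c"
  assumes "hopf_algebra K H"
    and "bij_betw (antipode H) (carrier H) (carrier H)"
    and "right_module_coalgebra K H C act"
  shows "\<exists>\<Phi>. bij_betw \<Phi> (harrison_cocycles K H C)
    (twisted_cocycles K H (tensor_coalgebra K C H) (tensor_right_act K C H))"
proof -
  interpret cocycle_setting K H C
    using assms
    by (simp add: cocycle_setting_def bijective_hopf_algebra_def bijective_hopf_algebra_axioms_def
        right_module_coalgebra_def)
  show ?thesis using bij_betw_twist by blast
qed

end
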